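(* (i) For every integer $d>4$ there exist constants $C,c>0$, depending only on $d$, such that for every positive integer $N$, every two points $b,e\in T_N^d$ and every $\lambda>0$, the loop-erasure $L=\mathrm{LE}(R)$ of the random walk $R$ on $T_N^d$ started at $b$ and stopped when it hits $e$ satisfies $$\mathbb{P}\left(\#L>\lambda N^{d/2}\right)\le Ce^{-c\lambda}.$$ (ii) If $d=4$, then for every $\epsilon>0$ there exist constants $C,c>0$, depending only on $\epsilon$, such that for every positive integer $N$, every two points $b,e\in T_N^4$ and every $\lambda>0$, the loop-erasure $L=\mathrm{LE}(R)$ of the random walk $R$ on $T_N^4$ started at $b$ and stopped when it hits $e$ satisfies $$\mathbb{P}\left(\#L>\lambda N^{2+\epsilon}\right)\le Ce^{-c\lambda}.$$
   Context: $T_N^d=\mathbb{Z}^d/(N\mathbb{Z})^d$ is the discrete torus with the graph structure inherited from $\mathbb{Z}^d$. A random walk on $T_N^d$ is the simple (nearest-neighbour) random walk, i.e. the projection to $T_N^d$ of the simple random walk on $\mathbb{Z}^d$. For a finite path $\gamma:\{0,\dots,n\}\to T$ in a graph $T$, its loop-erasure $\mathrm{LE}(\gamma)$ is the simple path defined by $\mathrm{LE}(\gamma)_0:=\gamma(0)$ and $\mathrm{LE}(\gamma)_{i+1}:=\gamma(j_i+1)$, where $j_i:=\max\{j:\gamma(j)=\mathrm{LE}(\gamma)_i\}$, for all $i$ such that $j_i<n$ (the path ends at the first $i$ with $j_i=n$). $\#\mathrm{LE}(\gamma)$ is the number of its vertices. *)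

theory Defs
  imports "HOL-Probability.Probability"
begin

text \<open>
  Points of \<open>\<int>\<^sup>d\<close> are functions \<^typ>\<open>nat \<Rightarrow> int\<close> that vanish from index \<open>d\<close> on, and points of
  the torus \<open>\<int>\<^sup>d / (N\<int>)\<^sup>d\<close> are given by their representatives with coordinates in \<open>{0..<N}\<close>.
\<close>

definition torus :: "nat \<Rightarrow> nat \<Rightarrow> (nat \<Rightarrow> int) set" where
  "torus d N = {x. (\<forall>i<d. 0 \<le> x i \<and> x i < int N) \<and> (\<forall>i\<ge>d. x i = 0)}"

definition torus_proj :: "nat \<Rightarrow> (nat \<Rightarrow> int) \<Rightarrow> (nat \<Rightarrow> int)" where
  "torus_proj N x = (\<lambda>i. x i mod int N)"

text \<open>
  A step \<open>(i, s)\<close> stands for the vector \<open>s e\<^sub>i\<close>; the \<open>2 d\<close> steps are exactly the neighbours of the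
  origin in \<open>\<int>\<^sup>d\<close>. An outcome is an infinite sequence of steps, which are independent and
  uniform on these neighbours.
\<close>

definition srw_steps :: "nat \<Rightarrow> (nat \<times> int) set" where
  "srw_steps d = {..<d} \<times> {-1, 1}"

definition srw_space :: "nat \<Rightarrow> (nat \<Rightarrow> nat \<times> int) measure" where
  "srw_space d = Pi\<^sub>M UNIV (\<lambda>_. measure_pmf (pmf_of_set (srw_steps d)))"

definition step_vec :: "nat \<times> int \<Rightarrow> (nat \<Rightarrow> int)" where
  "step_vec = (\<lambda>(i, s) j. if j = i then s else 0)"

definition srw :: "(nat \<Rightarrow> int) \<Rightarrow> (nat \<Rightarrow> nat \<times> int) \<Rightarrow> nat \<Rightarrow> (nat \<Rightarrow> int)" where
  "srw b \<omega> n = (\<lambda>i. b i + (\<Sum>k<n. step_vec (\<omega> k) i))"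

definition torus_walk ::
  "nat \<Rightarrow> (nat \<Rightarrow> int) \<Rightarrow> (nat \<Rightarrow> nat \<times> int) \<Rightarrow> nat \<Rightarrow> (nat \<Rightarrow> int)" where
  "torus_walk N b \<omega> n = torus_proj N (srw b \<omega> n)"

text \<open>
  The time \<open>0\<close> counts as a hit. The value is unspecified for a path that never visits \<open>e\<close>, which
  for the walk on the torus is an event of probability zero.
\<close>

definition hitting_time :: "(nat \<Rightarrow> 'a) \<Rightarrow> 'a \<Rightarrow> nat" where
  "hitting_time \<gamma> e = (LEAST n. \<gamma> n = e)"

text \<open>
  A finite path \<open>{0..n} \<rightarrow> 'a\<close> is a function on \<^typ>\<open>nat\<close> together with \<open>n\<close>. The values of
  \<open>loop_erasure_nth \<gamma> n i\<close> past the first \<open>i\<close> whose last visit is at time \<open>n\<close> have no meaning;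
  \<open>loop_erasure\<close> cuts them off.
\<close>

definition last_visit :: "(nat \<Rightarrow> 'a) \<Rightarrow> nat \<Rightarrow> 'a \<Rightarrow> nat" where
  "last_visit \<gamma> n v = Max {j. j \<le> n \<and> \<gamma> j = v}"

primrec loop_erasure_nth :: "(nat \<Rightarrow> 'a) \<Rightarrow> nat \<Rightarrow> nat \<Rightarrow> 'a" where
  "loop_erasure_nth \<gamma> n 0 = \<gamma> 0"
| "loop_erasure_nth \<gamma> n (Suc i) = \<gamma> (last_visit \<gamma> n (loop_erasure_nth \<gamma> n i) + 1)"

definition loop_erasure :: "(nat \<Rightarrow> 'a) \<Rightarrow> nat \<Rightarrow> 'a list" where
  "loop_erasure \<gamma> n =
     map (loop_erasure_nth \<gamma> n) [0..<Suc (LEAST i. last_visit \<gamma> n (loop_erasure_nth \<gamma> n i) = n)]"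

definition walk_loop_erasure ::
  "nat \<Rightarrow> (nat \<Rightarrow> int) \<Rightarrow> (nat \<Rightarrow> int) \<Rightarrow> (nat \<Rightarrow> nat \<times> int) \<Rightarrow> (nat \<Rightarrow> int) list" where
  "walk_loop_erasure N b e \<omega> =
     loop_erasure (torus_walk N b \<omega>) (hitting_time (torus_walk N b \<omega>) e)"

lemma last_visit_bounds:
  assumes "k \<le> n"
  shows "k \<le> last_visit \<gamma> n (\<gamma> k) \<and> last_visit \<gamma> n (\<gamma> k) \<le> n"
proof -
  let ?A = "{j. j \<le> n \<and> \<gamma> j = \<gamma> k}"
  have fin: "finite ?A" and mem: "k \<in> ?A"
    using assms by auto
  have "Max ?A \<in> ?A"
    using fin mem by (intro Max_in) blast+
  moreover have "k \<le> Max ?A"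
    using fin mem by (rule Max_ge)
  ultimately show ?thesis
    unfolding last_visit_def by blast
qed

lemma loop_erasure_end_exists:
  "\<exists>i. last_visit \<gamma> n (loop_erasure_nth \<gamma> n i) = n"
proof (rule ccontr)
  assume neg: "\<nexists>i. last_visit \<gamma> n (loop_erasure_nth \<gamma> n i) = n"
  let ?j = "\<lambda>i. last_visit \<gamma> n (loop_erasure_nth \<gamma> n i)"
  note step = last_visit_bounds[of _ n \<gamma>]
  have "i \<le> ?j i \<and> ?j i \<le> n" for i
  proof (induction i)
    case 0
    show ?case using step[of 0] by simp
  next
    case (Suc i)
    then have "?j i < n" using neg le_neq_implies_less by blast
    then show ?case using step[of "Suc (?j i)"] Suc by simp
  qed
  from this[of "Suc n"] have "Suc n \<le> n"
    using order_trans by blast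
  then show False by simp
qed

lemma distinct_loop_erasure: "distinct (loop_erasure \<gamma> n)"
proof -
  let ?j = "\<lambda>i. last_visit \<gamma> n (loop_erasure_nth \<gamma> n i)"
  define m where "m = (LEAST i. ?j i = n)"
  note step = last_visit_bounds[of _ n \<gamma>]
  have not_end: "?j i \<noteq> n" if "i < m" for i
    using not_less_Least that unfolding m_def by blast
  have le: "?j i \<le> n" if "i \<le> m" for i
    using that
  proof (induction i)
    case 0
    show ?case using step[of 0] by simp
  next
    case (Suc i)
    then have "?j i < n" using not_end[of i] by simp
    then show ?case using step[of "Suc (?j i)"] by simp
  qed
  have incr: "?j i < ?j (Suc i)" if "i < m" for i
    using step[of "Suc (?j i)"] le[of i] not_end[of i] that by simp
  have less: "?j i < ?j k" if "i < k" "k \<le> m" for i k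
    using that
  proof (induction k)
    case (Suc k)
    then show ?case using incr[of k] by (cases "i = k") auto
  qed simp
  have "inj_on (loop_erasure_nth \<gamma> n) {0..<Suc m}"
  proof (rule inj_onI)
    fix i k assume "i \<in> {0..<Suc m}" "k \<in> {0..<Suc m}"
      "loop_erasure_nth \<gamma> n i = loop_erasure_nth \<gamma> n k"
    then show "i = k"
      using less[of i k] less[of k i] by (metis atLeastLessThan_iff less_Suc_eq_le less_irrefl nat_neq_iff)
  qed
  then show ?thesis
    by (simp only: loop_erasure_def m_def distinct_map set_upt distinct_upt simp_thms)
qed

lemma prob_space_srw_space: "prob_space (srw_space d)"
  unfolding srw_space_def by (intro prob_space_PiM measure_pmf.prob_space_axioms)

lemma space_srw_space [simp]: "space (srw_space d) = UNIV"
  by (simp add: srw_space_def space_PiM)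

lemma measurable_torus_walk:
  "(\<lambda>\<omega>. torus_walk N b \<omega> n i) \<in> measurable (srw_space d) (count_space UNIV)"
proof -
  have [measurable]: "(\<lambda>\<omega>. \<omega> k) \<in> measurable (srw_space d) (count_space UNIV)" for k
    unfolding srw_space_def
    using measurable_component_singleton[of k UNIV "\<lambda>_. measure_pmf (pmf_of_set (srw_steps d))"]
    by (simp cong: measurable_cong_sets)
  have [measurable]: "(\<lambda>\<omega>. step_vec (\<omega> k) i) \<in> measurable (srw_space d) (count_space UNIV)" for k
    by (rule measurable_compose_countable) simp_all
  have [measurable]: "(\<lambda>\<omega>. \<Sum>k<m. step_vec (\<omega> k) i) \<in> measurable (srw_space d) (count_space UNIV)" for m
  proof (induction m)
    case (Suc m)
    note [measurable] = Suc
    show ?case by simp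
  qed simp
  show ?thesis
    unfolding torus_walk_def torus_proj_def srw_def by measurable
qed

lemma pred_torus_walk_eq:
  "Measurable.pred (srw_space d) (\<lambda>\<omega>. torus_walk N b \<omega> n = torus_walk N b \<omega> m)"
  "Measurable.pred (srw_space d) (\<lambda>\<omega>. torus_walk N b \<omega> n = e)"
proof -
  note [measurable] = measurable_torus_walk
  show "Measurable.pred (srw_space d) (\<lambda>\<omega>. torus_walk N b \<omega> n = torus_walk N b \<omega> m)"
    "Measurable.pred (srw_space d) (\<lambda>\<omega>. torus_walk N b \<omega> n = e)"
    unfolding fun_eq_iff by measurable
qed

lemma measurable_length_loop_erasure:
  fixes \<gamma> :: "'b \<Rightarrow> nat \<Rightarrow> 'a"
  assumes eq [measurable]: "\<And>m k. Measurable.pred M (\<lambda>\<omega>. \<gamma> \<omega> m = \<gamma> \<omega> k)"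
  shows "(\<lambda>\<omega>. length (loop_erasure (\<gamma> \<omega>) n)) \<in> measurable M (count_space UNIV)"
proof -
  define a where "a \<omega> = rec_nat 0 (\<lambda>_ k. Suc (last_visit (\<gamma> \<omega>) n (\<gamma> \<omega> k)))" for \<omega>
  have a0: "a \<omega> 0 = 0" and aS: "a \<omega> (Suc i) = Suc (last_visit (\<gamma> \<omega>) n (\<gamma> \<omega> (a \<omega> i)))" for \<omega> i
    by (simp_all add: a_def)
  have nth: "loop_erasure_nth (\<gamma> \<omega>) n i = \<gamma> \<omega> (a \<omega> i)" for \<omega> i
    by (induction i) (simp_all add: a0 aS)
  have lv [measurable]: "(\<lambda>\<omega>. last_visit (\<gamma> \<omega>) n (\<gamma> \<omega> k)) \<in> measurable M (count_space UNIV)" for k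
    unfolding last_visit_def by measurable
  have am [measurable]: "(\<lambda>\<omega>. a \<omega> i) \<in> measurable M (count_space UNIV)" for i
  proof (induction i)
    case (Suc i)
    note [measurable] = Suc
    have "(\<lambda>\<omega>. last_visit (\<gamma> \<omega>) n (\<gamma> \<omega> (a \<omega> i))) \<in> measurable M (count_space UNIV)"
      by (rule measurable_compose_countable[where g = "\<lambda>\<omega>. a \<omega> i"]) simp_all
    then show ?case unfolding aS by simp
  qed (simp add: a0)
  have [measurable]: "(\<lambda>\<omega>. last_visit (\<gamma> \<omega>) n (\<gamma> \<omega> (a \<omega> i))) \<in> measurable M (count_space UNIV)" for i
    by (rule measurable_compose_countable[where g = "\<lambda>\<omega>. a \<omega> i"]) simp_all
  show ?thesis
    unfolding loop_erasure_def nth by simp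
qed

lemma measurable_walk_loop_erasure:
  "(\<lambda>\<omega>. length (walk_loop_erasure N b e \<omega>)) \<in> measurable (srw_space d) (count_space UNIV)"
proof -
  note [measurable] = pred_torus_walk_eq measurable_length_loop_erasure
  have "(\<lambda>\<omega>. hitting_time (torus_walk N b \<omega>) e) \<in> measurable (srw_space d) (count_space UNIV)"
    unfolding hitting_time_def by measurable
  then show ?thesis
    unfolding walk_loop_erasure_def
    by (rule measurable_compose_countable[rotated]) simp
qed

end

theory Submission imports Defs begin

text \<open>
  Let \<open>p\<^sub>q(\<gamma>)\<close> be the weight of all walks with loop erasure \<open>\<gamma>\<close>, where every step is discounted by \<open>q < 1\<close>.
  It factors into Green functions of decreasing domains, so the total weight of paths of a given length is
  submultiplicative in the length. The logarithmic derivative of \<open>p\<^sub>q(\<gamma>)\<close> in \<open>q\<close> counts the closed walks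
  that meet \<open>\<gamma>\<close>. Short ones contribute at most a constant times the length of \<open>\<gamma>\<close>, up to a logarithm in
  dimension 4, and long ones at most \<open>1 / (1 - q)\<close> plus a constant. Consequently killing at a rate
  \<open>1 / S\<close> with \<open>S\<close> a little larger than \<open>N\<^bsup>d/2\<^esup>\<close> instead of \<open>1 / M\<close>, \<open>M \<approx> N\<^bsup>d\<^esup>\<close>, changes the weight of \<open>\<gamma>\<close>
  by at most the factor \<open>C (M / S) exp (C \<bar>\<gamma>\<bar> / S)\<close>, and the loss \<open>M / S\<close> is compensated by the normalisation \<open>1 / M\<close>.

  For the walk with lifetime \<open>S\<close> a first moment suffices to start the submultiplicative decay: if the loop erasure
  at some time is long, then a second moment argument shows that the future of the walk hits it, because its
  energy is at most that of the whole walk. So the expected length is a small fraction of \<open>S\<close>.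

  Finally, the walk stopped at \<open>e\<close> is at \<open>e\<close> at its last step and, one mixing time earlier, this has
  probability \<open>O(N\<^bsup>-d\<^esup>)\<close> independently of the past, so one may sum over all times.
\<close>

text \<open>Submultiplicativity is useful only if the paths whose lengths lie in one window of width
  about \<open>D\<close> weigh a small multiple of \<open>D\<close> together. All paths weigh at
  most the lifetime, so the lifetime has to be of the order of the length sought, up to powers of
  \<open>H\<close>, while the walk to \<open>e\<close> lives for about N^d steps. Hence the change
  of killing rate. Its cost in the length is \<open>exp (\<theta> * length)\<close> with
  \<open>\<theta> = 2 * H / S\<close>; since \<open>S\<close> is \<open>H ^ 2 * D\<close>, this
  stays below 3 on one window, so the decay survives the tilt.

  All constants are polynomial in one number \<open>H\<close>, which up to constants depending on d
  is 1 plus the sum of n^(1 - d/2) over n < N^2. It is bounded for d > 4 and of order 1 + log N for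
  d = 4, so both statements come from one argument, and the powers of the logarithm become
  N^\<epsilon>. The assumption d \<ge> 4 enters twice: the mixing time, of order N^2, must not
  exceed N^(d/2), and returns between time N^2 and the mixing time must contribute O(1).\<close>

section \<open>Loop erasure of lists\<close>

text \<open>This is the whole list if \<open>x\<close> does not occur in it.\<close>

definition after_last :: "'a \<Rightarrow> 'a list \<Rightarrow> 'a list" where
  "after_last x l = rev (takeWhile (\<lambda>y. y \<noteq> x) (rev l))"

lemma after_last_Nil [simp]: "after_last x [] = []"
  by (simp add: after_last_def)

lemma length_after_last: "length (after_last x l) \<le> length l"
  by (simp add: after_last_def) (metis length_rev length_takeWhile_le)

lemma notin_after_last: "x \<notin> set (after_last x l)"
  by (auto simp: after_last_def dest: set_takeWhileD)

lemma after_last_id: "x \<notin> set l \<Longrightarrow> after_last x l = l"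
  unfolding after_last_def by (subst takeWhile_eq_all_conv[THEN iffD2]) auto

lemma after_last_append:
  "after_last x (l @ r) = (if x \<in> set r then after_last x r else after_last x l @ r)"
proof (cases "x \<in> set r")
  case False
  then have "takeWhile (\<lambda>y. y \<noteq> x) (rev r @ rev l) = rev r @ takeWhile (\<lambda>y. y \<noteq> x) (rev l)"
    by (intro takeWhile_append2) auto
  then show ?thesis using False by (simp add: after_last_def)
qed (auto simp: after_last_def takeWhile_append1)

lemma after_last_Cons:
  "after_last x (y # l) = (if x \<in> set l then after_last x l else if y = x then l else y # l)"
  using after_last_append[of x "[y]" l] by (auto simp: after_last_def)

lemma after_last_Cons_same: "after_last x (x # l) = after_last x l"
  by (simp add: after_last_Cons after_last_id)

lemma after_last_snoc: "after_last x (l @ [x]) = []"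
  by (simp add: after_last_append after_last_def)

lemma after_last_split:
  "x \<in> set l \<Longrightarrow> \<exists>u. l = u @ x # after_last x l"
proof (induction l)
  case (Cons y l)
  show ?case
  proof (cases "x \<in> set l")
    case True
    then obtain u where "l = u @ x # after_last x l" using Cons by blast
    then show ?thesis using True by (intro exI[of _ "y # u"]) (simp add: after_last_Cons)
  next
    case False
    then show ?thesis using Cons by (intro exI[of _ "[]"]) (auto simp: after_last_Cons)
  qed
qed simp

lemma set_after_last: "set (after_last x l) \<subseteq> set l"
  by (auto simp: after_last_def dest: set_takeWhileD)

function (sequential) LE :: "'a list \<Rightarrow> 'a list" where
  "LE [] = []"
| "LE (x # l) = x # LE (after_last x l)"
  by pat_completeness auto
termination by (relation "Wellfounded.measure length") (auto simp: length_after_last le_imp_less_Suc)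

lemma LE_Nil_iff [simp]: "LE l = [] \<longleftrightarrow> l = []"
  by (cases l) auto

lemma set_LE: "set (LE l) \<subseteq> set l"
proof (induction l rule: LE.induct)
  case (2 x l)
  then show ?case using set_after_last[of x l] by auto
qed simp

lemma distinct_LE: "distinct (LE l)"
proof (induction l rule: LE.induct)
  case (2 x l)
  then show ?case using set_LE[of "after_last x l"] notin_after_last[of x l] by auto
qed simp

lemma length_LE: "length (LE l) \<le> length l"
proof (induction l rule: LE.induct)
  case (2 x l)
  then show ?case using length_after_last[of x l] by simp
qed simp

text \<open>Erasing loops can only shorten what \<open>r\<close> adds. This lets the length at a
  hitting time be read off one mixing time earlier, at a cost of \<open>g\<close> vertices.\<close>

lemma length_LE_append: "length (LE (l @ r)) \<le> length (LE l) + length r"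
proof (induction l rule: LE.induct)
  case 1
  then show ?case by (simp add: length_LE)
next
  case (2 x l)
  show ?case
  proof (cases "x \<in> set r")
    case True
    then have "LE ((x # l) @ r) = x # LE (after_last x r)"
      by (simp add: after_last_append)
    then show ?thesis
      using length_LE[of "after_last x r"] length_after_last[of x r] by simp
  next
    case False
    then show ?thesis using 2 by (simp add: after_last_append)
  qed
qed

text \<open>\<open>m\<close> is the time of the last visit to the \<open>j\<close>-th vertex of the
  loop erasure: afterwards the current loop erasure is never met again, so that it is final. The
  hitting estimates make such times rare.\<close>

lemma LE_prefix_time:
  assumes "1 \<le> j" "j \<le> length (LE l)"
  shows "\<exists>m<length l. LE (take (Suc m) l) = take j (LE l) \<and>
           set (LE (take (Suc m) l)) \<inter> set (drop (Suc m) l) = {}"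
  using assms
proof (induction l arbitrary: j rule: LE.induct)
  case (2 x l)
  define v where "v = after_last x l"
  \<comment> \<open>\<open>u\<close> is the list up to and including the last \<open>x\<close>. It
    erases to \<open>[x]\<close>, and nothing that follows can undo this vertex.\<close>
  obtain u where u: "x # l = u @ v" "u \<noteq> []" "LE u = [x]"
    "\<And>w. x \<notin> set w \<Longrightarrow> LE (u @ w) = x # LE w"
  proof (cases "x \<in> set l")
    case True
    then obtain u0 where u0: "l = u0 @ x # v" unfolding v_def using after_last_split by metis
    show ?thesis
      by (rule that[of "x # u0 @ [x]"]) (use u0 in \<open>auto simp: after_last_append after_last_Cons\<close>)
  next
    case False
    show ?thesis
      by (rule that[of "[x]"]) (use False in \<open>auto simp: v_def after_last_id\<close>)
  qed
  have xv: "x \<notin> set v" unfolding v_def by (rule notin_after_last)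
  show ?case
  proof (cases "j = 1")
    case True
    show ?thesis
      by (rule exI[of _ "length u - 1"]) (use True u xv in \<open>auto simp: neq_Nil_conv\<close>)
  next
    case False
    then have "1 \<le> j - 1" "j - 1 \<le> length (LE v)" using 2 by (auto simp: v_def)
    from 2(1)[folded v_def, OF this] obtain m where m: "m < length v"
      "LE (take (Suc m) v) = take (j - 1) (LE v)"
      "set (LE (take (Suc m) v)) \<inter> set (drop (Suc m) v) = {}" by auto
    have t: "take (Suc (length u + m)) (x # l) = u @ take (Suc m) v"
      and dr: "drop (Suc (length u + m)) (x # l) = drop (Suc m) v"
      unfolding u(1) by (simp_all add: Suc_diff_le)
    have xt: "x \<notin> set (take (Suc m) v)" using xv by (meson in_set_takeD)
    have lt: "LE (take (Suc (length u + m)) (x # l)) = x # take (j - 1) (LE v)"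
      unfolding t using u(4)[OF xt] m by simp
    have "length u + m < length (x # l)" using m(1) unfolding u(1) by simp
    moreover have "x # take (j - 1) (LE v) = take j (LE (x # l))"
      using False 2(2) by (cases j) (auto simp: v_def)
    moreover have "x \<notin> set (drop (Suc m) v)" using xv by (meson in_set_dropD)
    ultimately show ?thesis
    proof (intro exI[of _ "length u + m"] conjI)
      assume *: "x # take (j - 1) (LE v) = take j (LE (x # l))" "x \<notin> set (drop (Suc m) v)"
      show "LE (take (Suc (length u + m)) (x # l)) = take j (LE (x # l))"
        by (rule trans[OF lt *(1)])
      show "set (LE (take (Suc (length u + m)) (x # l))) \<inter> set (drop (Suc (length u + m)) (x # l)) = {}"
        unfolding lt dr using m *(2) by auto
    qed
  qed
qed simp

text \<open>Distinct points of the loop erasure are last left at times with loop erasures of distinct lengths.\<close>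

lemma length_LE_le_card:
  "length (LE l) \<le> D + card {m. m < length l \<and> D < length (LE (take (Suc m) l)) \<and>
     set (LE (take (Suc m) l)) \<inter> set (drop (Suc m) l) = {}}"
proof -
  let ?M = "{m. m < length l \<and> D < length (LE (take (Suc m) l)) \<and>
     set (LE (take (Suc m) l)) \<inter> set (drop (Suc m) l) = {}}"
  have "{D<..length (LE l)} \<subseteq> (\<lambda>m. length (LE (take (Suc m) l))) ` ?M"
  proof
    fix j assume j: "j \<in> {D<..length (LE l)}"
    then obtain m where m: "m<length l" "LE (take (Suc m) l) = take j (LE l)"
           "set (LE (take (Suc m) l)) \<inter> set (drop (Suc m) l) = {}"
      using LE_prefix_time[of j l] by auto
    then show "j \<in> (\<lambda>m. length (LE (take (Suc m) l))) ` ?M"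
      using j by (intro image_eqI[of _ _ m]) auto
  qed
  then have "card {D<..length (LE l)} \<le> card ?M"
    by (intro surj_card_le) simp_all
  then show ?thesis by simp
qed

section \<open>Agreement of the indexed loop erasure with the list recursion\<close>

lemma loop_erasure_end:
  assumes "last_visit \<gamma> n (\<gamma> 0) = n"
  shows "loop_erasure \<gamma> n = [\<gamma> 0]"
proof -
  have "(LEAST i. last_visit \<gamma> n (loop_erasure_nth \<gamma> n i) = n) = 0"
    using assms by (intro Least_eq_0) simp
  then show ?thesis by (simp add: loop_erasure_def)
qed

lemma loop_erasure_step:
  assumes j: "last_visit \<gamma> n (\<gamma> 0) = j" "j < n"
  shows "loop_erasure \<gamma> n = \<gamma> 0 # loop_erasure (\<lambda>i. \<gamma> (Suc j + i)) (n - Suc j)"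
proof -
  define \<gamma>' where "\<gamma>' = (\<lambda>i. \<gamma> (Suc j + i))"
  define n' where "n' = n - Suc j"
  \<comment> \<open>A point of the shifted path is visited after time \<open>j\<close>, so visits up
    to \<open>j\<close> do not affect the maximum and last visits are just shifted by
    \<open>Suc j\<close>.\<close>
  have lv: "last_visit \<gamma> n (\<gamma>' k) = Suc j + last_visit \<gamma>' n' (\<gamma>' k) \<and> last_visit \<gamma>' n' (\<gamma>' k) \<le> n'"
    if "k \<le> n'" for k
  proof -
    let ?B = "{i. i \<le> n' \<and> \<gamma>' i = \<gamma>' k}"
    have m: "last_visit \<gamma>' n' (\<gamma>' k) \<in> ?B"
      unfolding last_visit_def using that by (intro Max_in) auto
    have "last_visit \<gamma> n (\<gamma>' k) = Suc j + last_visit \<gamma>' n' (\<gamma>' k)"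
      unfolding last_visit_def[of \<gamma> n]
    proof (rule Max_eqI)
      show "finite {i. i \<le> n \<and> \<gamma> i = \<gamma>' k}" by auto
      show "Suc j + last_visit \<gamma>' n' (\<gamma>' k) \<in> {i. i \<le> n \<and> \<gamma> i = \<gamma>' k}"
        using m j by (auto simp: n'_def \<gamma>'_def)
      fix i assume i: "i \<in> {i. i \<le> n \<and> \<gamma> i = \<gamma>' k}"
      show "i \<le> Suc j + last_visit \<gamma>' n' (\<gamma>' k)"
      proof (cases "i \<le> j")
        case False
        then have "i - Suc j \<in> ?B" using i by (auto simp: n'_def \<gamma>'_def)
        then have "i - Suc j \<le> last_visit \<gamma>' n' (\<gamma>' k)"
          unfolding last_visit_def by (intro Max_ge) auto
        then show ?thesis by simp
      qed simp
    qed
    then show ?thesis using m by simp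
  qed
  define m where "m = (LEAST i. last_visit \<gamma>' n' (loop_erasure_nth \<gamma>' n' i) = n')"
  have not_end: "last_visit \<gamma>' n' (loop_erasure_nth \<gamma>' n' i) \<noteq> n'" if "i < m" for i
    using not_less_Least that unfolding m_def by blast
  have m_end: "last_visit \<gamma>' n' (loop_erasure_nth \<gamma>' n' m) = n'"
    unfolding m_def by (rule LeastI_ex) (rule loop_erasure_end_exists)
  have nth: "loop_erasure_nth \<gamma> n (Suc i) = loop_erasure_nth \<gamma>' n' i \<and>
      (\<exists>k\<le>n'. loop_erasure_nth \<gamma>' n' i = \<gamma>' k)" if "i \<le> m" for i
    using that
  proof (induction i)
    case 0
    show ?case using j by (auto simp: \<gamma>'_def n'_def)
  next
    case (Suc i)
    then obtain k where k: "k \<le> n'" "loop_erasure_nth \<gamma>' n' i = \<gamma>' k"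
      "loop_erasure_nth \<gamma> n (Suc i) = \<gamma>' k" by auto
    have "last_visit \<gamma>' n' (\<gamma>' k) < n'"
      using not_end[of i] Suc lv[OF k(1)] k by auto
    have "loop_erasure_nth \<gamma> n (Suc (Suc i)) = \<gamma> (last_visit \<gamma> n (\<gamma>' k) + 1)"
      using k(3) by simp
    also have "\<dots> = \<gamma>' (Suc (last_visit \<gamma>' n' (\<gamma>' k)))"
      using lv[OF k(1)] by (simp add: \<gamma>'_def)
    finally have "loop_erasure_nth \<gamma> n (Suc (Suc i)) = \<gamma>' (Suc (last_visit \<gamma>' n' (\<gamma>' k)))" .
    moreover have "loop_erasure_nth \<gamma>' n' (Suc i) = \<gamma>' (Suc (last_visit \<gamma>' n' (\<gamma>' k)))"
      using k(2) by simp
    ultimately show ?case using \<open>last_visit \<gamma>' n' (\<gamma>' k) < n'\<close> by (metis Suc_leI)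
  qed
  have lv': "last_visit \<gamma> n (loop_erasure_nth \<gamma> n (Suc i)) =
      Suc j + last_visit \<gamma>' n' (loop_erasure_nth \<gamma>' n' i)" if "i \<le> m" for i
    using nth[OF that] lv by metis
  have nn: "n = Suc j + n'" using j by (simp add: n'_def)
  have "(LEAST i. last_visit \<gamma> n (loop_erasure_nth \<gamma> n i) = n) = Suc m"
  proof (rule Least_equality)
    show "last_visit \<gamma> n (loop_erasure_nth \<gamma> n (Suc m)) = n"
      using lv'[of m] m_end nn by simp
    fix y assume y: "last_visit \<gamma> n (loop_erasure_nth \<gamma> n y) = n"
    show "Suc m \<le> y"
    proof (rule ccontr)
      assume "\<not> Suc m \<le> y"
      then have "y \<le> m" by simp
      show False
      proof (cases y)
        case 0
        then show ?thesis using y j by simp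
      next
        case (Suc i)
        then show ?thesis using y lv'[of i] not_end[of i] \<open>y \<le> m\<close> nn by simp
      qed
    qed
  qed
  then have "loop_erasure \<gamma> n = map (loop_erasure_nth \<gamma> n) (0 # map Suc [0..<Suc m])"
    unfolding loop_erasure_def by (metis map_Suc_upt upt_conv_Cons zero_less_Suc)
  also have "\<dots> = \<gamma> 0 # map (\<lambda>i. loop_erasure_nth \<gamma> n (Suc i)) [0..<Suc m]"
    by (simp add: o_def)
  also have "map (\<lambda>i. loop_erasure_nth \<gamma> n (Suc i)) [0..<Suc m] = map (loop_erasure_nth \<gamma>' n') [0..<Suc m]"
    using nth by (intro map_cong) auto
  finally show ?thesis
    unfolding loop_erasure_def m_def \<gamma>'_def n'_def .
qed

text \<open>Cutting at the last visit to the starting vertex matches one unfolding of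
  \<open>LE\<close>. The induction is strong because the rest of the path can be shorter by any
  amount.\<close>

lemma loop_erasure_eq_LE: "loop_erasure \<gamma> n = LE (map \<gamma> [0..<Suc n])"
proof (induction n arbitrary: \<gamma> rule: less_induct)
  case (less n)
  define j where "j = last_visit \<gamma> n (\<gamma> 0)"
  have "last_visit \<gamma> n (\<gamma> 0) \<in> {i. i \<le> n \<and> \<gamma> i = \<gamma> 0}"
    unfolding last_visit_def by (intro Max_in) auto
  then have jn: "j \<le> n" and \<gamma>j: "\<gamma> j = \<gamma> 0" by (simp_all add: j_def)
  have max: "i \<le> j" if "i \<le> n" "\<gamma> i = \<gamma> 0" for i
    unfolding j_def last_visit_def using that by (intro Max_ge) auto
  define rest where "rest = map \<gamma> [Suc j..<Suc n]"
  have "\<gamma> 0 \<notin> \<gamma> ` {Suc j..<Suc n}"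
  proof
    assume "\<gamma> 0 \<in> \<gamma> ` {Suc j..<Suc n}"
    then obtain i where "i \<in> {Suc j..<Suc n}" "\<gamma> 0 = \<gamma> i" by (rule imageE)
    then show False using max[of i] by simp
  qed
  then have notin: "\<gamma> 0 \<notin> set rest" by (simp only: rest_def set_map set_upt not_False_eq_True)
  have "[0..<Suc j + (n - j)] = [0..<Suc j] @ [Suc j..<Suc j + (n - j)]"
    by (intro upt_add_eq_append) simp
  then have upt: "[0..<Suc n] = [0..<j] @ [j] @ [Suc j..<Suc n]"
    using jn by simp
  have "map \<gamma> [0..<Suc n] = (map \<gamma> [0..<j] @ [\<gamma> 0]) @ rest"
    unfolding upt rest_def map_append by (simp only: list.map \<gamma>j append_assoc)
  then have al: "after_last (\<gamma> 0) (map \<gamma> [0..<Suc n]) = rest"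
    by (simp only: after_last_append[of _ _ rest] notin after_last_snoc if_False append_Nil)
  have c: "map \<gamma> [0..<Suc n] = \<gamma> 0 # map \<gamma> [1..<Suc n]"
    by (simp add: upt_conv_Cons del: upt_Suc)
  have al': "after_last (\<gamma> 0) (map \<gamma> [1..<Suc n]) = rest"
    using al unfolding c after_last_Cons_same .
  show ?case
  proof (cases "j = n")
    case True
    then show ?thesis
      using loop_erasure_end[of \<gamma> n] al' unfolding c by (simp add: rest_def j_def)
  next
    case False
    then have jn: "j < n" using jn by simp
    have "[Suc j..<Suc n] = map (\<lambda>i. i + Suc j) [0..<Suc (n - Suc j)]"
      using jn by (subst map_add_upt) simp
    then have "rest = map (\<lambda>i. \<gamma> (Suc j + i)) [0..<Suc (n - Suc j)]"
      unfolding rest_def by (simp only: map_map o_def add.commute[of _ "Suc j"])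
    then have "LE rest = loop_erasure (\<lambda>i. \<gamma> (Suc j + i)) (n - Suc j)"
      using less[of "n - Suc j" "\<lambda>i. \<gamma> (Suc j + i)"] jn by simp
    then show ?thesis
      using loop_erasure_step[OF j_def[symmetric] jn] al' unfolding c by simp
  qed
qed

section \<open>Finite symmetric Markov chains\<close>

locale finite_chain =
  fixes V :: "'a set" and P :: "'a \<Rightarrow> 'a \<Rightarrow> real"
  assumes finV: "finite V"
    and P_nonneg: "0 \<le> P x y"
    and P_sym: "x \<in> V \<Longrightarrow> y \<in> V \<Longrightarrow> P x y = P y x"
    and P_sum: "x \<in> V \<Longrightarrow> (\<Sum>y\<in>V. P x y) = 1"
begin

text \<open>Walks killed on leaving \<open>A\<close>. Membership is tested at every step, so the
  weight vanishes unless both endpoints lie in \<open>A\<close>.\<close>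

primrec pk :: "'a set \<Rightarrow> nat \<Rightarrow> 'a \<Rightarrow> 'a \<Rightarrow> real" where
  "pk A 0 = (\<lambda>x y. of_bool (x \<in> A \<and> x = y))"
| "pk A (Suc n) = (\<lambda>x y. of_bool (x \<in> A) * (\<Sum>z\<in>A. P x z * pk A n z y))"

text \<open>Expectation over the list of the first \<open>Suc n\<close> positions, as a finite
  recursion; measure theory is thus confined to the final transfer.\<close>

primrec EE :: "nat \<Rightarrow> 'a \<Rightarrow> ('a list \<Rightarrow> real) \<Rightarrow> real" where
  "EE 0 = (\<lambda>x f. f [x])"
| "EE (Suc n) = (\<lambda>x f. \<Sum>z\<in>V. P x z * EE n z (\<lambda>l. f (x # l)))"

lemma pk_nonneg: "0 \<le> pk A n x y"
  by (induction n arbitrary: x) (auto intro!: mult_nonneg_nonneg sum_nonneg P_nonneg)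

lemma pk_out1: "x \<notin> A \<Longrightarrow> pk A n x y = 0"
  by (cases n) auto

lemma pk_out2: "y \<notin> A \<Longrightarrow> pk A n x y = 0"
  by (induction n arbitrary: x) auto

lemma pk_mono:
  assumes "A \<subseteq> B" "B \<subseteq> V"
  shows "pk A n x y \<le> pk B n x y"
proof (induction n arbitrary: x)
  case (Suc n)
  have "(\<Sum>z\<in>A. P x z * pk A n z y) \<le> (\<Sum>z\<in>A. P x z * pk B n z y)"
    by (intro sum_mono mult_left_mono Suc P_nonneg)
  also have "\<dots> \<le> (\<Sum>z\<in>B. P x z * pk B n z y)"
    using assms finV by (intro sum_mono2) (auto intro: finite_subset mult_nonneg_nonneg P_nonneg pk_nonneg)
  finally show ?case
    using assms by (auto intro!: sum_nonneg mult_nonneg_nonneg P_nonneg pk_nonneg)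
qed (use assms in auto)

lemma pk_sum_V: "x \<in> V \<Longrightarrow> (\<Sum>y\<in>V. pk V n x y) = 1"
proof (induction n arbitrary: x)
  case 0
  then show ?case using finV by (simp add: sum.If_cases of_bool_def)
next
  case (Suc n)
  have "(\<Sum>y\<in>V. pk V (Suc n) x y) = (\<Sum>z\<in>V. P x z * (\<Sum>y\<in>V. pk V n z y))"
    using Suc by (subst sum_distrib_left) (simp, rule sum.swap)
  also have "\<dots> = 1" using Suc by (simp add: P_sum)
  finally show ?case .
qed

lemma pk_le_1: "pk V n x y \<le> 1"
proof (cases "x \<in> V \<and> y \<in> V")
  case True
  then have "pk V n x y \<le> (\<Sum>y\<in>V. pk V n x y)"
    by (intro member_le_sum pk_nonneg finV) auto
  then show ?thesis using True pk_sum_V by simp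
qed (auto simp: pk_out1 pk_out2)

lemma pk_le_1': "A \<subseteq> V \<Longrightarrow> pk A n x y \<le> 1"
  using pk_mono[of A V n x y] pk_le_1[of n x y] by simp

lemma pk_add:
  assumes "finite A"
  shows "pk A (m + n) x y = (\<Sum>z\<in>A. pk A m x z * pk A n z y)"
proof (induction m arbitrary: x)
  case 0
  show ?case
  proof (cases "x \<in> A")
    case True
    have "(\<Sum>z\<in>A. pk A 0 x z * pk A n z y) = (\<Sum>z\<in>A. if x = z then pk A n z y else 0)"
      by (rule sum.cong) (use True in auto)
    then show ?thesis using assms True by simp
  qed (simp add: pk_out1)
next
  case (Suc m)
  show ?case
  proof (cases "x \<in> A")
    case True
    have "pk A (Suc m + n) x y = (\<Sum>w\<in>A. P x w * (\<Sum>z\<in>A. pk A m w z * pk A n z y))"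
      using True Suc by simp
    also have "\<dots> = (\<Sum>w\<in>A. \<Sum>z\<in>A. P x w * pk A m w z * pk A n z y)"
      by (simp add: sum_distrib_left mult.assoc)
    also have "\<dots> = (\<Sum>z\<in>A. \<Sum>w\<in>A. P x w * pk A m w z * pk A n z y)"
      by (rule sum.swap)
    also have "\<dots> = (\<Sum>z\<in>A. pk A (Suc m) x z * pk A n z y)"
      using True by (simp add: sum_distrib_right)
    finally show ?thesis .
  qed (simp add: pk_out1)
qed

lemma pk_1: "finite A \<Longrightarrow> x \<in> A \<Longrightarrow> y \<in> A \<Longrightarrow> pk A 1 x y = P x y"
proof -
  assume A: "finite A" "x \<in> A" "y \<in> A"
  have "(\<Sum>z\<in>A. P x z * of_bool (z \<in> A \<and> z = y)) = (\<Sum>z\<in>A. if z = y then P x z else 0)"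
    by (rule sum.cong) auto
  then show ?thesis using A by simp
qed

lemma pk_sym: "pk V n x y = pk V n y x"
proof (cases "x \<in> V \<and> y \<in> V")
  case True
  then show ?thesis
  proof (induction n arbitrary: x)
    case (Suc n)
    have "pk V (Suc n) x y = (\<Sum>z\<in>V. pk V n y z * pk V 1 z x)"
      using Suc by (simp del: One_nat_def add: pk_1 finV P_sym mult.commute)
    also have "\<dots> = pk V (n + 1) y x" by (rule pk_add[OF finV, symmetric])
    finally show ?case by (simp del: pk.simps)
  qed auto
qed (auto simp: pk_out1 pk_out2)

lemma EE_cong:
  assumes "x \<in> V" "\<And>l. length l = Suc n \<Longrightarrow> set l \<subseteq> V \<Longrightarrow> hd l = x \<Longrightarrow> f l = g l"
  shows "EE n x f = EE n x g"
  using assms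
proof (induction n arbitrary: x f g)
  case (Suc n)
  have "EE n z (\<lambda>l. f (x # l)) = EE n z (\<lambda>l. g (x # l))" if "z \<in> V" for z
    by (rule Suc.IH) (use that Suc.prems in auto)
  then show ?case by simp
qed auto

lemma EE_mono:
  assumes "x \<in> V" "\<And>l. length l = Suc n \<Longrightarrow> set l \<subseteq> V \<Longrightarrow> hd l = x \<Longrightarrow> f l \<le> g l"
  shows "EE n x f \<le> EE n x g"
  using assms
proof (induction n arbitrary: x f g)
  case (Suc n)
  have "EE n z (\<lambda>l. f (x # l)) \<le> EE n z (\<lambda>l. g (x # l))" if "z \<in> V" for z
    by (rule Suc.IH) (use that Suc.prems in auto)
  then show ?case by (simp add: sum_mono mult_left_mono P_nonneg)
qed auto

lemma EE_add: "EE n x (\<lambda>l. f l + g l) = EE n x f + EE n x g"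
  by (induction n arbitrary: x f g) (simp_all add: sum.distrib distrib_left)

lemma EE_cmult: "EE n x (\<lambda>l. c * f l) = c * EE n x f"
  by (induction n arbitrary: x f) (simp_all add: sum_distrib_left mult.left_commute)

lemma EE_diff: "EE n x (\<lambda>l. f l - g l) = EE n x f - EE n x g"
  using EE_add[of n x f "\<lambda>l. (-1) * g l"] EE_cmult[of n x "-1" g] by simp

lemma EE_0 [simp]: "EE n x (\<lambda>l. 0) = 0"
  by (induction n arbitrary: x) simp_all

lemma EE_const: "x \<in> V \<Longrightarrow> EE n x (\<lambda>l. c) = c"
  by (induction n arbitrary: x) (simp_all add: P_sum sum_distrib_right[symmetric])

lemma EE_sum: "EE n x (\<lambda>l. \<Sum>i\<in>I. f i l) = (\<Sum>i\<in>I. EE n x (f i))"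
  by (induction I rule: infinite_finite_induct) (simp_all add: EE_add)

lemma EE_nonneg: "x \<in> V \<Longrightarrow> (\<And>l. 0 \<le> f l) \<Longrightarrow> 0 \<le> EE n x f"
  using EE_mono[of x n "\<lambda>_. 0" f] by simp

lemma EE_le: "x \<in> V \<Longrightarrow> (\<And>l. f l \<le> c) \<Longrightarrow> EE n x f \<le> c"
  using EE_mono[of x n f "\<lambda>_. c"] by (simp add: EE_const)

text \<open>The position at time \<open>m\<close> is both the last entry of \<open>l\<close> and the
  first of \<open>r\<close>; \<open>butlast\<close> keeps it from appearing twice.\<close>

lemma EE_markov:
  "EE (m + n) x f = EE m x (\<lambda>l. EE n (last l) (\<lambda>r. f (butlast l @ r)))"
proof (induction m arbitrary: x f)
  case (Suc m)
  have "EE m z (\<lambda>l. EE n (last l) (\<lambda>r. f (x # butlast l @ r)))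
     = EE m z (\<lambda>l. EE n (last (x # l)) (\<lambda>r. f (butlast (x # l) @ r)))" if "z \<in> V" for z
    by (rule EE_cong[OF that]) auto
  then show ?case using Suc by simp
qed simp

lemma EE_nth:
  assumes "i \<le> n" "x \<in> V"
  shows "EE n x (\<lambda>l. h (l ! i)) = (\<Sum>y\<in>V. pk V i x y * h y)"
  using assms
proof (induction n arbitrary: x i)
  case 0
  then have "(\<Sum>y\<in>V. pk V i x y * h y) = (\<Sum>y\<in>V. if x = y then h y else 0)"
    by (intro sum.cong) auto
  then show ?case using 0 finV by simp
next
  case (Suc n)
  show ?case
  proof (cases i)
    case 0
    have "(\<Sum>y\<in>V. pk V i x y * h y) = (\<Sum>y\<in>V. if x = y then h y else 0)"
      using Suc.prems 0 by (intro sum.cong) auto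
    moreover have "(\<Sum>z\<in>V. P x z * EE n z (\<lambda>l. h x)) = (\<Sum>z\<in>V. P x z * h x)"
      by (intro sum.cong) (auto simp: EE_const)
    ultimately show ?thesis using 0 finV Suc.prems by (simp add: sum_distrib_right[symmetric] P_sum)
  next
    case (Suc j)
    have "EE (Suc n) x (\<lambda>l. h (l ! i)) = (\<Sum>z\<in>V. P x z * (\<Sum>y\<in>V. pk V j z y * h y))"
      using Suc Suc.prems Suc.IH[of j] by simp
    also have "\<dots> = (\<Sum>y\<in>V. \<Sum>z\<in>V. P x z * pk V j z y * h y)"
      by (subst sum.swap) (simp add: sum_distrib_left mult.assoc)
    also have "\<dots> = (\<Sum>y\<in>V. pk V i x y * h y)"
      using Suc Suc.prems by (simp add: sum_distrib_right)
    finally show ?thesis .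
  qed
qed

lemma EE_nth2:
  assumes "i \<le> j" "j \<le> n" "x \<in> V"
  shows "EE n x (\<lambda>l. h (l ! i) (l ! j)) = (\<Sum>y\<in>V. \<Sum>z\<in>V. pk V i x y * pk V (j - i) y z * h y z)"
proof -
  have "EE n x (\<lambda>l. h (l ! i) (l ! j)) = EE (i + (n - i)) x (\<lambda>l. h (l ! i) (l ! j))"
    using assms by simp
  also have "\<dots> = EE i x (\<lambda>l. EE (n - i) (last l) (\<lambda>r. h ((butlast l @ r) ! i) ((butlast l @ r) ! j)))"
    by (rule EE_markov)
  also have "\<dots> = EE i x (\<lambda>l. (\<lambda>y. \<Sum>z\<in>V. pk V (j - i) y z * h y z) (l ! i))"
  proof (rule EE_cong[OF assms(3)])
    fix l :: "'a list" assume l: "length l = Suc i" "set l \<subseteq> V"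
    then have last: "last l = l ! i" "l ! i \<in> V"
      by (cases l rule: rev_cases; auto simp: nth_append)+
    have "EE (n - i) (last l) (\<lambda>r. h ((butlast l @ r) ! i) ((butlast l @ r) ! j))
      = EE (n - i) (last l) (\<lambda>r. h (l ! i) (r ! (j - i)))"
    proof (rule EE_cong)
      fix r :: "'a list" assume r: "length r = Suc (n - i)" "hd r = last l"
      then have "r ! 0 = l ! i" using last by (cases r) auto
      then show "h ((butlast l @ r) ! i) ((butlast l @ r) ! j) = h (l ! i) (r ! (j - i))"
        using l assms by (simp add: nth_append)
    qed (use last in auto)
    also have "\<dots> = (\<Sum>z\<in>V. pk V (j - i) (l ! i) z * h (l ! i) z)"
      using assms last by (simp add: EE_nth[of "j - i"])
    finally show "EE (n - i) (last l) (\<lambda>r. h ((butlast l @ r) ! i) ((butlast l @ r) ! j)) = \<dots>" .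
  qed
  also have "\<dots> = (\<Sum>y\<in>V. pk V i x y * (\<Sum>z\<in>V. pk V (j - i) y z * h y z))"
    using EE_nth[OF order.refl assms(3)] .
  finally show ?thesis by (simp add: sum_distrib_left mult.assoc)
qed

end

section \<open>Decomposition at last visits\<close>

context finite_chain
begin

lemma EE_eq_0:
  assumes "x \<in> V" "\<And>l. length l = Suc n \<Longrightarrow> set l \<subseteq> V \<Longrightarrow> hd l = x \<Longrightarrow> f l = 0"
  shows "EE n x f = 0"
  using EE_cong[of x n f "\<lambda>_. 0"] assms by simp

text \<open>Contribution of the \<open>r\<close> steps after the last visit to \<open>x\<close>, which avoid \<open>x\<close>; \<open>F\<close> sees only these.\<close>

definition last_exit :: "'a set \<Rightarrow> 'a \<Rightarrow> ('a list \<Rightarrow> real) \<Rightarrow> nat \<Rightarrow> real" where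
  "last_exit A x F r = (case r of 0 \<Rightarrow> F []
     | Suc r \<Rightarrow> \<Sum>z\<in>V. P x z * EE r z (\<lambda>l. of_bool (set l \<subseteq> A - {x}) * F l))"

text \<open>Last-exit decomposition, \<open>m\<close> being the time of the last visit to
  \<open>x\<close>: up to \<open>m\<close> the walk only has to stay in \<open>A\<close>, afterwards
  it must avoid \<open>x\<close> as well.\<close>

lemma EE_after_last:
  assumes A: "A \<subseteq> V" and x: "x \<in> A" and y: "y \<in> V"
  shows "EE n y (\<lambda>l. of_bool (set l \<subseteq> A \<and> x \<in> set l) * F (after_last x l))
    = (\<Sum>m\<le>n. pk A m y x * last_exit A x F (n - m))"
  using y
proof (induction n arbitrary: y)
  case 0
  then show ?case using x by (auto simp: last_exit_def after_last_Cons)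
next
  case (Suc n)
  \<comment> \<open>Either \<open>x\<close> occurs again, and the first vertex only has to lie in
    \<open>A\<close>, or the first vertex is itself the last visit.\<close>
  have pw: "of_bool (set (y # l) \<subseteq> A \<and> x \<in> set (y # l)) * F (after_last x (y # l))
     = of_bool (y \<in> A) * (of_bool (set l \<subseteq> A \<and> x \<in> set l) * F (after_last x l))
       + of_bool (y = x) * (of_bool (set l \<subseteq> A - {x}) * F l)" for l
    using x by (auto simp: after_last_Cons)
  have sumA: "(\<Sum>z\<in>V. P y z * pk A m z x) = (\<Sum>z\<in>A. P y z * pk A m z x)" for m
    using A finV by (intro sum.mono_neutral_right) (auto simp: pk_out1)
  have "EE (Suc n) y (\<lambda>l. of_bool (set l \<subseteq> A \<and> x \<in> set l) * F (after_last x l))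
     = (\<Sum>z\<in>V. P y z * (of_bool (y \<in> A) * (\<Sum>m\<le>n. pk A m z x * last_exit A x F (n - m))
         + of_bool (y = x) * EE n z (\<lambda>l. of_bool (set l \<subseteq> A - {x}) * F l)))"
    unfolding EE.simps pw EE_add EE_cmult by (intro sum.cong refl) (simp add: Suc.IH)
  also have "\<dots> = of_bool (y \<in> A) * (\<Sum>m\<le>n. (\<Sum>z\<in>V. P y z * pk A m z x) * last_exit A x F (n - m))
      + of_bool (y = x) * last_exit A x F (Suc n)"
  proof -
    have "(\<Sum>z\<in>V. P y z * (\<Sum>m\<le>n. pk A m z x * last_exit A x F (n - m)))
        = (\<Sum>m\<le>n. (\<Sum>z\<in>V. P y z * pk A m z x) * last_exit A x F (n - m))"
      by (simp add: sum_distrib_left sum_distrib_right mult.assoc) (rule sum.swap)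
    then show ?thesis
      by (auto simp: last_exit_def sum.distrib distrib_left sum_distrib_left mult.left_commute)
  qed
  also have "\<dots> = of_bool (y = x) * last_exit A x F (Suc n) + (\<Sum>m\<le>n. pk A (Suc m) y x * last_exit A x F (n - m))"
    by (simp add: sumA sum_distrib_left mult.assoc)
  also have "\<dots> = (\<Sum>m\<le>Suc n. pk A m y x * last_exit A x F (Suc n - m))"
    using x by (subst sum.atMost_Suc_shift) auto
  finally show ?case .
qed

lemma EE_LE_Cons:
  assumes A: "A \<subseteq> V" and x: "x \<in> A"
  shows "EE n x (\<lambda>l. of_bool (set l \<subseteq> A \<and> LE l = x # \<gamma>))
    = (\<Sum>m\<le>n. pk A m x x * last_exit A x (\<lambda>v. of_bool (LE v = \<gamma>)) (n - m))"
proof -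
  have "EE n x (\<lambda>l. of_bool (set l \<subseteq> A \<and> LE l = x # \<gamma>)) =
    EE n x (\<lambda>l. of_bool (set l \<subseteq> A \<and> x \<in> set l) * of_bool (LE (after_last x l) = \<gamma>))"
  proof (rule EE_cong)
    fix l :: "'a list" assume l: "length l = Suc n" "hd l = x"
    then obtain l' where l': "l = x # l'" by (cases l) auto
    show "of_bool (set l \<subseteq> A \<and> LE l = x # \<gamma>)
       = (of_bool (set l \<subseteq> A \<and> x \<in> set l) * of_bool (LE (after_last x l) = \<gamma>) :: real)"
      unfolding l' by (auto simp: after_last_Cons after_last_id)
  qed (use A x in auto)
  also have "\<dots> = (\<Sum>m\<le>n. pk A m x x * last_exit A x (\<lambda>v. of_bool (LE v = \<gamma>)) (n - m))"
    using A x by (intro EE_after_last) auto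
  finally show ?thesis .
qed

section \<open>Green functions and the weight of a loop erasure\<close>

definition G :: "'a set \<Rightarrow> real \<Rightarrow> 'a \<Rightarrow> 'a \<Rightarrow> real" where
  "G A q x y = (\<Sum>n. pk A n x y * q ^ n)"

text \<open>Generating function, in the number of steps, of the walks inside \<open>A\<close> whose loop erasure is the
  given path (\<open>erasure_weight_sums\<close>); each factor \<open>G\<close> accounts for the loops at one vertex.\<close>

fun erasure_weight :: "'a set \<Rightarrow> 'a list \<Rightarrow> real \<Rightarrow> real" where
  "erasure_weight A [] q = 0"
| "erasure_weight A [x] q = G A q x x"
| "erasure_weight A (x # z # \<gamma>) q = G A q x x * (q * P x z * erasure_weight (A - {x}) (z # \<gamma>) q)"

context
  fixes q :: real
  assumes q: "0 \<le> q" "q < 1"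
begin

lemma summable_pk: "A \<subseteq> V \<Longrightarrow> summable (\<lambda>n. pk A n x y * q ^ n)"
  using q by (intro summable_comparison_test'[OF summable_geometric[of q]])
     (auto simp: abs_mult pk_nonneg pk_le_1' intro!: mult_left_le_one_le)

lemma summable_norm_pk: "A \<subseteq> V \<Longrightarrow> summable (\<lambda>n. norm (pk A n x y * q ^ n))"
  using summable_pk[of A x y] q by (simp add: abs_mult pk_nonneg)

lemma G_sums: "A \<subseteq> V \<Longrightarrow> (\<lambda>n. pk A n x y * q ^ n) sums G A q x y"
  unfolding G_def by (intro summable_sums summable_pk)

lemma G_nonneg: "A \<subseteq> V \<Longrightarrow> 0 \<le> G A q x y"
  unfolding G_def by (intro suminf_nonneg summable_pk) (use q in \<open>auto intro!: mult_nonneg_nonneg pk_nonneg\<close>)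

lemma G_mono: "A \<subseteq> B \<Longrightarrow> B \<subseteq> V \<Longrightarrow> G A q x y \<le> G B q x y"
  unfolding G_def by (intro suminf_le summable_pk mult_right_mono pk_mono) (use q in auto)

lemma G_out1: "x \<notin> A \<Longrightarrow> G A q x y = 0"
  and G_out2: "y \<notin> A \<Longrightarrow> G A q x y = 0"
  by (simp_all add: G_def pk_out1 pk_out2)

lemma G_eq:
  assumes "A \<subseteq> V" "x \<in> A"
  shows "G A q x y = of_bool (x = y) + q * (\<Sum>z\<in>A. P x z * G A q z y)"
proof -
  have "(\<lambda>n. q * (\<Sum>z\<in>A. P x z * (pk A n z y * q ^ n))) sums (q * (\<Sum>z\<in>A. P x z * G A q z y))"
    by (intro sums_mult sums_sum G_sums assms)
  moreover have "(\<lambda>n. q * (\<Sum>z\<in>A. P x z * (pk A n z y * q ^ n))) = (\<lambda>n. pk A (Suc n) x y * q ^ Suc n)"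
    using assms by (auto simp: sum_distrib_left sum_distrib_right mult_ac)
  ultimately have "(\<lambda>n. pk A n x y * q ^ n) sums (q * (\<Sum>z\<in>A. P x z * G A q z y) + pk A 0 x y * q ^ 0)"
    by (subst sums_Suc_iff[symmetric]) auto
  then show ?thesis using G_sums[OF assms(1), of x y] sums_unique2 assms by fastforce
qed

lemma G_ge_1: "A \<subseteq> V \<Longrightarrow> x \<in> A \<Longrightarrow> 1 \<le> G A q x x"
  using q by (subst G_eq) (auto intro!: mult_nonneg_nonneg sum_nonneg G_nonneg P_nonneg)

text \<open>Maximum principle: rows of \<open>P\<close> restricted to \<open>B\<close> sum to at
  most 1, so the maximal absolute value is at most \<open>q < 1\<close> times itself.\<close>

lemma harmonic_zero:
  assumes B: "B \<subseteq> V" and h: "\<And>y. y \<in> B \<Longrightarrow> \<Delta> y = q * (\<Sum>u\<in>B. P y u * \<Delta> u)" and y: "y \<in> B"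
  shows "\<Delta> y = (0::real)"
proof -
  have fB: "finite B" using B finV finite_subset by blast
  define m where "m = Max ((\<lambda>y. \<bar>\<Delta> y\<bar>) ` B)"
  have m: "\<bar>\<Delta> u\<bar> \<le> m" if "u \<in> B" for u
    unfolding m_def using fB that by (intro Max_ge) auto
  have m0: "0 \<le> m" using m[OF y] by linarith
  have "\<bar>\<Delta> u\<bar> \<le> q * m" if u: "u \<in> B" for u
  proof -
    have "\<bar>\<Sum>w\<in>B. P u w * \<Delta> w\<bar> \<le> (\<Sum>w\<in>B. P u w * m)"
      by (rule order.trans[OF sum_abs]) (auto intro!: sum_mono mult_left_mono m simp: abs_mult P_nonneg)
    also have "\<dots> \<le> (\<Sum>w\<in>V. P u w * m)"
      using B finV m0 by (intro sum_mono2) (auto intro!: mult_nonneg_nonneg P_nonneg)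
    also have "\<dots> = m" using u B by (simp add: sum_distrib_right[symmetric] P_sum subset_iff)
    finally show ?thesis using q by (subst h[OF u]) (simp add: abs_mult mult_left_mono)
  qed
  moreover have "m \<in> (\<lambda>y. \<bar>\<Delta> y\<bar>) ` B" unfolding m_def using fB y by (intro Max_in) auto
  ultimately have "m \<le> q * m" by auto
  then have "(1 - q) * m \<le> 0" by (simp add: algebra_simps)
  then have "m \<le> 0" using q by (simp add: mult_le_0_iff)
  then show ?thesis using m[OF y] by simp
qed

text \<open>The subtracted term is the weight of the walks through \<open>x\<close>. Both sides
  satisfy the same first-step equation on \<open>A - {x}\<close> and agree at \<open>x\<close>, so
  \<open>harmonic_zero\<close> applies to the difference.\<close>

lemma G_remove:
  assumes A: "A \<subseteq> V" and x: "x \<in> A"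
  shows "G (A - {x}) q y z = G A q y z - G A q y x * G A q x z / G A q x x"
proof -
  have gx: "G A q x x > 0" using G_ge_1[OF A x] by linarith
  define \<Delta> where "\<Delta> y = G A q y z - G A q y x * G A q x z / G A q x x - G (A - {x}) q y z" for y
  have dx: "\<Delta> x = 0" using gx by (simp add: \<Delta>_def G_out1)
  have A': "A - {x} \<subseteq> V" using A by blast
  have fA: "finite A" using A finV finite_subset by blast
  have "\<Delta> y = 0" if y: "y \<in> A - {x}"
  proof (rule harmonic_zero[of "A - {x}"])
    fix y assume y: "y \<in> A - {x}"
    have e1: "(\<Sum>u\<in>A - {x}. P y u * \<Delta> u) = (\<Sum>u\<in>A. P y u * \<Delta> u)"
      using fA x by (subst sum_diff) (auto simp: dx)
    have e2: "(\<Sum>u\<in>A. P y u * G (A - {x}) q u z) = (\<Sum>u\<in>A - {x}. P y u * G (A - {x}) q u z)"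
      using fA x by (subst sum_diff) (auto simp: G_out1)
    have "q * (\<Sum>u\<in>A. P y u * \<Delta> u) = q * (\<Sum>u\<in>A. P y u * G A q u z)
       - (q * (\<Sum>u\<in>A. P y u * G A q u x)) * G A q x z / G A q x x - q * (\<Sum>u\<in>A. P y u * G (A - {x}) q u z)"
      by (simp add: \<Delta>_def algebra_simps sum_subtractf sum.distrib sum_distrib_left sum_divide_distrib)
    also have "\<dots> = \<Delta> y"
      using G_eq[OF A, of y z] G_eq[OF A, of y x] G_eq[OF A', of y z] y e2 gx
      by (auto simp: \<Delta>_def algebra_simps)
    finally show "\<Delta> y = q * (\<Sum>u\<in>A - {x}. P y u * \<Delta> u)" using e1 by simp
  qed (use A y in auto)
  moreover have "\<Delta> y = 0" if "y \<notin> A" using that by (simp add: \<Delta>_def G_out1)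
  ultimately have "\<Delta> y = 0" using dx by blast
  then show ?thesis by (simp add: \<Delta>_def)
qed

text \<open>\<open>EE_LE_Cons\<close> is a convolution of loops at the first vertex with
  continuations in \<open>A - {x}\<close>, so the generating functions multiply along the
  path.\<close>

lemma erasure_weight_sums:
  assumes "A \<subseteq> V" "\<gamma> \<noteq> []" "set \<gamma> \<subseteq> V"
  shows "(\<lambda>n. EE n (hd \<gamma>) (\<lambda>l. of_bool (set l \<subseteq> A \<and> LE l = \<gamma>)) * q ^ n) sums erasure_weight A \<gamma> q"
  using assms
proof (induction \<gamma> arbitrary: A rule: induct_list012)
  case (2 x)
  show ?case
  proof (cases "x \<in> A")
    case True
    have "last_exit A x (\<lambda>v. of_bool (LE v = [])) r = of_bool (r = 0)" for r
    proof (cases r)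
      case (Suc k)
      have "EE k z (\<lambda>l. of_bool (set l \<subseteq> A - {x}) * of_bool (LE l = [])) = 0" if "z \<in> V" for z
        by (rule EE_eq_0[OF that]) auto
      then show ?thesis using Suc by (simp add: last_exit_def)
    qed (simp add: last_exit_def)
    then have Q: "last_exit A x (\<lambda>v. of_bool (LE v = [])) (n - m) = of_bool (n - m = 0)" for n m .
    have "EE n x (\<lambda>l. of_bool (set l \<subseteq> A \<and> LE l = [x])) = pk A n x x" for n
    proof -
      have "EE n x (\<lambda>l. of_bool (set l \<subseteq> A \<and> LE l = [x])) = (\<Sum>m\<le>n. if m = n then pk A m x x else 0)"
        unfolding EE_LE_Cons[OF 2(1) True] Q by (intro sum.cong) auto
      then show ?thesis by simp
    qed
    then show ?thesis using G_sums[OF 2(1), of x x] by simp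
  next
    case False
    have "EE n x (\<lambda>l. of_bool (set l \<subseteq> A \<and> LE l = [x])) = 0" for n
    proof (rule EE_eq_0)
      fix l :: "'a list" assume "length l = Suc n" "hd l = x"
      then show "of_bool (set l \<subseteq> A \<and> LE l = [x]) = (0::real)" using False by (cases l) auto
    qed (use 2(3) in simp)
    then show ?thesis using False by (simp add: G_out1)
  qed
next
  case (3 x z \<gamma>)
  show ?case
  proof (cases "x \<in> A")
    case True
    let ?Q = "last_exit A x (\<lambda>v. of_bool (LE v = z # \<gamma>))"
    let ?w = "\<lambda>r. EE r z (\<lambda>l. of_bool (set l \<subseteq> A - {x} \<and> LE l = z # \<gamma>))"
    have Q0: "?Q 0 = 0" by (simp add: last_exit_def)
    \<comment> \<open>The vertex after the last visit to \<open>x\<close> heads the remaining list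
      and hence its loop erasure, so it has to be \<open>z\<close>.\<close>
    have QS: "?Q (Suc r) = P x z * ?w r" for r
    proof -
      have "(\<Sum>z'\<in>V. P x z' * EE r z' (\<lambda>l. of_bool (set l \<subseteq> A - {x}) * of_bool (LE l = z # \<gamma>)))
        = (\<Sum>z'\<in>V. if z' = z then P x z * ?w r else 0)"
      proof (rule sum.cong[OF refl])
        fix z' assume z': "z' \<in> V"
        have "EE r z' (\<lambda>l. of_bool (set l \<subseteq> A - {x}) * of_bool (LE l = z # \<gamma>)) = 0" if "z' \<noteq> z"
        proof (rule EE_eq_0[OF z'])
          fix l :: "'a list" assume "length l = Suc r" "hd l = z'"
          then have "LE l \<noteq> z # \<gamma>" using that by (cases l) auto
          then show "of_bool (set l \<subseteq> A - {x}) * of_bool (LE l = z # \<gamma>) = (0::real)" by simp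
        qed
        then show "P x z' * EE r z' (\<lambda>l. of_bool (set l \<subseteq> A - {x}) * of_bool (LE l = z # \<gamma>))
           = (if z' = z then P x z * ?w r else 0)" by (auto simp: of_bool_conj)
      qed
      moreover have "z \<in> V" using 3(5) by simp
      ultimately show ?thesis using finV by (simp add: last_exit_def)
    qed
    have w: "(\<lambda>r. ?w r * q ^ r) sums erasure_weight (A - {x}) (z # \<gamma>) q"
    proof -
      have "A - {x} \<subseteq> V" "set (z # \<gamma>) \<subseteq> V" using 3(3,5) by auto
      then show ?thesis using 3(2)[of "A - {x}"] by simp
    qed
    have zV: "z \<in> V" using 3(5) by simp
    have "(\<lambda>r. ?Q (Suc r) * q ^ Suc r) sums (q * P x z * erasure_weight (A - {x}) (z # \<gamma>) q)"
      using sums_mult[OF w, of "q * P x z"] by (simp add: QS mult_ac)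
    then have Qs: "(\<lambda>r. ?Q r * q ^ r) sums (q * P x z * erasure_weight (A - {x}) (z # \<gamma>) q)"
      using sums_Suc_iff[of "\<lambda>r. ?Q r * q ^ r" "q * P x z * erasure_weight (A - {x}) (z # \<gamma>) q"] by (simp add: Q0)
    have Qnn: "0 \<le> ?Q r" for r
    proof (cases r)
      case (Suc k)
      show ?thesis unfolding Suc QS by (intro mult_nonneg_nonneg P_nonneg EE_nonneg zV) simp
    qed (simp add: Q0)
    have "norm (?Q r * q ^ r) = ?Q r * q ^ r" for r using Qnn[of r] q by (simp add: abs_mult)
    then have Qn: "summable (\<lambda>r. norm (?Q r * q ^ r))" using Qs sums_summable by simp
    have "(\<lambda>n. \<Sum>m\<le>n. (pk A m x x * q ^ m) * (?Q (n - m) * q ^ (n - m))) sums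
        ((\<Sum>n. pk A n x x * q ^ n) * (\<Sum>n. ?Q n * q ^ n))"
      by (rule Cauchy_product_sums[OF summable_norm_pk[OF 3(3)] Qn])
    also have "(\<lambda>n. \<Sum>m\<le>n. (pk A m x x * q ^ m) * (?Q (n - m) * q ^ (n - m))) =
       (\<lambda>n. EE n x (\<lambda>l. of_bool (set l \<subseteq> A \<and> LE l = x # z # \<gamma>)) * q ^ n)"
    proof
      fix n
      have "(\<Sum>m\<le>n. (pk A m x x * q ^ m) * (?Q (n - m) * q ^ (n - m))) = (\<Sum>m\<le>n. pk A m x x * ?Q (n - m) * q ^ n)"
      proof (rule sum.cong[OF refl])
        fix m assume "m \<in> {..n}"
        then have "q ^ n = q ^ m * q ^ (n - m)" by (simp flip: power_add)
        then show "(pk A m x x * q ^ m) * (?Q (n - m) * q ^ (n - m)) = pk A m x x * ?Q (n - m) * q ^ n"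
          by (simp only: mult_ac)
      qed
      then show "(\<Sum>m\<le>n. (pk A m x x * q ^ m) * (?Q (n - m) * q ^ (n - m))) =
          EE n x (\<lambda>l. of_bool (set l \<subseteq> A \<and> LE l = x # z # \<gamma>)) * q ^ n"
        by (simp only: EE_LE_Cons[OF 3(3) True] sum_distrib_right)
    qed
    finally show ?thesis
      unfolding sums_unique[OF Qs, symmetric] G_def[symmetric] by (simp add: mult_ac)
  next
    case False
    have "EE n x (\<lambda>l. of_bool (set l \<subseteq> A \<and> LE l = x # z # \<gamma>)) = 0" for n
    proof (rule EE_eq_0)
      fix l :: "'a list" assume "length l = Suc n" "hd l = x"
      then show "of_bool (set l \<subseteq> A \<and> LE l = x # z # \<gamma>) = (0::real)" using False by (cases l) auto
    qed (use 3(5) in simp)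
    then show ?thesis using False by (simp add: G_out1)
  qed
qed simp

lemma erasure_weight_nonneg: "A \<subseteq> V \<Longrightarrow> 0 \<le> erasure_weight A \<gamma> q"
proof (induction \<gamma> arbitrary: A rule: induct_list012)
  case (3 x z \<gamma>)
  have "A - {x} \<subseteq> V" using 3(3) by blast
  from 3(2)[OF this] show ?case using 3(3) q by (simp add: G_nonneg P_nonneg)
qed (simp_all add: G_nonneg)

lemma erasure_weight_mono: "A \<subseteq> B \<Longrightarrow> B \<subseteq> V \<Longrightarrow> erasure_weight A \<gamma> q \<le> erasure_weight B \<gamma> q"
proof (induction \<gamma> arbitrary: A B rule: induct_list012)
  case (3 x z \<gamma>)
  have s: "A - {x} \<subseteq> B - {x}" "B - {x} \<subseteq> V" "A - {x} \<subseteq> V" "A \<subseteq> V" using 3(3,4) by auto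
  show ?case unfolding erasure_weight.simps
    using 3(2)[OF s(1,2)] erasure_weight_nonneg[OF s(3)] 3(3,4) s(4) q
    by (intro mult_mono G_mono G_nonneg P_nonneg mult_nonneg_nonneg order.refl) auto
qed (simp_all add: G_mono)

text \<open>The second piece is allowed to meet the first: its domain is enlarged to
  \<open>V\<close>, and the factor \<open>q\<close> of the joining step is bounded by 1.\<close>

lemma erasure_weight_append:
  assumes "A \<subseteq> V" "\<gamma>1 \<noteq> []" "\<gamma>2 \<noteq> []"
  shows "erasure_weight A (\<gamma>1 @ \<gamma>2) q \<le> erasure_weight A \<gamma>1 q * (P (last \<gamma>1) (hd \<gamma>2) * erasure_weight V \<gamma>2 q)"
  using assms
proof (induction \<gamma>1 arbitrary: A rule: induct_list012)
  case (2 x)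
  obtain z \<gamma> where g: "\<gamma>2 = z # \<gamma>" using 2 by (cases \<gamma>2) auto
  have "q * P x z * erasure_weight (A - {x}) (z # \<gamma>) q \<le> 1 * P x z * erasure_weight V (z # \<gamma>) q"
    using 2(1) q by (intro mult_mono erasure_weight_mono mult_nonneg_nonneg P_nonneg erasure_weight_nonneg) auto
  then show ?case using 2(1) by (simp add: g mult_left_mono G_nonneg)
next
  case (3 x z \<gamma>)
  have "erasure_weight (A - {x}) ((z # \<gamma>) @ \<gamma>2) q \<le> erasure_weight (A - {x}) (z # \<gamma>) q * (P (last (z # \<gamma>)) (hd \<gamma>2) * erasure_weight V \<gamma>2 q)"
  proof -
    have "A - {x} \<subseteq> V" using 3(3) by blast
    then show ?thesis using 3(2)[of "A - {x}"] 3(5) by auto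
  qed
  then have "G A q x x * (q * P x z) * erasure_weight (A - {x}) ((z # \<gamma>) @ \<gamma>2) q
    \<le> G A q x x * (q * P x z) * (erasure_weight (A - {x}) (z # \<gamma>) q * (P (last (z # \<gamma>)) (hd \<gamma>2) * erasure_weight V \<gamma>2 q))"
    using 3(3) q by (intro mult_left_mono mult_nonneg_nonneg G_nonneg P_nonneg) auto
  then show ?case by (simp add: mult_ac)
qed simp

end

end

section \<open>Dependence on the killing rate\<close>

context finite_chain
begin

text \<open>Union bound over the time \<open>i\<close> and the place \<open>x\<close> of a visit to
  \<open>U\<close>.\<close>

lemma pk_deficit:
  assumes "U \<subseteq> V" "z \<in> V" "y \<in> V"
  shows "pk V n y z - pk (V - U) n y z \<le> (\<Sum>i\<le>n. \<Sum>x\<in>U. pk V i y x * pk V (n - i) x z)"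
  using assms(3)
proof (induction n arbitrary: y)
  case 0
  have "0 \<le> (\<Sum>x\<in>U. pk V 0 y x * pk V 0 x z)" by (intro sum_nonneg mult_nonneg_nonneg pk_nonneg)
  moreover have "(\<Sum>x\<in>U. pk V 0 y x * pk V 0 x z) = of_bool (y = z)" if "y \<in> U"
  proof -
    have "(\<Sum>x\<in>U. pk V 0 y x * pk V 0 x z) = (\<Sum>x\<in>U. if x = y then of_bool (y = z) else 0)"
      using assms 0 by (intro sum.cong) auto
    then show ?thesis using that assms finite_subset[OF assms(1) finV] by simp
  qed
  ultimately show ?case using 0 assms by (cases "y \<in> U") auto
next
  case (Suc n)
  have fU: "finite U" using assms finV finite_subset by blast
  have nn: "0 \<le> (\<Sum>x\<in>U. pk V i y x * pk V m x z)" for i m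
    by (intro sum_nonneg mult_nonneg_nonneg pk_nonneg)
  show ?case
  proof (cases "y \<in> U")
    case True
    have "(\<Sum>x\<in>U. pk V 0 y x * pk V (Suc n) x z) = (\<Sum>x\<in>U. if x = y then pk V (Suc n) y z else 0)"
      using assms(1) Suc.prems by (intro sum.cong) auto
    then have "pk V (Suc n) y z = (\<Sum>x\<in>U. pk V 0 y x * pk V (Suc n - 0) x z)"
      using True fU by simp
    also have "\<dots> \<le> (\<Sum>i\<le>Suc n. \<Sum>x\<in>U. pk V i y x * pk V (Suc n - i) x z)"
      using member_le_sum[of 0 "{..Suc n}" "\<lambda>i. \<Sum>x\<in>U. pk V i y x * pk V (Suc n - i) x z"] nn by auto
    finally show ?thesis using pk_nonneg[of "V - U" "Suc n" y z] by linarith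
  next
    case False
    have "(\<Sum>u\<in>V - U. P y u * pk (V - U) n u z) = (\<Sum>u\<in>V. P y u * pk (V - U) n u z)"
      using finV by (intro sum.mono_neutral_left) (auto simp: pk_out1)
    then have "pk V (Suc n) y z - pk (V - U) (Suc n) y z = (\<Sum>u\<in>V. P y u * (pk V n u z - pk (V - U) n u z))"
      using False Suc.prems by (simp add: sum_subtractf right_diff_distrib)
    also have "\<dots> \<le> (\<Sum>u\<in>V. P y u * (\<Sum>i\<le>n. \<Sum>x\<in>U. pk V i u x * pk V (n - i) x z))"
      by (intro sum_mono mult_left_mono Suc.IH P_nonneg)
    also have "\<dots> = (\<Sum>i\<le>n. \<Sum>x\<in>U. (\<Sum>u\<in>V. P y u * pk V i u x) * pk V (n - i) x z)"
    proof -
      have "(\<Sum>u\<in>V. P y u * (\<Sum>i\<le>n. \<Sum>x\<in>U. pk V i u x * pk V (n - i) x z))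
        = (\<Sum>u\<in>V. \<Sum>i\<le>n. \<Sum>x\<in>U. P y u * pk V i u x * pk V (n - i) x z)"
        by (simp add: sum_distrib_left mult.assoc)
      also have "\<dots> = (\<Sum>i\<le>n. \<Sum>u\<in>V. \<Sum>x\<in>U. P y u * pk V i u x * pk V (n - i) x z)"
        by (rule sum.swap)
      also have "\<dots> = (\<Sum>i\<le>n. \<Sum>x\<in>U. \<Sum>u\<in>V. P y u * pk V i u x * pk V (n - i) x z)"
        by (rule sum.cong[OF refl sum.swap])
      finally show ?thesis by (simp add: sum_distrib_right)
    qed
    also have "\<dots> = (\<Sum>i\<le>n. \<Sum>x\<in>U. pk V (Suc i) y x * pk V (n - i) x z)"
      using Suc.prems by simp
    also have "\<dots> \<le> (\<Sum>i\<le>Suc n. \<Sum>x\<in>U. pk V i y x * pk V (Suc n - i) x z)"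
      by (subst sum.atMost_Suc_shift) (simp add: nn del: pk.simps)
    finally show ?thesis .
  qed
qed

text \<open>Rerooting a closed walk at its visit to \<open>U\<close> makes the summand independent
  of the visiting time, which takes \<open>Suc n\<close> values. This is the origin of the weight
  \<open>Suc n\<close> in \<open>short\<close>.\<close>

lemma trace_deficit:
  assumes "U \<subseteq> V"
  shows "(\<Sum>y\<in>V. pk V n y y - pk (V - U) n y y) \<le> real (Suc n) * (\<Sum>x\<in>U. pk V n x x)"
proof -
  have "(\<Sum>y\<in>V. pk V n y y - pk (V - U) n y y)
      \<le> (\<Sum>y\<in>V. \<Sum>i\<le>n. \<Sum>x\<in>U. pk V i y x * pk V (n - i) x y)"
    using assms by (intro sum_mono pk_deficit) auto
  also have "\<dots> = (\<Sum>i\<le>n. \<Sum>y\<in>V. \<Sum>x\<in>U. pk V i y x * pk V (n - i) x y)"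
    by (rule sum.swap)
  also have "\<dots> = (\<Sum>i\<le>n. \<Sum>x\<in>U. \<Sum>y\<in>V. pk V i y x * pk V (n - i) x y)"
    by (rule sum.cong[OF refl sum.swap])
  also have "\<dots> = (\<Sum>i\<le>n. \<Sum>x\<in>U. \<Sum>y\<in>V. pk V (n - i) x y * pk V i y x)"
    by (rule sum.cong[OF refl sum.cong[OF refl sum.cong[OF refl mult.commute]]])
  also have "\<dots> = (\<Sum>i\<le>n. \<Sum>x\<in>U. pk V n x x)"
    by (intro sum.cong refl) (simp add: pk_add[OF finV, symmetric])
  finally show ?thesis by simp
qed


text \<open>A closed walk of \<open>n\<close> steps can be cut at \<open>n + 1\<close> times, so
  summing \<open>G A q x y * G A q y x\<close> over \<open>y\<close> gives the series with
  coefficients \<open>(n + 1) * c n\<close>, which is \<open>q\<close> times the derivative plus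
  \<open>G A q x x\<close>.\<close>

lemma has_derivative_G:
  assumes A: "A \<subseteq> V" and q: "0 < q" "q < 1"
  shows "((\<lambda>q. G A q x x) has_real_derivative ((\<Sum>y\<in>A. G A q x y * G A q y x) - G A q x x) / q) (at q)"
proof -
  define c where "c n = pk A n x x" for n
  have fA: "finite A" using A finV finite_subset by blast
  have q': "0 \<le> q" "q < 1" using q by auto
  obtain K where K: "q < K" "K < 1" using q dense by blast
  have sK: "summable (\<lambda>n. c n * K ^ n)"
    unfolding c_def using K q by (intro summable_pk A) auto
  have D: "((\<lambda>q. \<Sum>n. c n * q ^ n) has_real_derivative (\<Sum>n. diffs c n * q ^ n)) (at q)"
    using K q by (intro termdiffs_strong[OF sK]) auto
  have "(\<lambda>n. diffs c n * q ^ n) sums (\<Sum>n. diffs c n * q ^ n)"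
  proof (rule summable_sums, rule termdiff_converges[of q K c])
    fix r :: real assume "norm r < K"
    then show "summable (\<lambda>n. c n * r ^ n)"
      using sK K q by (rule_tac powser_inside[of c K]) simp_all
  qed (use q K in simp)
  from sums_mult[OF this, of q]
  have "(\<lambda>n. (real (Suc n) * c (Suc n)) * q ^ Suc n) sums (q * (\<Sum>n. diffs c n * q ^ n))"
    by (simp add: diffs_def mult_ac)
  then have s1: "(\<lambda>n. (real n * c n) * q ^ n) sums (q * (\<Sum>n. diffs c n * q ^ n))"
    using sums_Suc_iff[of "\<lambda>n. (real n * c n) * q ^ n" "q * (\<Sum>n. diffs c n * q ^ n)"] by simp
  have s2: "(\<lambda>n. c n * q ^ n) sums G A q x x"
    unfolding c_def by (rule G_sums[OF q' A])
  have "(\<lambda>n. \<Sum>y\<in>A. \<Sum>m\<le>n. (pk A m x y * q ^ m) * (pk A (n - m) y x * q ^ (n - m))) sums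
      (\<Sum>y\<in>A. (\<Sum>n. pk A n x y * q ^ n) * (\<Sum>n. pk A n y x * q ^ n))"
    by (intro sums_sum Cauchy_product_sums summable_norm_pk q' A)
  moreover have "(\<Sum>y\<in>A. \<Sum>m\<le>n. (pk A m x y * q ^ m) * (pk A (n - m) y x * q ^ (n - m)))
      = (real n * c n) * q ^ n + c n * q ^ n" for n
  proof -
    have "(\<Sum>y\<in>A. \<Sum>m\<le>n. (pk A m x y * q ^ m) * (pk A (n - m) y x * q ^ (n - m)))
       = (\<Sum>m\<le>n. \<Sum>y\<in>A. (pk A m x y * pk A (n - m) y x) * q ^ n)"
      by (subst sum.swap, intro sum.cong refl) (simp add: mult_ac flip: power_add)
    also have "\<dots> = (\<Sum>m\<le>n. c n * q ^ n)"
      unfolding sum_distrib_right[symmetric] pk_add[OF fA, symmetric]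
      by (simp add: c_def)
    finally show ?thesis by (simp add: algebra_simps)
  qed
  ultimately have "(\<lambda>n. (real n * c n) * q ^ n + c n * q ^ n) sums (\<Sum>y\<in>A. G A q x y * G A q y x)"
    by (simp add: G_def)
  then have "(\<Sum>y\<in>A. G A q x y * G A q y x) = q * (\<Sum>n. diffs c n * q ^ n) + G A q x x"
    using sums_add[OF s1 s2] sums_unique2 by blast
  then have "(\<Sum>n. diffs c n * q ^ n) = ((\<Sum>y\<in>A. G A q x y * G A q y x) - G A q x x) / q"
    using q by (simp add: field_simps)
  then show ?thesis using D by (simp add: G_def c_def)
qed

text \<open>Generating function of the rooted closed walks in \<open>A\<close> that meet \<open>U\<close>. Up to elementary terms it is the
  logarithmic derivative of \<open>erasure_weight\<close> in \<open>q\<close>.\<close>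

definition loop_trace :: "'a set \<Rightarrow> 'a set \<Rightarrow> real \<Rightarrow> real" where
  "loop_trace A U q = (\<Sum>y\<in>V. G A q y y - G (A - U) q y y)"

text \<open>By \<open>G_remove\<close> the trace lost on removing \<open>x\<close> is the sum of
  \<open>G A q x y * G A q y x\<close> divided by \<open>G A q x x\<close>; this puts
  \<open>has_derivative_G\<close> in logarithmic form.\<close>

lemma has_derivative_G':
  assumes A: "A \<subseteq> V" and q: "0 < q" "q < 1"
  shows "((\<lambda>q. G A q x x) has_real_derivative G A q x x * ((loop_trace A {x} q - 1) / q)) (at q)"
proof (cases "x \<in> A")
  case True
  have q': "0 \<le> q" "q < 1" using q by auto
  have gx: "G A q x x > 0" using G_ge_1[OF q' A True] by linarith
  have "loop_trace A {x} q = (\<Sum>y\<in>V. G A q x y * G A q y x / G A q x x)"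
    unfolding loop_trace_def by (intro sum.cong refl) (subst G_remove[OF q' A True], simp)
  also have "\<dots> = (\<Sum>y\<in>A. G A q x y * G A q y x / G A q x x)"
    using A finV by (intro sum.mono_neutral_right) (auto simp: G_def pk_out1)
  finally have "loop_trace A {x} q = (\<Sum>y\<in>A. G A q x y * G A q y x) / G A q x x"
    by (simp add: sum_divide_distrib)
  then have "G A q x x * ((loop_trace A {x} q - 1) / q) = ((\<Sum>y\<in>A. G A q x y * G A q y x) - G A q x x) / q"
    using gx by (simp add: field_simps)
  with has_derivative_G[OF A q, of x] show ?thesis by metis
next
  case False
  then have "(\<lambda>q. G A q x x) = (\<lambda>_. 0)" by (auto simp: G_def pk_out1)
  then show ?thesis by (simp add: fun_eq_iff)
qed

text \<open>Logarithmic derivatives add and the loop traces telescope along the path. Each vertex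
  contributes \<open>- 1 / q\<close> and each step, through its factor \<open>q\<close>,
  \<open>1 / q\<close>; there is one vertex more than there are steps.\<close>

lemma has_derivative_erasure_weight:
  assumes q: "0 < q" "q < 1" and "A \<subseteq> V" "\<gamma> \<noteq> []"
  shows "(erasure_weight A \<gamma> has_real_derivative erasure_weight A \<gamma> q * ((loop_trace A (set \<gamma>) q - 1) / q)) (at q)"
  using assms(3,4)
proof (induction \<gamma> arbitrary: A rule: induct_list012)
  case (2 x)
  then show ?case using has_derivative_G'[OF 2(1) q, of x] by simp
next
  case (3 x z \<gamma>)
  have A': "A - {x} \<subseteq> V" using 3(3) by blast
  let ?g = "G A q x x" and ?z = "erasure_weight (A - {x}) (z # \<gamma>) q"
  let ?t1 = "loop_trace A {x} q" and ?t2 = "loop_trace (A - {x}) (set (z # \<gamma>)) q"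
  have IH: "(erasure_weight (A - {x}) (z # \<gamma>) has_real_derivative ?z * ((?t2 - 1) / q)) (at q)"
    by (rule 3(2)[OF A']) simp
  have "((\<lambda>q. G A q x x * (q * P x z * erasure_weight (A - {x}) (z # \<gamma>) q)) has_real_derivative
     ?g * ((?t1 - 1) / q) * (q * P x z * ?z) +
     (1 * P x z * ?z + ?z * ((?t2 - 1) / q) * (q * P x z)) * ?g) (at q)"
    by (rule DERIV_mult[OF has_derivative_G'[OF 3(3) q] DERIV_mult[OF DERIV_cmult_right[OF DERIV_ident] IH]])
  moreover have "?g * ((?t1 - 1) / q) * (q * P x z * ?z) +
     (1 * P x z * ?z + ?z * ((?t2 - 1) / q) * (q * P x z)) * ?g
      = ?g * (q * P x z * ?z) * ((?t1 + ?t2 - 1) / q)"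
    using q by (simp add: field_simps)
  moreover have "?t1 + ?t2 = loop_trace A (set (x # z # \<gamma>)) q"
  proof -
    have "A - {x} - set (z # \<gamma>) = A - set (x # z # \<gamma>)" by auto
    then show ?thesis by (simp only: loop_trace_def sum.distrib[symmetric]) simp
  qed
  moreover have "erasure_weight A (x # z # \<gamma>) = (\<lambda>q. G A q x x * (q * P x z * erasure_weight (A - {x}) (z # \<gamma>) q))"
    by (rule ext) simp
  ultimately show ?case by (simp only:)
qed simp

end

text \<open>In the second condition the eigenvalue 1 is subtracted exactly. Hence passing from \<open>q1\<close> to \<open>q2\<close> in
  \<open>erasure_weight_compare\<close> costs the factor \<open>(1 - q1) / (1 - q2)\<close> itself and not a power of it.\<close>

locale heat_trace_chain = finite_chain V P for V :: "'a set" and P +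
  fixes g :: nat and h h' :: real
  assumes short: "x \<in> V \<Longrightarrow> (\<Sum>n<g. real (Suc n) * pk V n x x) \<le> h"
    and long: "0 < q \<Longrightarrow> q < 1 \<Longrightarrow>
      (\<Sum>n. ((\<Sum>y\<in>V. pk V (n + g) y y) - 1) * q ^ (n + g)) \<le> h'"
begin

text \<open>Subtracting \<open>1 / (1 - q)\<close> takes 1 from every coefficient. Below
  \<open>g\<close> this 1 is given away and walks are counted through the vertices of
  \<open>U\<close>; from \<open>g\<close> on \<open>U\<close> is ignored and the full trace minus 1
  is used.\<close>

lemma loop_trace_le:
  assumes U: "U \<subseteq> V" and q: "0 < q" "q < 1"
  shows "loop_trace V U q - 1 / (1 - q) \<le> h * card U + h'"
proof -
  have q': "0 \<le> q" "q < 1" using q by auto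
  have fU: "finite U" using U finV finite_subset by blast
  have U': "V - U \<subseteq> V" by blast
  define t where "t n = (\<Sum>y\<in>V. pk V n y y - pk (V - U) n y y)" for n
  define w where "w n = (\<Sum>y\<in>V. pk V n y y)" for n
  have "(\<lambda>n. (\<Sum>y\<in>V. pk V n y y * q ^ n - pk (V - U) n y y * q ^ n)) sums loop_trace V U q"
    unfolding loop_trace_def by (intro sums_sum sums_diff G_sums q' U' order.refl)
  then have "(\<lambda>n. t n * q ^ n) sums loop_trace V U q"
    by (simp add: t_def sum_distrib_right left_diff_distrib)
  moreover have geo: "(\<lambda>n. q ^ n) sums (1 / (1 - q))" using q by (intro geometric_sums) auto
  ultimately have s: "(\<lambda>n. (t n - 1) * q ^ n) sums (loop_trace V U q - 1 / (1 - q))"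
    by (simp add: left_diff_distrib sums_diff)
  have "(\<lambda>n. (\<Sum>y\<in>V. pk V n y y * q ^ n)) sums (\<Sum>y\<in>V. G V q y y)"
    by (intro sums_sum G_sums q' order.refl)
  then have sw: "summable (\<lambda>n. (w n - 1) * q ^ n)"
    using geo by (auto simp: w_def sum_distrib_right left_diff_distrib sums_iff intro!: summable_diff)
  have "(\<Sum>n. (t (n + g) - 1) * q ^ (n + g)) \<le> (\<Sum>n. (w (n + g) - 1) * q ^ (n + g))"
  proof (rule suminf_le)
    show "summable (\<lambda>n. (t (n + g) - 1) * q ^ (n + g))"
      using sums_summable[OF s] by (rule summable_ignore_initial_segment)
    show "summable (\<lambda>n. (w (n + g) - 1) * q ^ (n + g))"
      using sw by (rule summable_ignore_initial_segment)
    have "t n \<le> w n" for n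
      unfolding t_def w_def by (intro sum_mono) (simp add: pk_nonneg)
    then show "(t (n + g) - 1) * q ^ (n + g) \<le> (w (n + g) - 1) * q ^ (n + g)" for n
      using q by (intro mult_right_mono) auto
  qed
  also have "\<dots> \<le> h'" unfolding w_def by (rule long[OF q])
  finally have 1: "(\<Sum>n. (t (n + g) - 1) * q ^ (n + g)) \<le> h'" .
  have "(\<Sum>n<g. (t n - 1) * q ^ n) \<le> (\<Sum>n<g. real (Suc n) * (\<Sum>x\<in>U. pk V n x x))"
  proof (rule sum_mono)
    fix n
    have t0: "0 \<le> t n" unfolding t_def by (intro sum_nonneg) (simp add: pk_mono)
    have "(t n - 1) * q ^ n \<le> t n * q ^ n" using q by (intro mult_right_mono) auto
    also have "\<dots> \<le> t n" using q t0 by (simp add: mult_left_le power_le_one)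
    also have "\<dots> \<le> real (Suc n) * (\<Sum>x\<in>U. pk V n x x)"
      unfolding t_def by (rule trace_deficit[OF U])
    finally show "(t n - 1) * q ^ n \<le> real (Suc n) * (\<Sum>x\<in>U. pk V n x x)" .
  qed
  also have "\<dots> = (\<Sum>x\<in>U. \<Sum>n<g. real (Suc n) * pk V n x x)"
    unfolding sum_distrib_left by (rule sum.swap)
  also have "\<dots> \<le> (\<Sum>x\<in>U. h)" using U by (intro sum_mono short) auto
  finally have 2: "(\<Sum>n<g. (t n - 1) * q ^ n) \<le> h * card U" by (simp add: mult.commute)
  have "loop_trace V U q - 1 / (1 - q) = (\<Sum>n. (t n - 1) * q ^ n)"
    using sums_unique[OF s] .
  also have "\<dots> = (\<Sum>n. (t (n + g) - 1) * q ^ (n + g)) + (\<Sum>n<g. (t n - 1) * q ^ n)"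
    by (rule suminf_split_initial_segment[OF sums_summable[OF s]])
  finally show ?thesis using 1 2 by linarith
qed

text \<open>The logarithmic derivative of the weight is at most \<open>1 / (1 - q)\<close> plus
  \<open>K\<close>, so multiplication by \<open>1 - q\<close> and \<open>exp (- K * q)\<close> gives
  a nonincreasing function.\<close>

lemma erasure_weight_compare:
  assumes q: "1 / 2 \<le> q1" "q1 \<le> q2" "q2 < 1" and \<gamma>: "\<gamma> \<noteq> []" "set \<gamma> \<subseteq> V" and hh: "0 \<le> h" "0 \<le> h'"
  shows "(1 - q2) * erasure_weight V \<gamma> q2 \<le> (1 - q1) * erasure_weight V \<gamma> q1 * exp (2 * (h * length \<gamma> + h') * (q2 - q1))"
proof -
  \<comment> \<open>The factor 2 absorbs the division by \<open>q\<close>, which is at least 1/2, in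
    the logarithmic derivative.\<close>
  define K where "K = 2 * (h * length \<gamma> + h')"
  have K0: "0 \<le> K" using hh by (simp add: K_def)
  define F where "F q = (1 - q) * erasure_weight V \<gamma> q * exp (- K * q)" for q
  have "F q2 \<le> F q1"
  proof (rule DERIV_nonpos_imp_nonincreasing[OF q(2)])
    fix q assume qq: "q1 \<le> q" "q \<le> q2"
    then have q0: "0 < q" "q < 1" "1 / 2 \<le> q" using q by auto
    let ?z = "erasure_weight V \<gamma> q" and ?L = "(loop_trace V (set \<gamma>) q - 1) / q"
    have "(F has_real_derivative (-1 * ?z + ?z * ?L * (1 - q)) * exp (- K * q)
        + (exp (- K * q) * (- K)) * ((1 - q) * ?z)) (at q)"
      unfolding F_def
      by (rule DERIV_mult DERIV_mult[OF _ has_derivative_erasure_weight[OF q0(1,2) order.refl \<gamma>(1)]] derivative_eq_intros refl | simp)+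
    moreover have "(-1 * ?z + ?z * ?L * (1 - q)) * exp (- K * q)
        + (exp (- K * q) * (- K)) * ((1 - q) * ?z)
      = (1 - q) * ?z * exp (- K * q) * (?L - 1 / (1 - q) - K)"
      using q0 by (simp add: field_simps)
    moreover have "?L - 1 / (1 - q) - K \<le> 0"
    proof -
      have c: "real (card (set \<gamma>)) \<le> length \<gamma>" using card_length[of \<gamma>] by simp
      have e: "?L - 1 / (1 - q) = (loop_trace V (set \<gamma>) q - 1 / (1 - q)) / q"
        using q0 by (simp add: field_simps)
      have "loop_trace V (set \<gamma>) q - 1 / (1 - q) \<le> h * card (set \<gamma>) + h'"
        by (rule loop_trace_le[OF \<gamma>(2) q0(1,2)])
      also have "\<dots> \<le> h * length \<gamma> + h'" using c hh by (simp add: mult_left_mono)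
      also have "\<dots> = K * (1 / 2)" by (simp add: K_def)
      also have "\<dots> \<le> K * q" using q0 K0 by (intro mult_left_mono) auto
      finally show ?thesis unfolding e using q0 by (simp add: field_simps)
    qed
    moreover have "0 \<le> (1 - q) * ?z * exp (- K * q)"
      using q0 by (intro mult_nonneg_nonneg erasure_weight_nonneg) auto
    ultimately show "\<exists>y. (F has_real_derivative y) (at q) \<and> y \<le> 0"
      by (metis mult_nonneg_nonpos)
  qed
  then have "F q2 * exp (K * q2) \<le> F q1 * exp (K * q2)" by (simp add: mult_right_mono)
  then show ?thesis
    unfolding K_def[symmetric]
    by (simp add: F_def mult.assoc right_diff_distrib flip: exp_add)
qed

end

section \<open>Hitting probabilities and the first moment of the loop erasure\<close>

lemma sum_symmetric_le:
  fixes f :: "nat \<Rightarrow> nat \<Rightarrow> real"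
  assumes T: "finite T" and sym: "\<And>i j. f i j = f j i" and nn: "\<And>i j. 0 \<le> f i j"
  shows "(\<Sum>i\<in>T. \<Sum>j\<in>T. f i j) \<le> 2 * (\<Sum>i\<in>T. \<Sum>j | j \<in> T \<and> i \<le> j. f i j)"
proof -
  have "(\<Sum>j\<in>T. f i j) \<le> (\<Sum>j | j \<in> T \<and> i \<le> j. f i j) + (\<Sum>j | j \<in> T \<and> j \<le> i. f i j)" for i
  proof -
    have "(\<Sum>j\<in>T. f i j) = (\<Sum>j\<in>{j. j \<in> T \<and> i \<le> j} \<union> {j. j \<in> T \<and> j \<le> i}. f i j)"
      by (rule sum.cong) auto
    also have "\<dots> = (\<Sum>j | j \<in> T \<and> i \<le> j. f i j) + (\<Sum>j | j \<in> T \<and> j \<le> i. f i j)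
        - sum (f i) ({j. j \<in> T \<and> i \<le> j} \<inter> {j. j \<in> T \<and> j \<le> i})"
      using T by (intro sum_Un) auto
    also have "\<dots> \<le> (\<Sum>j | j \<in> T \<and> i \<le> j. f i j) + (\<Sum>j | j \<in> T \<and> j \<le> i. f i j)"
      by (simp add: sum_nonneg nn)
    finally show ?thesis .
  qed
  then have "(\<Sum>i\<in>T. \<Sum>j\<in>T. f i j)
      \<le> (\<Sum>i\<in>T. (\<Sum>j | j \<in> T \<and> i \<le> j. f i j) + (\<Sum>j | j \<in> T \<and> j \<le> i. f i j))"
    by (rule sum_mono)
  also have "\<dots> = (\<Sum>i\<in>T. \<Sum>j | j \<in> T \<and> i \<le> j. f i j) + (\<Sum>i\<in>T. \<Sum>j | j \<in> T \<and> j \<le> i. f i j)"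
    by (rule sum.distrib)
  also have "(\<Sum>i\<in>T. \<Sum>j | j \<in> T \<and> j \<le> i. f i j) = (\<Sum>j\<in>T. \<Sum>i | i \<in> T \<and> j \<le> i. f i j)"
    by (rule sum.swap_restrict[OF T T])
  also have "\<dots> = (\<Sum>i\<in>T. \<Sum>j | j \<in> T \<and> i \<le> j. f i j)"
    by (subst sym) simp
  finally show ?thesis by simp
qed

lemma sum_pairs:
  "(\<Sum>t = a..<a + 2 * k. f t) = (\<Sum>j<k. f (a + 2 * j) + f (Suc (a + 2 * j)) :: real)"
  by (induction k) simp_all

lemma sum_set_le_sum_nth:
  assumes "A \<subseteq> set l" "\<And>a. 0 \<le> (f a :: real)"
  shows "(\<Sum>a\<in>A. f a) \<le> (\<Sum>i<length l. f (l ! i))"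
proof -
  have "(\<Sum>a\<in>A. f a) \<le> (\<Sum>a\<in>(!) l ` {..<length l}. f a)"
    using assms by (intro sum_mono2) (auto simp: in_set_conv_nth subset_iff)
  also have "\<dots> \<le> (\<Sum>i<length l. f (l ! i))"
    using sum_image_le[of "{..<length l}" f "(!) l"] assms(2) by simp
  finally show ?thesis .
qed

text \<open>The lower bound is on two consecutive times because on an even torus the walk is periodic.\<close>

locale mixing_chain = finite_chain V P for V :: "'a set" and P +
  fixes g :: nat and H v :: real
  assumes g_pos: "1 \<le> g" and H_ge_1: "1 \<le> H" and v_pos: "0 < v"
    and upper: "g \<le> n \<Longrightarrow> x \<in> V \<Longrightarrow> y \<in> V \<Longrightarrow> pk V n x y \<le> H / v"
    and lower: "g \<le> n \<Longrightarrow> x \<in> V \<Longrightarrow> y \<in> V \<Longrightarrow> 1 / v \<le> pk V n x y + pk V (Suc n) x y"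
    and short: "x \<in> V \<Longrightarrow> (\<Sum>n<g. real (Suc n) * pk V n x x) \<le> H"
begin

text \<open>Pairs are weighted by the Green function truncated at the mixing time, so energy that is
  small relative to the squared size means a set that is easy to hit. \<open>path_energy\<close>
  counts visits with multiplicity and so dominates the energy of every set of visited
  points.\<close>

definition green_energy :: "'a set \<Rightarrow> real" where
  "green_energy A = (\<Sum>a\<in>A. \<Sum>b\<in>A. \<Sum>u<g. pk V u a b)"

definition path_energy :: "'a list \<Rightarrow> real" where
  "path_energy l = (\<Sum>i<length l. \<Sum>j<length l. \<Sum>u<g. pk V u (l ! i) (l ! j))"

text \<open>The Paley-Zygmund quotient of \<open>avoid_window\<close>: the square of the first
  moment bound \<open>\<tau> * a / (2 * v)\<close> over the second moment bound, which is
  \<open>4 * H\<^sup>2\<close> times the square of \<open>\<tau> * a / v\<close>.\<close>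

definition hit_prob :: real where "hit_prob = 1 / (16 * H\<^sup>2)"

lemma hit_prob: "0 < hit_prob" "hit_prob \<le> 1"
proof -
  have "1 \<le> H\<^sup>2" using H_ge_1 by (simp add: one_le_power)
  then have "1 \<le> 16 * H\<^sup>2" by simp
  then show "0 < hit_prob" "hit_prob \<le> 1" using H_ge_1 by (auto simp: hit_prob_def divide_le_eq_1)
qed

text \<open>Paley-Zygmund applied to the number of visits to \<open>A\<close>.\<close>

lemma avoid_window:
  assumes A: "A \<subseteq> V" "A \<noteq> {}" and k: "1 \<le> k" and x: "x \<in> V"
    and en: "green_energy A * v \<le> real (2 * k) * (real (card A))\<^sup>2"
  shows "EE (g + 2 * k) x (\<lambda>l. of_bool (set (tl l) \<inter> A = {})) \<le> 1 - hit_prob"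
proof -
  \<comment> \<open>Visits are counted from time \<open>g\<close> on, where the kernel bounds apply,
    at an even number of times so that they pair up for \<open>lower\<close>. Time 0 is left out
    through \<open>tl\<close> because in \<open>EE_length_LE_time\<close> the walk starts on the set
    to be hit.\<close>
  define n T \<tau> where "n = g + 2 * k" and "T = {g..<g + 2 * k}" and "\<tau> = real (2 * k)"
  define Z :: "'a list \<Rightarrow> real" where "Z l = (\<Sum>t\<in>T. of_bool (l ! t \<in> A))" for l
  define I :: "'a list \<Rightarrow> real" where "I l = of_bool (set (tl l) \<inter> A \<noteq> {})" for l
  define a where "a = real (card A)"
  have fA: "finite A" using A finV finite_subset by blast
  have a1: "1 \<le> a" using A fA by (simp add: a_def Suc_le_eq card_gt_0_iff)
  have \<tau>: "0 < \<tau>" using k by (simp add: \<tau>_def)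
  have Tn: "t \<le> n" "g \<le> t" if "t \<in> T" for t using that by (auto simp: T_def n_def)
  have cT: "card T = 2 * k" "finite T" by (simp_all add: T_def)
  have EZ: "EE n x Z = (\<Sum>t\<in>T. \<Sum>y\<in>A. pk V t x y)"
  proof -
    have "EE n x (\<lambda>l. of_bool (l ! t \<in> A)) = (\<Sum>y\<in>A. pk V t x y)" if "t \<in> T" for t
    proof -
      have "EE n x (\<lambda>l. of_bool (l ! t \<in> A)) = (\<Sum>y\<in>V. pk V t x y * of_bool (y \<in> A))"
        by (rule EE_nth[OF Tn(1)[OF that] x])
      also have "\<dots> = (\<Sum>y\<in>A. pk V t x y * of_bool (y \<in> A))"
        using A finV by (intro sum.mono_neutral_right) auto
      finally show ?thesis by simp
    qed
    then show ?thesis unfolding Z_def EE_sum by simp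
  qed
  have EZ_ge: "\<tau> * a / (2 * v) \<le> EE n x Z"
  proof -
    have "\<tau> * a / (2 * v) = (\<Sum>j<k. \<Sum>y\<in>A. 1 / v)"
      by (simp add: \<tau>_def a_def)
    also have "\<dots> \<le> (\<Sum>j<k. \<Sum>y\<in>A. pk V (g + 2 * j) x y + pk V (Suc (g + 2 * j)) x y)"
      using A x by (intro sum_mono lower) auto
    also have "\<dots> = EE n x Z"
      unfolding EZ T_def sum_pairs by (simp add: sum.distrib)
    finally show ?thesis .
  qed
  have pair: "EE n x (\<lambda>l. of_bool (l ! t \<in> A) * of_bool (l ! t' \<in> A))
      \<le> H / v * (\<Sum>y\<in>A. \<Sum>z\<in>A. pk V (t' - t) y z)" if "t \<in> T" "t' \<in> T" "t \<le> t'" for t t'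
  proof -
    have "EE n x (\<lambda>l. of_bool (l ! t \<in> A) * of_bool (l ! t' \<in> A))
      = (\<Sum>y\<in>V. \<Sum>z\<in>V. pk V t x y * pk V (t' - t) y z * (of_bool (y \<in> A) * of_bool (z \<in> A)))"
      using that Tn x by (intro EE_nth2) auto
    also have "\<dots> = (\<Sum>y\<in>V. \<Sum>z\<in>A. pk V t x y * pk V (t' - t) y z * (of_bool (y \<in> A) * of_bool (z \<in> A)))"
      using A finV by (intro sum.cong refl sum.mono_neutral_right) auto
    also have "\<dots> = (\<Sum>y\<in>A. \<Sum>z\<in>A. pk V t x y * pk V (t' - t) y z * (of_bool (y \<in> A) * of_bool (z \<in> A)))"
      using A finV by (intro sum.mono_neutral_right) auto
    also have "\<dots> = (\<Sum>y\<in>A. \<Sum>z\<in>A. pk V t x y * pk V (t' - t) y z)" by simp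
    also have "\<dots> \<le> (\<Sum>y\<in>A. \<Sum>z\<in>A. H / v * pk V (t' - t) y z)"
      using that Tn x A by (intro sum_mono mult_right_mono upper pk_nonneg) auto
    finally show ?thesis by (simp add: sum_distrib_left)
  qed
  have inner: "(\<Sum>t' | t' \<in> T \<and> t \<le> t'. \<Sum>y\<in>A. \<Sum>z\<in>A. pk V (t' - t) y z) \<le> 2 * H * \<tau> * a\<^sup>2 / v"
    if t: "t \<in> T" for t
  proof -
    have "(\<Sum>t' | t' \<in> T \<and> t \<le> t'. \<Sum>y\<in>A. \<Sum>z\<in>A. pk V (t' - t) y z)
       \<le> (\<Sum>r<2 * k. \<Sum>y\<in>A. \<Sum>z\<in>A. pk V r y z)"
    proof (rule sum_le_included[where i = "\<lambda>r. r + t"])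
      show "\<forall>t'\<in>{t' \<in> T. t \<le> t'}. \<exists>r\<in>{..<2 * k}. r + t = t' \<and>
        (\<Sum>y\<in>A. \<Sum>z\<in>A. pk V (t' - t) y z) \<le> (\<Sum>y\<in>A. \<Sum>z\<in>A. pk V r y z)"
      proof
        fix t' assume "t' \<in> {t' \<in> T. t \<le> t'}"
        then show "\<exists>r\<in>{..<2 * k}. r + t = t' \<and>
          (\<Sum>y\<in>A. \<Sum>z\<in>A. pk V (t' - t) y z) \<le> (\<Sum>y\<in>A. \<Sum>z\<in>A. pk V r y z)"
          using t by (intro bexI[of _ "t' - t"]) (auto simp: T_def)
      qed
    qed (auto simp: cT intro!: sum_nonneg pk_nonneg)
    also have "\<dots> = (\<Sum>y\<in>A. \<Sum>z\<in>A. \<Sum>r<2 * k. pk V r y z)"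
      by (subst sum.swap, rule sum.cong[OF refl], rule sum.swap)
    also have "\<dots> \<le> (\<Sum>y\<in>A. \<Sum>z\<in>A. (\<Sum>r<g. pk V r y z) + \<tau> * (H / v))"
    proof (intro sum_mono)
      fix y z assume yz: "y \<in> A" "z \<in> A"
      have "(\<Sum>r<2 * k. pk V r y z) \<le> (\<Sum>r<2 * k. of_bool (r < g) * pk V r y z + H / v)"
        using yz A H_ge_1 v_pos by (intro sum_mono) (auto intro!: upper simp: not_less)
      also have "\<dots> = (\<Sum>r | r < 2 * k \<and> r < g. pk V r y z) + \<tau> * (H / v)"
      proof -
        have "(\<Sum>r<2 * k. of_bool (r < g) * pk V r y z) = (\<Sum>r\<in>{r. r < 2 * k \<and> r < g}. of_bool (r < g) * pk V r y z)"
          by (intro sum.mono_neutral_right) auto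
        then show ?thesis by (simp add: sum.distrib \<tau>_def)
      qed
      also have "(\<Sum>r | r < 2 * k \<and> r < g. pk V r y z) \<le> (\<Sum>r<g. pk V r y z)"
        by (intro sum_mono2) (auto intro: pk_nonneg)
      finally show "(\<Sum>r<2 * k. pk V r y z) \<le> (\<Sum>r<g. pk V r y z) + \<tau> * (H / v)" by simp
    qed
    also have "\<dots> = green_energy A + a\<^sup>2 * (\<tau> * (H / v))"
      by (simp add: green_energy_def sum.distrib a_def power2_eq_square)
    \<comment> \<open>By the energy hypothesis, pairs of visits less than \<open>g\<close> apart
      cost no more than the bound for the distant pairs.\<close>
    also have "\<dots> \<le> \<tau> * a\<^sup>2 / v + a\<^sup>2 * (\<tau> * (H / v))"
      using en v_pos by (simp add: \<tau>_def a_def pos_le_divide_eq)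
    also have "\<dots> = (1 + H) * (\<tau> * a\<^sup>2 / v)" using v_pos by (simp add: field_simps)
    also have "\<dots> \<le> (2 * H) * (\<tau> * a\<^sup>2 / v)"
      using H_ge_1 v_pos \<tau> by (intro mult_right_mono) auto
    finally show ?thesis by simp
  qed
  have "EE n x (\<lambda>l. (Z l)\<^sup>2) \<le> EE n x (\<lambda>l. 2 * (\<Sum>t\<in>T. \<Sum>t' | t' \<in> T \<and> t \<le> t'. of_bool (l ! t \<in> A) * of_bool (l ! t' \<in> A)))"
  proof (rule EE_mono[OF x])
    fix l :: "'a list"
    have "(Z l)\<^sup>2 = (\<Sum>t\<in>T. \<Sum>t'\<in>T. of_bool (l ! t \<in> A) * of_bool (l ! t' \<in> A))"
      unfolding Z_def power2_eq_square by (rule sum_product)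
    also have "\<dots> \<le> 2 * (\<Sum>t\<in>T. \<Sum>t' | t' \<in> T \<and> t \<le> t'. of_bool (l ! t \<in> A) * of_bool (l ! t' \<in> A))"
      by (rule sum_symmetric_le[OF cT(2)]) (auto simp: mult.commute)
    finally show "(Z l)\<^sup>2 \<le> \<dots>" .
  qed
  also have "\<dots> = 2 * (\<Sum>t\<in>T. \<Sum>t' | t' \<in> T \<and> t \<le> t'. EE n x (\<lambda>l. of_bool (l ! t \<in> A) * of_bool (l ! t' \<in> A)))"
    unfolding EE_cmult EE_sum ..
  also have "\<dots> \<le> 2 * (\<Sum>t\<in>T. \<Sum>t' | t' \<in> T \<and> t \<le> t'. H / v * (\<Sum>y\<in>A. \<Sum>z\<in>A. pk V (t' - t) y z))"
    by (intro mult_left_mono sum_mono pair) auto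
  also have "\<dots> = 2 * (\<Sum>t\<in>T. H / v * (\<Sum>t' | t' \<in> T \<and> t \<le> t'. \<Sum>y\<in>A. \<Sum>z\<in>A. pk V (t' - t) y z))"
    by (simp add: sum_distrib_left)
  also have "\<dots> \<le> 2 * (\<Sum>t\<in>T. H / v * (2 * H * \<tau> * a\<^sup>2 / v))"
    using H_ge_1 v_pos by (intro mult_left_mono sum_mono inner) auto
  also have "\<dots> = 4 * H\<^sup>2 * (\<tau> * a / v)\<^sup>2"
    by (simp add: cT \<tau>_def power2_eq_square)
  finally have EZ2: "EE n x (\<lambda>l. (Z l)\<^sup>2) \<le> 4 * H\<^sup>2 * (\<tau> * a / v)\<^sup>2" .
  have ZI: "Z l * I l = Z l" if "length l = Suc n" for l
  proof (cases "set (tl l) \<inter> A = {}")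
    case True
    have "l ! t \<notin> A" if "t \<in> T" for t
    proof -
      have e: "l ! t = tl l ! (t - 1)" and "t - 1 < length (tl l)"
        using that Tn[OF that] g_pos \<open>length l = Suc n\<close> by (auto simp: nth_tl)
      then have "tl l ! (t - 1) \<in> set (tl l)" by (rule_tac nth_mem)
      then have "tl l ! (t - 1) \<notin> A" using True by blast
      then show "l ! t \<notin> A" by (subst e)
    qed
    then have "Z l = 0" unfolding Z_def by (intro sum.neutral ballI) simp
    then show ?thesis by simp
  qed (simp add: I_def)
  define m1 m2 where "m1 = EE n x Z" and "m2 = EE n x (\<lambda>l. (Z l)\<^sup>2)"
  have "0 < \<tau> * a / (2 * v)" using \<tau> a1 v_pos by simp
  then have m1p: "0 < m1" using EZ_ge unfolding m1_def by linarith
  \<comment> \<open>Cauchy-Schwarz in the form that the mean of the square of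
    \<open>Z l - \<mu> * I l\<close> is nonnegative, where \<open>Z l * I l = Z l\<close>. This
    \<open>\<mu>\<close> makes \<open>\<mu> * m1\<close> the bound on the second moment.\<close>
  define \<mu> where "\<mu> = 4 * H\<^sup>2 * (\<tau> * a / v)\<^sup>2 / m1"
  have "0 \<le> EE n x (\<lambda>l. (Z l - \<mu> * I l)\<^sup>2)" by (rule EE_nonneg[OF x]) simp
  also have "\<dots> = EE n x (\<lambda>l. (Z l)\<^sup>2 + (\<mu>\<^sup>2 * I l - 2 * \<mu> * Z l))"
  proof (rule EE_cong[OF x])
    fix l :: "'a list" assume l: "length l = Suc n"
    have "(Z l - \<mu> * I l)\<^sup>2 = (Z l)\<^sup>2 + (\<mu>\<^sup>2 * (I l * I l) - 2 * \<mu> * (Z l * I l))"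
      by (simp add: power2_eq_square algebra_simps)
    moreover have "I l * I l = I l" by (simp add: I_def)
    ultimately show "(Z l - \<mu> * I l)\<^sup>2 = (Z l)\<^sup>2 + (\<mu>\<^sup>2 * I l - 2 * \<mu> * Z l)"
      using ZI[OF l] by simp
  qed
  also have "\<dots> = m2 + (\<mu>\<^sup>2 * EE n x I - 2 * \<mu> * m1)"
    unfolding EE_add EE_diff EE_cmult m1_def m2_def ..
  also have "\<dots> \<le> \<mu> * m1 + (\<mu>\<^sup>2 * EE n x I - 2 * \<mu> * m1)"
    using EZ2 m1p by (simp add: m2_def \<mu>_def)
  finally have "m1 * \<mu> \<le> \<mu>\<^sup>2 * EE n x I" by (simp add: algebra_simps)
  moreover have \<mu>p: "0 < \<mu>" using m1p H_ge_1 \<tau> a1 v_pos by (simp add: \<mu>_def)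
  ultimately have "m1 \<le> \<mu> * EE n x I" by (simp add: power2_eq_square mult.assoc)
  then have "m1 * m1 \<le> (\<mu> * EE n x I) * m1" using m1p by (intro mult_right_mono) auto
  also have "\<dots> = (\<mu> * m1) * EE n x I" by (simp only: mult_ac)
  also have "\<mu> * m1 = 4 * H\<^sup>2 * (\<tau> * a / v)\<^sup>2" using m1p by (simp add: \<mu>_def)
  finally have "m1\<^sup>2 \<le> 4 * H\<^sup>2 * (\<tau> * a / v)\<^sup>2 * EE n x I"
    by (simp only: power2_eq_square)
  moreover have "(\<tau> * a / (2 * v))\<^sup>2 \<le> m1\<^sup>2"
    using EZ_ge \<tau> a1 v_pos by (intro power_mono) (auto simp: m1_def)
  ultimately have "(\<tau> * a / v)\<^sup>2 * (1 / 4) \<le> (\<tau> * a / v)\<^sup>2 * (4 * H\<^sup>2 * EE n x I)"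
    by (simp add: power_divide power_mult_distrib mult_ac)
  moreover have "0 < (\<tau> * a / v)\<^sup>2" using \<tau> a1 v_pos by simp
  ultimately have "1 / 4 \<le> 4 * H\<^sup>2 * EE n x I" by (simp only: mult_le_cancel_left_pos)
  then have "hit_prob \<le> EE n x I" using H_ge_1 by (simp add: hit_prob_def field_simps)
  moreover have "EE n x (\<lambda>l. of_bool (set (tl l) \<inter> A = {})) = EE n x (\<lambda>l. 1 - I l)"
    by (rule EE_cong[OF x]) (auto simp: I_def)
  ultimately show ?thesis using x by (simp add: EE_diff EE_const n_def)
qed

lemma EE_avoid_add:
  assumes x: "x \<in> V" and c: "\<And>y. y \<in> V \<Longrightarrow> EE n y (\<lambda>l. of_bool (set (tl l) \<inter> A = {})) \<le> c"
  shows "EE (m + n) x (\<lambda>l. of_bool (set (tl l) \<inter> A = {})) \<le> EE m x (\<lambda>l. of_bool (set (tl l) \<inter> A = {})) * c"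
proof -
  have "EE (m + n) x (\<lambda>l. of_bool (set (tl l) \<inter> A = {}))
     = EE m x (\<lambda>l. EE n (last l) (\<lambda>r. of_bool (set (tl (butlast l @ r)) \<inter> A = {})))"
    by (rule EE_markov)
  also have "\<dots> \<le> EE m x (\<lambda>l. c * of_bool (set (tl l) \<inter> A = {}))"
  proof (rule EE_mono[OF x])
    fix l :: "'a list" assume l: "length l = Suc m" "set l \<subseteq> V"
    then have ll: "last l \<in> V" by (cases l rule: rev_cases) auto
    have "EE n (last l) (\<lambda>r. of_bool (set (tl (butlast l @ r)) \<inter> A = {}))
      \<le> EE n (last l) (\<lambda>r. of_bool (set (tl l) \<inter> A = {}) * of_bool (set (tl r) \<inter> A = {}))"
    proof (rule EE_mono[OF ll])
      fix r :: "'a list" assume r: "length r = Suc n" "hd r = last l"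
      then obtain r' where r': "r = last l # r'" by (cases r) auto
      have "butlast l @ r = l @ r'" unfolding r' using l by (cases l rule: rev_cases) auto
      then have "tl (butlast l @ r) = tl l @ tl r" using l r' by (cases l) auto
      then show "of_bool (set (tl (butlast l @ r)) \<inter> A = {}) \<le>
         (of_bool (set (tl l) \<inter> A = {}) * of_bool (set (tl r) \<inter> A = {}) :: real)" by auto
    qed
    also have "\<dots> = of_bool (set (tl l) \<inter> A = {}) * EE n (last l) (\<lambda>r. of_bool (set (tl r) \<inter> A = {}))"
      by (rule EE_cmult)
    also have "\<dots> \<le> of_bool (set (tl l) \<inter> A = {}) * c"
      by (intro mult_left_mono c ll) auto
    finally show "EE n (last l) (\<lambda>r. of_bool (set (tl (butlast l @ r)) \<inter> A = {}))
        \<le> c * of_bool (set (tl l) \<inter> A = {})" by (simp add: mult.commute)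
  qed
  finally show ?thesis by (simp add: EE_cmult mult.commute)
qed

text \<open>By the Markov property the windows are \<open>J\<close> trials, each failing with
  conditional probability at most \<open>1 - hit_prob\<close>; steps beyond them only lower the
  probability of avoiding.\<close>

lemma avoid_windows:
  assumes A: "A \<subseteq> V" "A \<noteq> {}" and k: "1 \<le> k" and x: "x \<in> V"
    and en: "green_energy A * v \<le> real (2 * k) * (real (card A))\<^sup>2"
    and m: "J * (g + 2 * k) \<le> m"
  shows "EE m x (\<lambda>l. of_bool (set (tl l) \<inter> A = {})) \<le> (1 - hit_prob) ^ J"
proof -
  have w: "EE (J * (g + 2 * k)) x (\<lambda>l. of_bool (set (tl l) \<inter> A = {})) \<le> (1 - hit_prob) ^ J"
  proof (induction J)
    case 0
    show ?case by (simp add: EE_le x)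
  next
    case (Suc J)
    have "EE (J * (g + 2 * k) + (g + 2 * k)) x (\<lambda>l. of_bool (set (tl l) \<inter> A = {}))
      \<le> EE (J * (g + 2 * k)) x (\<lambda>l. of_bool (set (tl l) \<inter> A = {})) * (1 - hit_prob)"
      by (rule EE_avoid_add[OF x]) (rule avoid_window[OF A k _ en])
    also have "\<dots> \<le> (1 - hit_prob) ^ J * (1 - hit_prob)"
      using hit_prob by (intro mult_right_mono Suc) auto
    finally show ?case by (simp add: algebra_simps)
  qed
  have "EE (J * (g + 2 * k) + (m - J * (g + 2 * k))) x (\<lambda>l. of_bool (set (tl l) \<inter> A = {}))
      \<le> EE (J * (g + 2 * k)) x (\<lambda>l. of_bool (set (tl l) \<inter> A = {})) * 1"
    by (rule EE_avoid_add[OF x]) (simp add: EE_le)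
  then show ?thesis using w m by simp
qed

section \<open>Energy of the path and the first moment of final times\<close>

lemma green_energy_le: "A \<subseteq> set l \<Longrightarrow> green_energy A \<le> path_energy l"
proof -
  assume A: "A \<subseteq> set l"
  have "green_energy A \<le> (\<Sum>a\<in>A. \<Sum>j<length l. \<Sum>u<g. pk V u a (l ! j))"
    unfolding green_energy_def
    by (intro sum_mono sum_set_le_sum_nth[OF A] sum_nonneg pk_nonneg)
  also have "\<dots> \<le> path_energy l"
    unfolding path_energy_def by (intro sum_set_le_sum_nth[OF A] sum_nonneg pk_nonneg)
  finally show ?thesis .
qed

text \<open>A value \<open>w = r + u\<close> below \<open>g\<close> arises from at most
  \<open>w + 1\<close> pairs, which is the weight in \<open>short\<close>; every other return is
  bounded by \<open>H / v\<close>.\<close>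

lemma return_sum:
  assumes y: "y \<in> V"
  shows "(\<Sum>r<m. \<Sum>u<g. pk V (r + u) y y) \<le> H + real m * real g * (H / v)"
proof -
  have "(\<Sum>r<m. \<Sum>u<g. pk V (r + u) y y) \<le>
     (\<Sum>r<m. \<Sum>u<g. (\<Sum>w<g. of_bool (w = r + u) * pk V w y y) + H / v)"
  proof (intro sum_mono)
    fix r u
    have "(\<Sum>w<g. of_bool (w = r + u) * pk V w y y) = (\<Sum>w<g. if w = r + u then pk V w y y else 0)"
      by (intro sum.cong) auto
    then have "(\<Sum>w<g. of_bool (w = r + u) * pk V w y y) = of_bool (r + u < g) * pk V (r + u) y y"
      by simp
    moreover have "0 \<le> H / v" using H_ge_1 v_pos by simp
    ultimately show "pk V (r + u) y y \<le> (\<Sum>w<g. of_bool (w = r + u) * pk V w y y) + H / v"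
      using upper[of "r + u" y y] y by (cases "r + u < g") auto
  qed
  also have "\<dots> = (\<Sum>r<m. \<Sum>u<g. \<Sum>w<g. of_bool (w = r + u) * pk V w y y) + real m * real g * (H / v)"
    by (simp add: sum.distrib)
  also have "(\<Sum>r<m. \<Sum>u<g. \<Sum>w<g. of_bool (w = r + u) * pk V w y y)
     = (\<Sum>w<g. (\<Sum>r<m. \<Sum>u<g. of_bool (w = r + u)) * pk V w y y)"
  proof -
    have "(\<Sum>r<m. \<Sum>u<g. \<Sum>w<g. of_bool (w = r + u) * pk V w y y)
      = (\<Sum>r<m. \<Sum>w<g. \<Sum>u<g. of_bool (w = r + u) * pk V w y y)"
      by (rule sum.cong[OF refl sum.swap])
    also have "\<dots> = (\<Sum>w<g. \<Sum>r<m. \<Sum>u<g. of_bool (w = r + u) * pk V w y y)"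
      by (rule sum.swap)
    finally show ?thesis by (simp only: sum_distrib_right)
  qed
  also have "\<dots> \<le> (\<Sum>w<g. real (Suc w) * pk V w y y)"
  proof (intro sum_mono mult_right_mono pk_nonneg)
    fix w
    have "(\<Sum>r<m. \<Sum>u<g. of_bool (w = r + u)) \<le> (\<Sum>r<m. of_bool (r \<le> w) :: real)"
    proof (intro sum_mono)
      fix r
      have "(\<Sum>u<g. of_bool (w = r + u)) = (\<Sum>u<g. if u = w - r then of_bool (r \<le> w) else 0 :: real)"
        by (intro sum.cong) auto
      also have "\<dots> \<le> of_bool (r \<le> w)" by simp
      finally show "(\<Sum>u<g. of_bool (w = r + u)) \<le> (of_bool (r \<le> w) :: real)" .
    qed
    also have "(\<Sum>r<m. of_bool (r \<le> w)) = (\<Sum>r | r < m \<and> r \<le> w. 1 :: real)"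
      by (intro sum.mono_neutral_cong_right) auto
    also have "\<dots> \<le> (\<Sum>r\<le>w. 1)" by (rule sum_mono2) auto
    finally show "(\<Sum>r<m. \<Sum>u<g. of_bool (w = r + u)) \<le> real (Suc w)" by simp
  qed
  also have "\<dots> \<le> H" by (rule short[OF y])
  finally show ?thesis by simp
qed

text \<open>For \<open>i \<le> j\<close>, summing over the position at time \<open>j\<close> closes
  the walk by Chapman-Kolmogorov and symmetry: only returns after \<open>j - i + u\<close> steps
  remain, and \<open>return_sum\<close> bounds them.\<close>

lemma EE_path_energy:
  assumes x: "x \<in> V"
  shows "EE m x path_energy \<le> 2 * real (Suc m) * (H + real (Suc m) * real g * (H / v))"
proof -
  let ?T = "{..<Suc m}"
  have "EE m x path_energy \<le> EE m x (\<lambda>l. 2 * (\<Sum>i\<in>?T. \<Sum>j | j \<in> ?T \<and> i \<le> j. \<Sum>u<g. pk V u (l ! i) (l ! j)))"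
  proof (rule EE_mono[OF x])
    fix l :: "'a list" assume l: "length l = Suc m"
    show "path_energy l \<le> 2 * (\<Sum>i\<in>?T. \<Sum>j | j \<in> ?T \<and> i \<le> j. \<Sum>u<g. pk V u (l ! i) (l ! j))"
      unfolding path_energy_def l
      by (rule sum_symmetric_le) (auto intro!: sum_nonneg pk_nonneg sum.cong simp: pk_sym)
  qed
  also have "\<dots> = 2 * (\<Sum>i\<in>?T. \<Sum>j | j \<in> ?T \<and> i \<le> j. EE m x (\<lambda>l. \<Sum>u<g. pk V u (l ! i) (l ! j)))"
    unfolding EE_cmult EE_sum ..
  also have "\<dots> \<le> 2 * (\<Sum>i\<in>?T. H + real (Suc m) * real g * (H / v))"
  proof (intro mult_left_mono sum_mono)
    fix i assume i: "i \<in> ?T"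
    have "(\<Sum>j | j \<in> ?T \<and> i \<le> j. EE m x (\<lambda>l. \<Sum>u<g. pk V u (l ! i) (l ! j)))
      = (\<Sum>j | j \<in> ?T \<and> i \<le> j. \<Sum>y\<in>V. pk V i x y * (\<Sum>u<g. pk V (j - i + u) y y))"
    proof (rule sum.cong[OF refl])
      fix j assume j: "j \<in> {j. j \<in> ?T \<and> i \<le> j}"
      have "EE m x (\<lambda>l. \<Sum>u<g. pk V u (l ! i) (l ! j))
        = (\<Sum>y\<in>V. \<Sum>z\<in>V. pk V i x y * pk V (j - i) y z * (\<Sum>u<g. pk V u y z))"
        using j x by (intro EE_nth2) auto
      also have "\<dots> = (\<Sum>y\<in>V. \<Sum>z\<in>V. pk V i x y * pk V (j - i) y z * (\<Sum>u<g. pk V u z y))"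
        by (rule sum.cong[OF refl sum.cong[OF refl arg_cong[where f = "\<lambda>t. _ * t", OF sum.cong[OF refl pk_sym]]]])
      also have "\<dots> = (\<Sum>y\<in>V. pk V i x y * (\<Sum>z\<in>V. \<Sum>u<g. pk V (j - i) y z * pk V u z y))"
        by (simp add: sum_distrib_left mult.assoc)
      also have "\<dots> = (\<Sum>y\<in>V. pk V i x y * (\<Sum>u<g. \<Sum>z\<in>V. pk V (j - i) y z * pk V u z y))"
        by (rule sum.cong[OF refl], rule arg_cong[where f = "\<lambda>t. _ * t"], rule sum.swap)
      finally show "EE m x (\<lambda>l. \<Sum>u<g. pk V u (l ! i) (l ! j))
        = (\<Sum>y\<in>V. pk V i x y * (\<Sum>u<g. pk V (j - i + u) y y))"
        by (simp only: pk_add[OF finV])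
    qed
    also have "\<dots> = (\<Sum>y\<in>V. pk V i x y * (\<Sum>j | j \<in> ?T \<and> i \<le> j. \<Sum>u<g. pk V (j - i + u) y y))"
      by (subst sum.swap) (simp add: sum_distrib_left)
    also have "\<dots> \<le> (\<Sum>y\<in>V. pk V i x y * (H + real (Suc m) * real g * (H / v)))"
    proof (intro sum_mono mult_left_mono pk_nonneg)
      fix y assume y: "y \<in> V"
      have "(\<Sum>j | j \<in> ?T \<and> i \<le> j. \<Sum>u<g. pk V (j - i + u) y y) \<le> (\<Sum>r<Suc m. \<Sum>u<g. pk V (r + u) y y)"
      proof (rule sum_le_included[where i = "\<lambda>r. r + i"])
        show "\<forall>j\<in>{j. j \<in> ?T \<and> i \<le> j}. \<exists>r\<in>?T. r + i = j \<and>
          (\<Sum>u<g. pk V (j - i + u) y y) \<le> (\<Sum>u<g. pk V (r + u) y y)"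
        proof
          fix j assume "j \<in> {j. j \<in> ?T \<and> i \<le> j}"
          then show "\<exists>r\<in>?T. r + i = j \<and> (\<Sum>u<g. pk V (j - i + u) y y) \<le> (\<Sum>u<g. pk V (r + u) y y)"
            by (intro bexI[of _ "j - i"]) auto
        qed
      qed (auto intro!: sum_nonneg pk_nonneg)
      then show "(\<Sum>j | j \<in> ?T \<and> i \<le> j. \<Sum>u<g. pk V (j - i + u) y y) \<le> H + real (Suc m) * real g * (H / v)"
        using return_sum[OF y, of "Suc m"] by linarith
    qed
    also have "\<dots> = H + real (Suc m) * real g * (H / v)"
      unfolding sum_distrib_right[symmetric] by (simp add: pk_sum_V[OF x])
    finally show "(\<Sum>j | j \<in> ?T \<and> i \<le> j. EE m x (\<lambda>l. \<Sum>u<g. pk V u (l ! i) (l ! j)))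
      \<le> H + real (Suc m) * real g * (H / v)" .
  qed simp
  also have "\<dots> = 2 * real (Suc m) * (H + real (Suc m) * real g * (H / v))"
    by (simp only: sum_constant card_lessThan mult.assoc)
  finally show ?thesis .
qed

text \<open>Either the path up to time \<open>m\<close> has energy above \<open>K\<close>, which
  Markov's inequality controls, or its loop erasure is a large set of energy at most
  \<open>K\<close>, which the following \<open>J\<close> windows miss with probability at most
  \<open>(1 - hit_prob) ^ J\<close>.\<close>

lemma EE_length_LE_time:
  assumes x: "x \<in> V" and D: "0 < D" and k: "1 \<le> k"
    and m: "m + J * (g + 2 * k) \<le> n" and K: "0 < K" "K * v \<le> real (2 * k) * (real D)\<^sup>2"
  shows "EE n x (\<lambda>l. of_bool (D < length (LE (take (Suc m) l)) \<and>
      set (LE (take (Suc m) l)) \<inter> set (drop (Suc m) l) = {}))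
    \<le> 2 * real (Suc m) * (H + real (Suc m) * real g * (H / v)) / K + (1 - hit_prob) ^ J"
proof -
  let ?B = "\<lambda>l. of_bool (D < length (LE (take (Suc m) l)) \<and>
      set (LE (take (Suc m) l)) \<inter> set (drop (Suc m) l) = {}) :: real"
  define c where "c = (1 - hit_prob) ^ J"
  have c0: "0 \<le> c" using hit_prob by (simp add: c_def)
  have "EE (m + (n - m)) x ?B = EE m x (\<lambda>l. EE (n - m) (last l) (\<lambda>r. ?B (butlast l @ r)))"
    by (rule EE_markov)
  also have "\<dots> \<le> EE m x (\<lambda>l. 1 / K * path_energy l + c)"
  proof (rule EE_mono[OF x])
    fix l :: "'a list" assume l: "length l = Suc m" "set l \<subseteq> V"
    then have ll: "last l \<in> V" by (cases l rule: rev_cases) auto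
    have pe: "0 \<le> path_energy l" unfolding path_energy_def by (intro sum_nonneg pk_nonneg)
    have "EE (n - m) (last l) (\<lambda>r. ?B (butlast l @ r))
      = EE (n - m) (last l) (\<lambda>r. of_bool (D < length (LE l)) * of_bool (set (tl r) \<inter> set (LE l) = {}))"
    proof (rule EE_cong[OF ll])
      fix r :: "'a list" assume r: "length r = Suc (n - m)" "hd r = last l"
      then obtain r' where r': "r = last l # r'" by (cases r) auto
      have "butlast l @ r = l @ r'" unfolding r' using l by (cases l rule: rev_cases) auto
      then show "?B (butlast l @ r) = of_bool (D < length (LE l)) * of_bool (set (tl r) \<inter> set (LE l) = {})"
        using l r' by auto
    qed
    also have "\<dots> = of_bool (D < length (LE l)) * EE (n - m) (last l) (\<lambda>r. of_bool (set (tl r) \<inter> set (LE l) = {}))"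
      by (rule EE_cmult)
    also have "\<dots> \<le> 1 / K * path_energy l + c"
    proof (cases "D < length (LE l) \<and> path_energy l \<le> K")
      case True
      have "green_energy (set (LE l)) \<le> K"
        using green_energy_le[OF set_LE[of l]] True by linarith
      then have "green_energy (set (LE l)) * v \<le> K * v" using v_pos by (intro mult_right_mono) auto
      also have "\<dots> \<le> real (2 * k) * (real D)\<^sup>2" by (rule K)
      also have "\<dots> \<le> real (2 * k) * (real (card (set (LE l))))\<^sup>2"
        using True distinct_card[OF distinct_LE[of l]] by (intro mult_left_mono power_mono) auto
      finally have e: "green_energy (set (LE l)) * v \<le> real (2 * k) * (real (card (set (LE l))))\<^sup>2" .
      have "EE (n - m) (last l) (\<lambda>r. of_bool (set (tl r) \<inter> set (LE l) = {})) \<le> c"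
        unfolding c_def
      proof (rule avoid_windows[OF _ _ k ll e])
        show "set (LE l) \<subseteq> V" using set_LE[of l] l by blast
        show "set (LE l) \<noteq> {}" using l by auto
      qed (use m in simp)
      moreover have "0 \<le> 1 / K * path_energy l" using pe K by simp
      ultimately show ?thesis using True by simp
    next
      case False
      show ?thesis
      proof (cases "D < length (LE l)")
        case True
        then have "1 \<le> 1 / K * path_energy l" using False K by (simp add: field_simps)
        moreover have "EE (n - m) (last l) (\<lambda>r. of_bool (set (tl r) \<inter> set (LE l) = {})) \<le> 1"
          by (rule EE_le[OF ll]) simp
        ultimately show ?thesis using c0 True by simp
      next
        case F: False
        have "0 \<le> 1 / K * path_energy l" using pe K by simp
        then show ?thesis using F c0 by simp
      qed
    qed
    finally show "EE (n - m) (last l) (\<lambda>r. ?B (butlast l @ r)) \<le> 1 / K * path_energy l + c" .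
  qed
  also have "\<dots> = 1 / K * EE m x path_energy + c"
    unfolding EE_add EE_cmult by (simp add: EE_const x)
  also have "\<dots> \<le> 1 / K * (2 * real (Suc m) * (H + real (Suc m) * real g * (H / v))) + c"
    using K by (intro add_right_mono mult_left_mono EE_path_energy x) auto
  finally show ?thesis using m by (simp add: c_def)
qed

text \<open>By \<open>length_LE_le_card\<close> more than \<open>D\<close> times must be final with
  a loop erasure longer than \<open>D\<close>, and their expected number is bounded. The last
  \<open>J * (g + 2 * k)\<close> times have too little future for \<open>J\<close> windows and are
  counted with probability 1.\<close>

lemma prob_LE_long:
  assumes x: "x \<in> V" and D: "0 < D" and k: "1 \<le> k" and n: "Suc n \<le> T"
    and K: "0 < K" "K * v \<le> real (2 * k) * (real D)\<^sup>2"
  shows "EE n x (\<lambda>l. of_bool (2 * D < length (LE l))) \<le>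
     (real (J * (g + 2 * k)) +
       real T * (2 * real T * (H + real T * real g * (H / v)) / K + (1 - hit_prob) ^ J)) / D"
proof -
  let ?B = "\<lambda>m l. D < length (LE (take (Suc m) l)) \<and>
      set (LE (take (Suc m) l)) \<inter> set (drop (Suc m) l) = {}"
  define w where "w = J * (g + 2 * k)"
  define \<delta> where "\<delta> = 2 * real T * (H + real T * real g * (H / v)) / K + (1 - hit_prob) ^ J"
  have \<delta>0: "0 \<le> \<delta>" using hit_prob H_ge_1 v_pos K by (simp add: \<delta>_def)
  have "EE n x (\<lambda>l. of_bool (2 * D < length (LE l))) \<le> EE n x (\<lambda>l. 1 / real D * (\<Sum>m<Suc n. of_bool (?B m l)))"
  proof (rule EE_mono[OF x])
    fix l :: "'a list" assume l: "length l = Suc n"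
    have "length (LE l) \<le> D + card {m. m < Suc n \<and> ?B m l}"
      using length_LE_le_card[of l D] by (simp add: l)
    moreover have "real (card {m. m < Suc n \<and> ?B m l}) = (\<Sum>m<Suc n. of_bool (?B m l))"
    proof -
      have "(\<Sum>m<Suc n. of_bool (?B m l)) = (\<Sum>m\<in>{m. m < Suc n \<and> ?B m l}. 1 :: real)"
        by (intro sum.mono_neutral_cong_right) auto
      then show ?thesis by simp
    qed
    ultimately have "real (length (LE l)) \<le> real D + (\<Sum>m<Suc n. of_bool (?B m l))"
      by linarith
    moreover have "0 \<le> (\<Sum>m<Suc n. of_bool (?B m l) :: real)" by (intro sum_nonneg) simp
    ultimately show "of_bool (2 * D < length (LE l)) \<le> 1 / real D * (\<Sum>m<Suc n. of_bool (?B m l))"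
      using D by (auto simp: field_simps simp del: sum.lessThan_Suc)
  qed
  also have "\<dots> = 1 / real D * (\<Sum>m<Suc n. EE n x (\<lambda>l. of_bool (?B m l)))"
    unfolding EE_cmult EE_sum ..
  finally have 1: "EE n x (\<lambda>l. of_bool (2 * D < length (LE l)))
    \<le> 1 / real D * (\<Sum>m<Suc n. EE n x (\<lambda>l. of_bool (?B m l)))" .
  have "(\<Sum>m<Suc n. EE n x (\<lambda>l. of_bool (?B m l))) \<le> (\<Sum>m<Suc n. of_bool (n < m + w) + \<delta>)"
  proof (rule sum_mono)
    fix m assume m: "m \<in> {..<Suc n}"
    show "EE n x (\<lambda>l. of_bool (?B m l)) \<le> of_bool (n < m + w) + \<delta>"
    proof (cases "n < m + w")
      case True
      have "EE n x (\<lambda>l. of_bool (?B m l)) \<le> 1" by (rule EE_le[OF x]) simp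
      then show ?thesis using True \<delta>0 by simp
    next
      case False
      then have mn: "m + J * (g + 2 * k) \<le> n" by (simp add: w_def)
      have "EE n x (\<lambda>l. of_bool (?B m l)) \<le>
          2 * real (Suc m) * (H + real (Suc m) * real g * (H / v)) / K + (1 - hit_prob) ^ J"
        by (rule EE_length_LE_time[OF x D k mn K])
      also have "\<dots> \<le> \<delta>" unfolding \<delta>_def
        using m n H_ge_1 v_pos K
        by (intro add_right_mono divide_right_mono mult_mono add_left_mono) auto
      finally show ?thesis using False by simp
    qed
  qed
  also have "\<dots> = (\<Sum>m<Suc n. of_bool (n < m + w)) + real (Suc n) * \<delta>"
    by (simp only: sum.distrib sum_constant card_lessThan)
  finally have 2: "(\<Sum>m<Suc n. EE n x (\<lambda>l. of_bool (?B m l)))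
    \<le> (\<Sum>m<Suc n. of_bool (n < m + w)) + real (Suc n) * \<delta>" .
  have 3: "(\<Sum>m<Suc n. of_bool (n < m + w)) \<le> real w"
  proof -
    have "(\<Sum>m<Suc n. of_bool (n < m + w)) = (\<Sum>m | m < Suc n \<and> n < m + w. 1 :: real)"
      by (intro sum.mono_neutral_cong_right) auto
    also have "\<dots> = real (card {m. m < Suc n \<and> n < m + w})" by simp
    also have "card {m. m < Suc n \<and> n < m + w} \<le> card {Suc n - w..<Suc n}" by (intro card_mono) auto
    also have "card {Suc n - w..<Suc n} \<le> w" by simp
    finally show ?thesis by simp
  qed
  have "real (Suc n) * \<delta> \<le> real T * \<delta>" using n \<delta>0 by (intro mult_right_mono) auto
  with 2 3 have "(\<Sum>m<Suc n. EE n x (\<lambda>l. of_bool (?B m l))) \<le> real w + real T * \<delta>"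
    by linarith
  then have "1 / real D * (\<Sum>m<Suc n. EE n x (\<lambda>l. of_bool (?B m l))) \<le> 1 / real D * (real w + real T * \<delta>)"
    by (intro mult_left_mono) simp_all
  with 1 have "EE n x (\<lambda>l. of_bool (2 * D < length (LE l))) \<le> 1 / real D * (real w + real T * \<delta>)"
    by (rule order.trans)
  then show ?thesis unfolding w_def \<delta>_def by simp
qed

end

section \<open>Exponential decay under killing\<close>

lemma exp_neg_le_inverse: "0 < x \<Longrightarrow> exp (- x) \<le> 1 / (x::real)"
proof -
  assume x: "0 < x"
  have "x \<le> exp x" using exp_ge_add_one_self[of x] by linarith
  then show ?thesis using x by (simp add: exp_minus field_simps)
qed

lemma power_le_exp_neg:
  assumes "0 \<le> x" "x \<le> (1::real)"
  shows "(1 - x) ^ n \<le> exp (- (x * real n))"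
proof -
  have "(1 - x) ^ n \<le> exp (- x) ^ n"
    using assms exp_ge_add_one_self[of "- x"] by (intro power_mono) auto
  then show ?thesis by (simp add: exp_of_nat_mult[symmetric] mult.commute)
qed

lemma power_le_fact_exp: "0 \<le> x \<Longrightarrow> x ^ n \<le> fact n * exp (x::real)"
proof -
  assume x: "0 \<le> x"
  have "x ^ n / fact n = (\<Sum>k\<in>{n}. inverse (fact k) * x ^ k)" by (simp add: field_simps)
  also have "\<dots> \<le> (\<Sum>k. inverse (fact k) * x ^ k)"
    using x by (intro sum_le_suminf summable_exp) auto
  also have "\<dots> = exp x" by (simp add: exp_def)
  finally show ?thesis by (simp add: field_simps)
qed

context finite_chain
begin

definition simple_paths :: "'a \<Rightarrow> 'a list set" where
  "simple_paths x = {\<gamma>. \<gamma> \<noteq> [] \<and> hd \<gamma> = x \<and> set \<gamma> \<subseteq> V \<and> distinct \<gamma>}"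

lemma finite_simple_paths: "finite (simple_paths x)"
proof (rule finite_subset)
  show "simple_paths x \<subseteq> {\<gamma>. set \<gamma> \<subseteq> V \<and> length \<gamma> \<le> card V}"
    unfolding simple_paths_def using finV
    by (auto simp flip: distinct_card intro!: card_mono)
  show "finite {\<gamma>. set \<gamma> \<subseteq> V \<and> length \<gamma> \<le> card V}"
    using finV by (rule finite_lists_length_le)
qed

lemma LE_in_simple_paths:
  "length l = Suc n \<Longrightarrow> set l \<subseteq> V \<Longrightarrow> LE l \<in> simple_paths (hd l)"
  using set_LE[of l] distinct_LE[of l] by (cases l) (auto simp: simple_paths_def)

lemma sum_erasure_weight_sums:
  assumes q: "0 \<le> q" "q < 1" and x: "x \<in> V" and F: "F \<subseteq> simple_paths x"
  shows "(\<lambda>n. EE n x (\<lambda>l. of_bool (LE l \<in> F)) * q ^ n) sums (\<Sum>\<gamma>\<in>F. erasure_weight V \<gamma> q)"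
proof -
  have fF: "finite F" using F finite_simple_paths finite_subset by blast
  have "(\<lambda>n. \<Sum>\<gamma>\<in>F. EE n (hd \<gamma>) (\<lambda>l. of_bool (set l \<subseteq> V \<and> LE l = \<gamma>)) * q ^ n) sums (\<Sum>\<gamma>\<in>F. erasure_weight V \<gamma> q)"
    using F by (intro sums_sum erasure_weight_sums q order.refl) (auto simp: simple_paths_def)
  moreover have "(\<Sum>\<gamma>\<in>F. EE n (hd \<gamma>) (\<lambda>l. of_bool (set l \<subseteq> V \<and> LE l = \<gamma>)) * q ^ n)
     = EE n x (\<lambda>l. of_bool (LE l \<in> F)) * q ^ n" for n
  proof -
    have "(\<Sum>\<gamma>\<in>F. EE n (hd \<gamma>) (\<lambda>l. of_bool (set l \<subseteq> V \<and> LE l = \<gamma>)) * q ^ n)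
      = (\<Sum>\<gamma>\<in>F. EE n x (\<lambda>l. of_bool (set l \<subseteq> V \<and> LE l = \<gamma>))) * q ^ n"
      using F by (simp add: sum_distrib_right simple_paths_def subset_iff)
    also have "(\<Sum>\<gamma>\<in>F. EE n x (\<lambda>l. of_bool (set l \<subseteq> V \<and> LE l = \<gamma>)))
      = EE n x (\<lambda>l. \<Sum>\<gamma>\<in>F. of_bool (set l \<subseteq> V \<and> LE l = \<gamma>))"
      by (rule EE_sum[symmetric])
    also have "\<dots> = EE n x (\<lambda>l. of_bool (LE l \<in> F))"
    proof (rule EE_cong[OF x])
      fix l :: "'a list" assume "set l \<subseteq> V"
      then have "(\<Sum>\<gamma>\<in>F. of_bool (set l \<subseteq> V \<and> LE l = \<gamma>)) = (\<Sum>\<gamma>\<in>F. if LE l = \<gamma> then 1 else 0 :: real)"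
        by (intro sum.cong) auto
      then show "(\<Sum>\<gamma>\<in>F. of_bool (set l \<subseteq> V \<and> LE l = \<gamma>)) = (of_bool (LE l \<in> F) :: real)"
        using fF by simp
    qed
    finally show ?thesis .
  qed
  ultimately show ?thesis by simp
qed

text \<open>Different paths correspond to disjoint events, so their total weight is at most the
  expected lifetime of the killed walk.\<close>

lemma sum_erasure_weight_le:
  assumes q: "0 \<le> q" "q < 1" and x: "x \<in> V" and F: "F \<subseteq> simple_paths x"
  shows "(\<Sum>\<gamma>\<in>F. erasure_weight V \<gamma> q) \<le> 1 / (1 - q)"
proof (rule sums_le[OF _ sum_erasure_weight_sums[OF assms] geometric_sums])
  fix n
  have "EE n x (\<lambda>l. of_bool (LE l \<in> F)) \<le> 1" by (rule EE_le[OF x]) simp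
  then show "EE n x (\<lambda>l. of_bool (LE l \<in> F)) * q ^ n \<le> q ^ n"
    using q by (simp add: mult_left_le_one_le EE_nonneg x)
qed (use q in auto)

end

text \<open>\<open>H\<close> dominates all constants of the chain, so the bounds below may lose powers of \<open>H\<close>. The exponents
  43, 45, 48, ... are chosen only to be sufficiently separated.\<close>

locale lerw_chain = mixing_chain V P g "real H" v for V :: "'a set" and P g and H :: nat and v +
  fixes s :: nat
  assumes long: "0 < q \<Longrightarrow> q < 1 \<Longrightarrow>
      (\<Sum>n. ((\<Sum>y\<in>V. pk V (n + g) y y) - 1) * q ^ (n + g)) \<le> real H * real g"
    and H_ge: "1000 \<le> H" and s_pos: "1 \<le> s" and v_le: "v \<le> (real s)\<^sup>2" and v_ge: "(real s)\<^sup>2 \<le> 4 * v"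
    and g_le: "g \<le> H * s"
begin

sublocale heat_trace_chain V P g "real H" "real H * real g"
  by unfold_locales (use short long in auto)

abbreviation "h \<equiv> real H"
abbreviation "\<sigma> \<equiv> real s"

definition D :: nat where "D = H ^ 43 * s"
definition S :: real where "S = h ^ 45 * \<sigma>"
definition q\<^sub>S :: real where "q\<^sub>S = 1 - 1 / S"

lemma h_ge: "1000 \<le> h" using H_ge by simp
lemma h_pos: "0 < h" using h_ge by linarith
lemma \<sigma>_ge: "1 \<le> \<sigma>" using s_pos by simp
lemma \<sigma>_pos: "0 < \<sigma>" using \<sigma>_ge by linarith
lemma g_le': "real g \<le> h * \<sigma>" using g_le by (metis of_nat_le_iff of_nat_mult)

lemma h_power_mono: "a \<le> b \<Longrightarrow> h ^ a \<le> h ^ b"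
  using h_ge by (intro power_increasing) auto

lemma D_real: "real D = h ^ 43 * \<sigma>" by (simp add: D_def)
lemma D_pos: "0 < D" using H_ge s_pos by (simp add: D_def)

lemma g_div_v: "real g * (h / v) \<le> 4 * h\<^sup>2 / \<sigma>"
proof -
  have "real g * (h / v) \<le> (h * \<sigma>) * (h / v)"
    using g_le' h_pos v_pos by (intro mult_right_mono) auto
  also have "\<dots> \<le> (h * \<sigma>) * (h / (\<sigma>\<^sup>2 / 4))"
    using v_ge h_pos \<sigma>_pos v_pos by (intro mult_left_mono divide_left_mono) auto
  also have "\<dots> = 4 * h\<^sup>2 / \<sigma>" using \<sigma>_pos by (simp add: field_simps power2_eq_square)
  finally show ?thesis .
qed

text \<open>The value is chosen so that the \<open>H ^ 48 * s\<close> early times contribute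
  \<open>D / 6\<close> in total.\<close>

lemma prob_LE_long_early:
  assumes x: "x \<in> V" and n: "n < H ^ 48 * s"
  shows "EE n x (\<lambda>l. of_bool (2 * D < length (LE l))) \<le> 1 / (6 * h ^ 5)"
proof -
  \<comment> \<open>For these \<open>k\<close> and \<open>D\<close>, \<open>Kv\<close> permits the
    power 24 + 2 * 43 = 110 of \<open>h\<close> in \<open>K\<close>. The mean energy is at most
    \<open>10 * h ^ 98 * \<sigma>\<close>, which leaves \<open>10 / h ^ 12\<close>; and
    \<open>J = H ^ 13\<close> bounds the probability of missing all windows by
    \<open>16 / h ^ 11\<close>.\<close>
  define J k T K where "J = H ^ 13" and "k = H ^ 24 * s" and "T = H ^ 48 * s" and "K = h ^ 110 * \<sigma>"
  have Tr: "real T = h ^ 48 * \<sigma>" by (simp add: T_def)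
  have Kv: "K * v \<le> real (2 * k) * (real D)\<^sup>2"
  proof -
    have "K * v \<le> K * \<sigma>\<^sup>2" using v_le h_pos \<sigma>_pos by (intro mult_left_mono) (auto simp: K_def)
    also have "\<dots> = h ^ 110 * \<sigma> ^ 3" by (simp add: K_def power3_eq_cube power2_eq_square)
    also have "\<dots> \<le> 2 * (h ^ 110 * \<sigma> ^ 3)" using h_pos \<sigma>_pos by simp
    also have "\<dots> = real (2 * k) * (real D)\<^sup>2"
      by (simp add: k_def D_real power_mult_distrib power3_eq_cube power2_eq_square flip: power_mult power_add)
    finally show ?thesis .
  qed
  have "EE n x (\<lambda>l. of_bool (2 * D < length (LE l))) \<le>
     (real (J * (g + 2 * k)) + real T * (2 * real T * (h + real T * real g * (h / v)) / K + (1 - hit_prob) ^ J)) / D"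
  proof (rule prob_LE_long[OF x D_pos])
    show "1 \<le> k" using H_ge s_pos by (simp add: k_def)
    show "0 < K" using h_pos \<sigma>_pos by (simp add: K_def)
  qed (use n Kv in \<open>auto simp: T_def\<close>)
  also have "\<dots> \<le> (3 * h ^ 37 * \<sigma> + real T * (10 / h ^ 12 + 16 / h ^ 11)) / D"
  proof (intro divide_right_mono add_mono mult_left_mono)
    have "real (J * (g + 2 * k)) = h ^ 13 * (real g + 2 * (h ^ 24 * \<sigma>))" by (simp add: J_def k_def)
    also have "\<dots> \<le> h ^ 13 * (h ^ 24 * \<sigma> + 2 * (h ^ 24 * \<sigma>))"
    proof (intro mult_left_mono add_right_mono)
      have "h * \<sigma> \<le> h ^ 24 * \<sigma>" using h_power_mono[of 1 24] \<sigma>_pos by (intro mult_right_mono) auto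
      then show "real g \<le> h ^ 24 * \<sigma>" using g_le' by linarith
    qed simp
    also have "\<dots> = 3 * h ^ 37 * \<sigma>" by (simp flip: power_add add: mult_ac)
    finally show "real (J * (g + 2 * k)) \<le> 3 * h ^ 37 * \<sigma>" .
  next
    have "h + real T * real g * (h / v) \<le> h ^ 50 + h ^ 48 * \<sigma> * (4 * h\<^sup>2 / \<sigma>)"
      using g_div_v h_power_mono[of 1 50] h_pos \<sigma>_pos unfolding Tr mult.assoc
      by (intro add_mono mult_left_mono) auto
    also have "\<dots> = 5 * h ^ 50" using \<sigma>_pos by (simp flip: power_add)
    finally have "2 * real T * (h + real T * real g * (h / v)) / K \<le> 2 * real T * (5 * h ^ 50) / K"
      using h_pos \<sigma>_pos by (intro divide_right_mono mult_left_mono) (auto simp: K_def)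
    also have "\<dots> = 10 * (h ^ 98 * \<sigma>) / (h ^ 110 * \<sigma>)"
      by (simp add: Tr K_def mult_ac flip: power_add)
    also have "\<dots> = 10 / h ^ 12"
      using h_pos \<sigma>_pos by (simp add: field_simps flip: power_add)
    finally show "2 * real T * (h + real T * real g * (h / v)) / K \<le> 10 / h ^ 12" .
  next
    have "(1 - hit_prob) ^ J \<le> exp (- (hit_prob * real J))"
      using hit_prob by (intro power_le_exp_neg) auto
    also have "\<dots> \<le> 1 / (hit_prob * real J)"
      using hit_prob h_pos by (intro exp_neg_le_inverse) (simp add: J_def)
    also have "\<dots> = 16 / h ^ 11"
      using h_pos by (simp add: hit_prob_def J_def field_simps flip: power_add)
    finally show "(1 - hit_prob) ^ J \<le> 16 / h ^ 11" .
  qed auto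
  also have "\<dots> = 19 / h ^ 6 + 10 / h ^ 7"
    using h_pos \<sigma>_pos by (simp add: Tr D_real field_simps flip: power_add)
  also have "\<dots> \<le> 1 / (6 * h ^ 5)"
  proof -
    have "10 / h ^ 7 \<le> 10 / h ^ 6"
      using h_pos h_power_mono[of 6 7] by (intro divide_left_mono) auto
    then have "19 / h ^ 6 + 10 / h ^ 7 \<le> 29 / h ^ 6" by simp
    also have "\<dots> = (29 / h) / h ^ 5" by (simp add: power_add[of h 1 5, simplified])
    also have "\<dots> \<le> (1 / 6) / h ^ 5"
      using h_ge by (intro divide_right_mono) (auto simp: field_simps)
    finally show ?thesis by simp
  qed
  finally show ?thesis .
qed

lemma S_ge: "1000 * 2 \<le> S"
proof -
  have "1000 * 2 \<le> h ^ 2 * 1" using mult_mono[of 1000 h 2 h] h_ge by (simp add: power2_eq_square)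
  also have "\<dots> \<le> h ^ 45 * \<sigma>" using h_power_mono[of 2 45] \<sigma>_ge h_pos by (intro mult_mono) auto
  finally show ?thesis by (simp add: S_def)
qed

lemma S_pos: "0 < S" using S_ge by linarith

lemma q\<^sub>S: "1 / 2 \<le> q\<^sub>S" "0 \<le> q\<^sub>S" "q\<^sub>S < 1" "1 / (1 - q\<^sub>S) = S"
proof -
  have "1 / S \<le> 1 / 2" using S_ge by (intro divide_left_mono) auto
  then show "1 / 2 \<le> q\<^sub>S" "0 \<le> q\<^sub>S" by (simp_all add: q\<^sub>S_def)
  show "q\<^sub>S < 1" "1 / (1 - q\<^sub>S) = S" using S_pos by (simp_all add: q\<^sub>S_def)
qed

lemma sum_erasure_weight_window:
  assumes x: "x \<in> V"
  shows "(\<Sum>\<gamma> | \<gamma> \<in> simple_paths x \<and> 2 * D < length \<gamma> \<and> length \<gamma> \<le> 4 * D. erasure_weight V \<gamma> q\<^sub>S) \<le> D / 3"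
proof -
  define F where "F = {\<gamma>. \<gamma> \<in> simple_paths x \<and> 2 * D < length \<gamma> \<and> length \<gamma> \<le> 4 * D}"
  \<comment> \<open>From \<open>T\<close> on killing alone suffices:
    \<open>q\<^sub>S ^ T * S\<close> is at most \<open>S\<^sup>2 / T = h ^ 42 * \<sigma>\<close>,
    which is below \<open>D / 6\<close>.\<close>
  define T where "T = H ^ 48 * s"
  have Tr: "real T = h ^ 48 * \<sigma>" by (simp add: T_def)
  define b where "b n = (if n < T then 1 / (6 * h ^ 5) * q\<^sub>S ^ n else q\<^sub>S ^ n)" for n
  have sq: "(\<lambda>n. q\<^sub>S ^ n) sums S" using geometric_sums[of q\<^sub>S] q\<^sub>S by simp
  have tail: "(\<lambda>n. q\<^sub>S ^ (n + T)) sums (q\<^sub>S ^ T * S)"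
    using sums_mult[OF sq, of "q\<^sub>S ^ T"] by (simp add: power_add mult_ac)
  have bs: "b sums (q\<^sub>S ^ T * S + (\<Sum>n<T. b n))"
  proof -
    have "(\<lambda>n. b (n + T)) sums (q\<^sub>S ^ T * S)" using tail by (simp add: b_def)
    then show ?thesis by (simp add: sums_iff_shift)
  qed
  have "(\<Sum>\<gamma>\<in>F. erasure_weight V \<gamma> q\<^sub>S) \<le> q\<^sub>S ^ T * S + (\<Sum>n<T. b n)"
  proof (rule sums_le[OF _ sum_erasure_weight_sums[OF q\<^sub>S(2,3) x] bs])
    show "F \<subseteq> simple_paths x" by (auto simp: F_def)
    fix n
    have "EE n x (\<lambda>l. of_bool (LE l \<in> F)) \<le> (if n < T then 1 / (6 * h ^ 5) else 1)"
    proof (cases "n < T")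
      case True
      have "EE n x (\<lambda>l. of_bool (LE l \<in> F)) \<le> EE n x (\<lambda>l. of_bool (2 * D < length (LE l)))"
        by (rule EE_mono[OF x]) (auto simp: F_def)
      then show ?thesis using prob_LE_long_early[OF x, of n] True by (simp add: T_def)
    next
      case False
      have "EE n x (\<lambda>l. of_bool (LE l \<in> F)) \<le> 1" by (rule EE_le[OF x]) simp
      then show ?thesis using False by simp
    qed
    then show "EE n x (\<lambda>l. of_bool (LE l \<in> F)) * q\<^sub>S ^ n \<le> b n"
      using q\<^sub>S mult_right_mono[of _ _ "q\<^sub>S ^ n"] by (fastforce simp: b_def split: if_splits)
  qed
  also have "(\<Sum>n<T. b n) \<le> (\<Sum>n<T. 1 / (6 * h ^ 5))"
    using q\<^sub>S h_pos by (intro sum_mono) (auto simp: b_def power_le_one intro!: divide_right_mono)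
  also have "\<dots> = D / 6" using h_pos by (simp add: Tr D_real field_simps flip: power_add)
  also have "q\<^sub>S ^ T * S \<le> D / 6"
  proof -
    have "q\<^sub>S ^ T \<le> exp (- (1 / S * real T))"
      unfolding q\<^sub>S_def using S_ge by (intro power_le_exp_neg) auto
    also have "\<dots> \<le> 1 / (1 / S * real T)"
      using S_pos h_pos \<sigma>_pos by (intro exp_neg_le_inverse) (simp add: Tr)
    finally have "q\<^sub>S ^ T * S \<le> 1 / (1 / S * real T) * S" using S_pos by (intro mult_right_mono) auto
    also have "\<dots> = h ^ 42 * \<sigma>"
      using h_pos \<sigma>_pos by (simp add: S_def Tr field_simps flip: power_add)
    also have "\<dots> \<le> (h ^ 42 * \<sigma>) * (h / 6)"
      using h_ge \<sigma>_pos by (intro mult_left_mono[of 1 _ "h ^ 42 * \<sigma>", simplified mult_1_right]) auto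
    also have "\<dots> = D / 6" by (simp add: D_real power_add[of h 42 1, simplified])
    finally show ?thesis .
  qed
  finally show ?thesis by (simp add: F_def)
qed

text \<open>The tilt anticipates the length-dependent factor of
  \<open>erasure_weight_compare\<close>, whose exponent is at most \<open>2 * h * length / S\<close>
  because \<open>q - q\<^sub>S\<close> is at most \<open>1 / S\<close>.\<close>

definition \<theta> :: real where "\<theta> = 2 * h / S"
definition tail :: "nat \<Rightarrow> 'a \<Rightarrow> real" where
  "tail m x = (\<Sum>\<gamma> | \<gamma> \<in> simple_paths x \<and> m < length \<gamma>. exp (\<theta> * length \<gamma>) * erasure_weight V \<gamma> q\<^sub>S)"

lemma \<theta>: "0 \<le> \<theta>" "\<theta> * real (4 * D) \<le> 1"
proof -
  show "0 \<le> \<theta>" using S_pos by (simp add: \<theta>_def)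
  have "\<theta> * real (4 * D) = 8 * (h ^ 44 * \<sigma>) / (h ^ 45 * \<sigma>)"
    by (simp add: \<theta>_def D_real S_def power_add[of h 1 43, simplified])
  also have "\<dots> = 8 / h" using h_pos \<sigma>_pos by (simp add: power_add[of h 1 44, simplified])
  also have "\<dots> \<le> 1" using h_ge by simp
  finally show "\<theta> * real (4 * D) \<le> 1" .
qed

lemma erasure_weight_S_nonneg: "0 \<le> erasure_weight V \<gamma> q\<^sub>S"
  by (rule erasure_weight_nonneg[OF q\<^sub>S(2,3) order.refl])

lemma exp_theta_le: "m \<le> 4 * D \<Longrightarrow> exp (\<theta> * real m) \<le> 3"
proof -
  assume "m \<le> 4 * D"
  then have "\<theta> * real m \<le> \<theta> * real (4 * D)" using \<theta> by (intro mult_left_mono) auto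
  then have "exp (\<theta> * real m) \<le> exp 1" using \<theta> by simp
  then show ?thesis using exp_le by linarith
qed

text \<open>A path is cut after its first \<open>j\<close> vertices. The weight is
  submultiplicative, the tilt of the first piece is at most 3, and the rest is longer than
  \<open>m - 4 * D\<close>; as the rows of \<open>P\<close> sum to 1, the joining step preserves the
  bound \<open>B\<close>.\<close>

lemma tail_le_split:
  assumes x: "x \<in> V" and j: "1 \<le> j" "j \<le> 4 * D" and m: "4 * D \<le> m"
    and B: "\<And>y. y \<in> V \<Longrightarrow> tail (m - 4 * D) y \<le> B"
  shows "tail m x \<le> 3 * B * (\<Sum>\<gamma> | \<gamma> \<in> simple_paths x \<and> length \<gamma> = j. erasure_weight V \<gamma> q\<^sub>S)"
proof -
  define F1 where "F1 = {\<gamma> \<in> simple_paths x. length \<gamma> = j}"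
  define F2 where "F2 y = {\<gamma> \<in> simple_paths y. m - 4 * D < length \<gamma>}" for y
  define w where "w \<gamma> = exp (\<theta> * length \<gamma>) * erasure_weight V \<gamma> q\<^sub>S" for \<gamma>
  have w0: "0 \<le> w \<gamma>" for \<gamma> by (simp add: w_def erasure_weight_S_nonneg)
  have fin: "finite F1" "finite (F2 y)" for y
    by (auto simp: F1_def F2_def finite_simple_paths)
  have "tail m x \<le> (\<Sum>(\<gamma>1, y, \<gamma>2)\<in>(SIGMA \<gamma>1:F1. SIGMA y:V. F2 y). w \<gamma>1 * (P (last \<gamma>1) y * w \<gamma>2))"
    unfolding tail_def
  proof (rule sum_le_included[where i = "\<lambda>(\<gamma>1, y, \<gamma>2). \<gamma>1 @ \<gamma>2"])
    show "finite {\<gamma> \<in> simple_paths x. m < length \<gamma>}" by (simp add: finite_simple_paths)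
    show "finite (SIGMA \<gamma>1:F1. SIGMA y:V. F2 y)" using fin finV by auto
    show "\<forall>\<gamma>\<in>{\<gamma> \<in> simple_paths x. m < length \<gamma>}. \<exists>p\<in>(SIGMA \<gamma>1:F1. SIGMA y:V. F2 y).
        (case p of (\<gamma>1, y, \<gamma>2) \<Rightarrow> \<gamma>1 @ \<gamma>2) = \<gamma> \<and>
        exp (\<theta> * length \<gamma>) * erasure_weight V \<gamma> q\<^sub>S \<le> (case p of (\<gamma>1, y, \<gamma>2) \<Rightarrow> w \<gamma>1 * (P (last \<gamma>1) y * w \<gamma>2))"
    proof
      fix \<gamma> assume "\<gamma> \<in> {\<gamma> \<in> simple_paths x. m < length \<gamma>}"
      then have \<gamma>: "\<gamma> \<noteq> []" "hd \<gamma> = x" "set \<gamma> \<subseteq> V" "distinct \<gamma>" "m < length \<gamma>"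
        by (auto simp: simple_paths_def)
      define \<gamma>1 \<gamma>2 where "\<gamma>1 = take j \<gamma>" and "\<gamma>2 = drop j \<gamma>"
      have len: "length \<gamma>1 = j" "length \<gamma>2 = length \<gamma> - j" using \<gamma> j m by (auto simp: \<gamma>1_def \<gamma>2_def)
      have ne: "\<gamma>1 \<noteq> []" "\<gamma>2 \<noteq> []" 
        unfolding length_greater_0_conv[symmetric] len using j m \<gamma>(5) by linarith+
      have app: "\<gamma> = \<gamma>1 @ \<gamma>2" by (simp add: \<gamma>1_def \<gamma>2_def)
      have sub: "set \<gamma>1 \<subseteq> V" "set \<gamma>2 \<subseteq> V"
        using \<gamma>(3) set_take_subset[of j \<gamma>] set_drop_subset[of j \<gamma>]
        unfolding \<gamma>1_def \<gamma>2_def by blast+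
      have dist: "distinct \<gamma>1" "distinct \<gamma>2" using \<gamma>(4) by (simp_all add: \<gamma>1_def \<gamma>2_def)
      have hd1: "hd \<gamma>1 = x" using \<gamma>(2) j(1) by (simp add: \<gamma>1_def)
      have len2: "m - 4 * D < length \<gamma> - j" using \<gamma>(5) j(2) m by linarith
      have 1: "\<gamma>1 \<in> F1" by (simp add: F1_def simple_paths_def sub dist hd1 len ne)
      have 2: "\<gamma>2 \<in> F2 (hd \<gamma>2)" by (simp add: F2_def simple_paths_def sub dist len len2 ne)
      have 3: "hd \<gamma>2 \<in> V" using sub(2) hd_in_set[OF ne(2)] by blast
      have "exp (\<theta> * length \<gamma>) = exp (\<theta> * length \<gamma>1) * exp (\<theta> * length \<gamma>2)"
        by (simp add: app distrib_left exp_add)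
      moreover have "erasure_weight V \<gamma> q\<^sub>S \<le> erasure_weight V \<gamma>1 q\<^sub>S * (P (last \<gamma>1) (hd \<gamma>2) * erasure_weight V \<gamma>2 q\<^sub>S)"
        unfolding app by (rule erasure_weight_append[OF q\<^sub>S(2,3) order.refl ne])
      ultimately have "exp (\<theta> * length \<gamma>) * erasure_weight V \<gamma> q\<^sub>S \<le> exp (\<theta> * length \<gamma>1) * exp (\<theta> * length \<gamma>2) *
          (erasure_weight V \<gamma>1 q\<^sub>S * (P (last \<gamma>1) (hd \<gamma>2) * erasure_weight V \<gamma>2 q\<^sub>S))"
        by (simp add: mult_left_mono)
      then have "exp (\<theta> * length \<gamma>) * erasure_weight V \<gamma> q\<^sub>S \<le> w \<gamma>1 * (P (last \<gamma>1) (hd \<gamma>2) * w \<gamma>2)"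
        by (simp add: w_def mult_ac)
      then show "\<exists>p\<in>(SIGMA \<gamma>1:F1. SIGMA y:V. F2 y). (case p of (\<gamma>1, y, \<gamma>2) \<Rightarrow> \<gamma>1 @ \<gamma>2) = \<gamma> \<and>
        exp (\<theta> * length \<gamma>) * erasure_weight V \<gamma> q\<^sub>S \<le> (case p of (\<gamma>1, y, \<gamma>2) \<Rightarrow> w \<gamma>1 * (P (last \<gamma>1) y * w \<gamma>2))"
        using 1 2 3 app[symmetric] by (intro bexI[of _ "(\<gamma>1, hd \<gamma>2, \<gamma>2)"]) simp_all
    qed
  qed (auto intro!: mult_nonneg_nonneg w0 P_nonneg)
  also have "\<dots> = (\<Sum>\<gamma>1\<in>F1. \<Sum>y\<in>V. \<Sum>\<gamma>2\<in>F2 y. w \<gamma>1 * (P (last \<gamma>1) y * w \<gamma>2))"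
  proof -
    have "(\<Sum>\<gamma>1\<in>F1. \<Sum>y\<in>V. \<Sum>\<gamma>2\<in>F2 y. w \<gamma>1 * (P (last \<gamma>1) y * w \<gamma>2))
      = (\<Sum>\<gamma>1\<in>F1. \<Sum>(y, \<gamma>2)\<in>Sigma V F2. w \<gamma>1 * (P (last \<gamma>1) y * w \<gamma>2))"
      by (rule sum.cong[OF refl], rule sum.Sigma) (use fin finV in auto)
    also have "\<dots> = (\<Sum>(\<gamma>1, y, \<gamma>2)\<in>(SIGMA \<gamma>1:F1. SIGMA y:V. F2 y). w \<gamma>1 * (P (last \<gamma>1) y * w \<gamma>2))"
      by (rule sum.Sigma) (use fin finV in auto)
    finally show ?thesis by (rule sym)
  qed
  also have "\<dots> = (\<Sum>\<gamma>1\<in>F1. w \<gamma>1 * (\<Sum>y\<in>V. P (last \<gamma>1) y * tail (m - 4 * D) y))"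
    by (simp add: tail_def F2_def w_def sum_distrib_left)
  also have "\<dots> \<le> (\<Sum>\<gamma>1\<in>F1. (3 * erasure_weight V \<gamma>1 q\<^sub>S) * (\<Sum>y\<in>V. P (last \<gamma>1) y * B))"
  proof (rule sum_mono, rule mult_mono)
    fix \<gamma>1 assume g1: "\<gamma>1 \<in> F1"
    then show "w \<gamma>1 \<le> 3 * erasure_weight V \<gamma>1 q\<^sub>S" unfolding w_def
      using j by (intro mult_right_mono exp_theta_le erasure_weight_S_nonneg) (auto simp: F1_def)
    show "(\<Sum>y\<in>V. P (last \<gamma>1) y * tail (m - 4 * D) y) \<le> (\<Sum>y\<in>V. P (last \<gamma>1) y * B)"
      by (intro sum_mono mult_left_mono B P_nonneg)
    show "0 \<le> (\<Sum>y\<in>V. P (last \<gamma>1) y * tail (m - 4 * D) y)"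
      unfolding tail_def by (intro sum_nonneg mult_nonneg_nonneg P_nonneg erasure_weight_S_nonneg) auto
  qed (simp add: erasure_weight_S_nonneg)
  also have "\<dots> = (\<Sum>\<gamma>1\<in>F1. (3 * erasure_weight V \<gamma>1 q\<^sub>S) * B)"
  proof (rule sum.cong[OF refl])
    fix \<gamma>1 assume "\<gamma>1 \<in> F1"
    then have "last \<gamma>1 \<in> V" using last_in_set by (fastforce simp: F1_def simple_paths_def)
    then show "(3 * erasure_weight V \<gamma>1 q\<^sub>S) * (\<Sum>y\<in>V. P (last \<gamma>1) y * B) = (3 * erasure_weight V \<gamma>1 q\<^sub>S) * B"
      by (simp add: sum_distrib_right[symmetric] P_sum)
  qed
  also have "\<dots> = 3 * B * (\<Sum>\<gamma>\<in>F1. erasure_weight V \<gamma> q\<^sub>S)" by (simp add: sum_distrib_left mult_ac)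
  finally show ?thesis by (simp add: F1_def)
qed

text \<open>Averaging over the point at which the path is cut avoids fixing one length with small total weight.\<close>

lemma tail_halves:
  assumes x: "x \<in> V" and m: "4 * D \<le> m" and B: "\<And>y. y \<in> V \<Longrightarrow> tail (m - 4 * D) y \<le> B"
  shows "tail m x \<le> B / 2"
proof -
  have "0 \<le> tail (m - 4 * D) x"
    unfolding tail_def by (intro sum_nonneg mult_nonneg_nonneg erasure_weight_S_nonneg) simp
  then have B0: "0 \<le> B" using B[OF x] by linarith
  \<comment> \<open>There are \<open>2 * D\<close> cuts and the window weighs at most
    \<open>D / 3\<close>; dividing \<open>3 * B * (D / 3)\<close> by \<open>2 * D\<close> gives
    \<open>B / 2\<close>.\<close>
  have "real (2 * D) * tail m x = (\<Sum>j\<in>{2 * D<..4 * D}. tail m x)" by simp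
  also have "\<dots> \<le> (\<Sum>j\<in>{2 * D<..4 * D}. 3 * B * (\<Sum>\<gamma> | \<gamma> \<in> simple_paths x \<and> length \<gamma> = j. erasure_weight V \<gamma> q\<^sub>S))"
    by (intro sum_mono tail_le_split x m B) auto
  also have "\<dots> = 3 * B * (\<Sum>j\<in>{2 * D<..4 * D}. \<Sum>\<gamma> | \<gamma> \<in> simple_paths x \<and> length \<gamma> = j. erasure_weight V \<gamma> q\<^sub>S)"
    by (simp add: sum_distrib_left)
  also have "(\<Sum>j\<in>{2 * D<..4 * D}. \<Sum>\<gamma> | \<gamma> \<in> simple_paths x \<and> length \<gamma> = j. erasure_weight V \<gamma> q\<^sub>S)
    = (\<Sum>j\<in>{2 * D<..4 * D}. \<Sum>\<gamma> | \<gamma> \<in> {\<gamma>. \<gamma> \<in> simple_paths x \<and> 2 * D < length \<gamma> \<and> length \<gamma> \<le> 4 * D} \<and> length \<gamma> = j. erasure_weight V \<gamma> q\<^sub>S)"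
    by (intro sum.cong refl) auto
  also have "\<dots> = (\<Sum>\<gamma> | \<gamma> \<in> simple_paths x \<and> 2 * D < length \<gamma> \<and> length \<gamma> \<le> 4 * D. erasure_weight V \<gamma> q\<^sub>S)"
    by (intro sum.group) (auto simp: finite_simple_paths)
  also have "3 * B * \<dots> \<le> 3 * B * (D / 3)"
    using B0 by (intro mult_left_mono sum_erasure_weight_window x) auto
  finally show ?thesis using D_pos by (simp add: field_simps)
qed

lemma tail_le:
  assumes "x \<in> V"
  shows "tail (4 * D * n) x \<le> 6 * S / 2 ^ n"
  using assms
proof (induction n arbitrary: x)
  case 0
  \<comment> \<open>Finiteness of \<open>V\<close> provides some bound \<open>B\<close>, a priori
    without control. \<open>tail_halves\<close> improves it to \<open>B \<le> 3 * S + B / 2\<close>,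
    hence \<open>B \<le> 6 * S\<close>.\<close>
  define B where "B = Max (tail 0 ` V)"
  have ne: "tail 0 ` V \<noteq> {}" "finite (tail 0 ` V)" using 0 finV by auto
  have B: "tail 0 y \<le> B" if "y \<in> V" for y unfolding B_def using that ne by (intro Max_ge) auto
  have "tail 0 y \<le> 3 * S + B / 2" if y: "y \<in> V" for y
  proof -
    have "tail 0 y = (\<Sum>\<gamma> | \<gamma> \<in> simple_paths y \<and> length \<gamma> \<le> 4 * D. exp (\<theta> * length \<gamma>) * erasure_weight V \<gamma> q\<^sub>S) + tail (4 * D) y"
    proof -
      have "{\<gamma> \<in> simple_paths y. 0 < length \<gamma>} = {\<gamma> \<in> simple_paths y. length \<gamma> \<le> 4 * D} \<union> {\<gamma> \<in> simple_paths y. 4 * D < length \<gamma>}"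
        by (auto simp: simple_paths_def)
      then show ?thesis unfolding tail_def
        by (simp add: sum.union_disjoint[symmetric] finite_simple_paths disjoint_iff)
    qed
    also have "tail (4 * D) y \<le> B / 2" by (rule tail_halves[OF y]) (auto intro: B)
    also have "(\<Sum>\<gamma> | \<gamma> \<in> simple_paths y \<and> length \<gamma> \<le> 4 * D. exp (\<theta> * length \<gamma>) * erasure_weight V \<gamma> q\<^sub>S)
      \<le> (\<Sum>\<gamma> | \<gamma> \<in> simple_paths y \<and> length \<gamma> \<le> 4 * D. 3 * erasure_weight V \<gamma> q\<^sub>S)"
      by (intro sum_mono mult_right_mono exp_theta_le erasure_weight_S_nonneg) auto
    also have "\<dots> = 3 * (\<Sum>\<gamma> | \<gamma> \<in> simple_paths y \<and> length \<gamma> \<le> 4 * D. erasure_weight V \<gamma> q\<^sub>S)"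
      by (simp add: sum_distrib_left)
    also have "\<dots> \<le> 3 * (1 / (1 - q\<^sub>S))"
      by (intro mult_left_mono sum_erasure_weight_le[OF q\<^sub>S(2,3) y]) auto
    finally show ?thesis using q\<^sub>S(4) by simp
  qed
  moreover have "B \<in> tail 0 ` V" unfolding B_def using ne by (intro Max_in)
  ultimately have "B \<le> 3 * S + B / 2" by blast
  then show ?case using B[OF 0] by simp
next
  case (Suc n)
  have "tail (4 * D * Suc n) x \<le> (6 * S / 2 ^ n) / 2"
    by (rule tail_halves[OF Suc.prems]) (use Suc.IH in auto)
  then show ?case by (simp add: field_simps)
qed

text \<open>Times below \<open>M\<close> are replaced by killing at rate \<open>1 / (2 * M)\<close>,
  where \<open>q ^ n\<close> is still at least 1/2. \<open>erasure_weight_compare\<close> passes to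
  rate \<open>1 / S\<close> at the price \<open>2 * M / S\<close>, whose denominator cancels the
  \<open>S\<close> in \<open>tail_le\<close>.\<close>

lemma sum_prob_LE_long:
  assumes x: "x \<in> V" and M: "S \<le> real M"
  shows "(\<Sum>n<M. EE n x (\<lambda>l. of_bool (4 * D * j < length (LE l)))) \<le> 72 * real M / 2 ^ j"
proof -
  define F where "F = {\<gamma> \<in> simple_paths x. 4 * D * j < length \<gamma>}"
  define q where "q = 1 - 1 / (2 * real M)"
  have M0: "0 < real M" using M S_pos by linarith
  have M1: "1 \<le> real M" using M S_ge by linarith
  have qS: "q\<^sub>S \<le> q" unfolding q_def q\<^sub>S_def
    using M M0 S_pos by (simp add: frac_le)
  have q: "0 \<le> q" "q < 1" using qS q\<^sub>S M0 by (auto simp: q_def)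
  have eq: "EE n x (\<lambda>l. of_bool (LE l \<in> F)) = EE n x (\<lambda>l. of_bool (4 * D * j < length (LE l)))" for n
    using LE_in_simple_paths by (intro EE_cong[OF x]) (auto simp: F_def)
  have sums: "(\<lambda>n. EE n x (\<lambda>l. of_bool (4 * D * j < length (LE l))) * q ^ n) sums (\<Sum>\<gamma>\<in>F. erasure_weight V \<gamma> q)"
    unfolding eq[symmetric] by (rule sum_erasure_weight_sums[OF q x]) (auto simp: F_def)
  have "(\<Sum>\<gamma>\<in>F. erasure_weight V \<gamma> q) \<le> (\<Sum>\<gamma>\<in>F. 2 * real M / S * 3 * (exp (\<theta> * length \<gamma>) * erasure_weight V \<gamma> q\<^sub>S))"
  proof (rule sum_mono)
    fix \<gamma> assume "\<gamma> \<in> F"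
    then have \<gamma>: "\<gamma> \<noteq> []" "set \<gamma> \<subseteq> V" by (auto simp: F_def simple_paths_def)
    have "(1 - q) * erasure_weight V \<gamma> q \<le> (1 - q\<^sub>S) * erasure_weight V \<gamma> q\<^sub>S * exp (2 * (h * length \<gamma> + h * real g) * (q - q\<^sub>S))"
      by (rule erasure_weight_compare[OF q\<^sub>S(1) qS q(2) \<gamma>]) auto
    also have "exp (2 * (h * length \<gamma> + h * real g) * (q - q\<^sub>S)) \<le> exp (\<theta> * length \<gamma> + 1)"
    proof -
      have "2 * (h * length \<gamma> + h * real g) * (q - q\<^sub>S) \<le> 2 * (h * length \<gamma> + h * real g) * (1 / S)"
        using M0 by (intro mult_left_mono) (auto simp: q_def q\<^sub>S_def)
      also have "\<dots> = \<theta> * length \<gamma> + 2 * h * real g / S" by (simp add: \<theta>_def add_divide_distrib algebra_simps)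
      also have "2 * h * real g / S \<le> 1"
      proof -
        have "2 * h * real g \<le> h * h * (h * \<sigma>)"
          using h_ge g_le' by (intro mult_mono) auto
        also have "\<dots> = h ^ 3 * \<sigma>" by (simp add: power3_eq_cube)
        also have "\<dots> \<le> S" unfolding S_def using h_power_mono[of 3 45] by (intro mult_right_mono) auto
        finally show ?thesis using S_pos by simp
      qed
      finally show ?thesis by simp
    qed
    also have "\<dots> \<le> 3 * exp (\<theta> * length \<gamma>)"
      using exp_le by (simp add: exp_add)
    finally have "(1 - q) * erasure_weight V \<gamma> q \<le> (1 - q\<^sub>S) * erasure_weight V \<gamma> q\<^sub>S * (3 * exp (\<theta> * length \<gamma>))"
      using q\<^sub>S erasure_weight_S_nonneg by (simp add: mult_left_mono)
    then show "erasure_weight V \<gamma> q \<le> 2 * real M / S * 3 * (exp (\<theta> * length \<gamma>) * erasure_weight V \<gamma> q\<^sub>S)"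
      using M0 S_pos by (simp add: q_def q\<^sub>S_def field_simps)
  qed
  also have "\<dots> = 6 * real M / S * tail (4 * D * j) x"
    by (simp add: tail_def F_def sum_distrib_left)
  also have "\<dots> \<le> 6 * real M / S * (6 * S / 2 ^ j)"
    using M0 S_pos by (intro mult_left_mono tail_le x) auto
  also have "\<dots> = 36 * real M / 2 ^ j" using S_pos by simp
  finally have 1: "(\<Sum>\<gamma>\<in>F. erasure_weight V \<gamma> q) \<le> 36 * real M / 2 ^ j" .
  have half: "1 / 2 \<le> q ^ n" if "n < M" for n
  proof -
    have "1 / 2 \<le> 1 + real M * (- (1 / (2 * real M)))" using M0 by simp
    also have "\<dots> \<le> (1 + - (1 / (2 * real M))) ^ M"
      using M1 by (intro Bernoulli_inequality) simp
    also have "\<dots> = q ^ M" by (simp add: q_def)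
    also have "\<dots> \<le> q ^ n" using q that by (intro power_decreasing) auto
    finally show ?thesis .
  qed
  have "(\<Sum>n<M. EE n x (\<lambda>l. of_bool (4 * D * j < length (LE l)))) * (1 / 2) \<le>
    (\<Sum>n<M. EE n x (\<lambda>l. of_bool (4 * D * j < length (LE l))) * q ^ n)"
    unfolding sum_distrib_right using half by (intro sum_mono mult_left_mono EE_nonneg x) auto
  also have "\<dots> \<le> (\<Sum>n. EE n x (\<lambda>l. of_bool (4 * D * j < length (LE l))) * q ^ n)"
    using q by (intro sum_le_suminf sums_summable[OF sums]) (auto intro!: mult_nonneg_nonneg EE_nonneg x)
  also have "\<dots> = (\<Sum>\<gamma>\<in>F. erasure_weight V \<gamma> q)" using sums_unique[OF sums] by simp
  finally show ?thesis using 1 by simp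
qed

end

section \<open>The walk stopped at a point\<close>

context lerw_chain
begin

text \<open>At time \<open>n - g\<close> the loop erasure is at most \<open>g\<close> vertices
  shorter than at time \<open>n\<close>, and from there, whatever the past, the walk is at
  \<open>e\<close> after \<open>g\<close> steps with probability at most
  \<open>h / v\<close>.\<close>

lemma EE_hit_long:
  assumes b: "b \<in> V" and e: "e \<in> V" and n: "g \<le> n" "n \<le> N"
  shows "EE N b (\<lambda>l. of_bool (l ! n = e \<and> \<kappa> < real (length (LE (take (Suc n) l)))))
    \<le> h / v * EE (n - g) b (\<lambda>l. of_bool (\<kappa> - real g < real (length (LE l))))"
proof -
  define m where "m = n - g"
  let ?f = "\<lambda>l. of_bool (l ! n = e \<and> \<kappa> < real (length (LE (take (Suc n) l)))) :: real"
  have "EE (m + (N - m)) b ?f = EE m b (\<lambda>l. EE (N - m) (last l) (\<lambda>r. ?f (butlast l @ r)))"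
    by (rule EE_markov)
  also have "\<dots> \<le> EE m b (\<lambda>l. h / v * of_bool (\<kappa> - real g < real (length (LE l))))"
  proof (rule EE_mono[OF b])
    fix l :: "'a list" assume l: "length l = Suc m" "set l \<subseteq> V"
    then have ll: "last l \<in> V" by (cases l rule: rev_cases) auto
    let ?c = "of_bool (\<kappa> - real g < real (length (LE l))) :: real"
    have "EE (N - m) (last l) (\<lambda>r. ?f (butlast l @ r)) \<le> EE (N - m) (last l) (\<lambda>r. ?c * of_bool (r ! g = e))"
    proof (rule EE_mono[OF ll])
      fix r :: "'a list" assume r: "length r = Suc (N - m)" "hd r = last l"
      then obtain r' where r': "r = last l # r'" by (cases r) auto
      have bl: "butlast l @ r = l @ r'" unfolding r' using l by (cases l rule: rev_cases) auto
      have nth: "(butlast l @ r) ! n = r ! g"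
        using l n by (auto simp: nth_append m_def)
      have tk: "take (Suc n) (butlast l @ r) = l @ take g r'"
        unfolding bl using l n by (simp add: m_def)
      have "length (LE (l @ take g r')) \<le> length (LE l) + length (take g r')" by (rule length_LE_append)
      also have "\<dots> \<le> length (LE l) + g" by simp
      finally have "real (length (LE (l @ take g r'))) \<le> real (length (LE l)) + real g"
        by (metis of_nat_add of_nat_le_iff)
      then show "?f (butlast l @ r) \<le> ?c * of_bool (r ! g = e)"
        unfolding nth tk by auto
    qed
    also have "\<dots> = ?c * EE (N - m) (last l) (\<lambda>r. of_bool (r ! g = e))"
      by (rule EE_cmult)
    also have "EE (N - m) (last l) (\<lambda>r. of_bool (r ! g = e)) = (\<Sum>y\<in>V. pk V g (last l) y * of_bool (y = e))"
      using n by (intro EE_nth ll) (simp add: m_def)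
    also have "\<dots> = (\<Sum>y\<in>V. if y = e then pk V g (last l) e else 0)"
      by (intro sum.cong) auto
    also have "\<dots> = pk V g (last l) e" using e finV by simp
    also have "?c * pk V g (last l) e \<le> ?c * (h / v)"
      by (intro mult_left_mono upper ll e order.refl) simp
    finally show "EE (N - m) (last l) (\<lambda>r. ?f (butlast l @ r)) \<le> h / v * ?c" by (simp add: mult.commute)
  qed
  also have "\<dots> = h / v * EE m b (\<lambda>l. of_bool (\<kappa> - real g < real (length (LE l))))"
    by (rule EE_cmult)
  finally show ?thesis using n by (simp add: m_def)
qed

text \<open>A single point has energy at most \<open>h\<close>, and
  \<open>v \<le> \<sigma>\<^sup>2\<close>, so \<open>2 * H * s\<^sup>2\<close> counted times per
  window satisfy the energy condition of \<open>avoid_windows\<close>.\<close>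

lemma EE_avoid_point:
  assumes b: "b \<in> V" and e: "e \<in> V"
  shows "EE (J * (g + 2 * (H * s\<^sup>2))) b (\<lambda>l. of_bool (e \<notin> set l)) \<le> (1 - hit_prob) ^ J"
proof -
  have "EE (J * (g + 2 * (H * s\<^sup>2))) b (\<lambda>l. of_bool (e \<notin> set l))
    \<le> EE (J * (g + 2 * (H * s\<^sup>2))) b (\<lambda>l. of_bool (set (tl l) \<inter> {e} = {}))"
  proof (rule EE_mono[OF b])
    fix l :: "'a list"
    show "of_bool (e \<notin> set l) \<le> (of_bool (set (tl l) \<inter> {e} = {}) :: real)"
      by (cases l) auto
  qed
  also have "\<dots> \<le> (1 - hit_prob) ^ J"
  proof (rule avoid_windows[OF _ _ _ b _ order.refl])
    show "1 \<le> H * s\<^sup>2" using H_ge s_pos by simp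
    have "green_energy {e} = (\<Sum>u<g. pk V u e e)" by (simp add: green_energy_def)
    also have "\<dots> \<le> (\<Sum>u<g. real (Suc u) * pk V u e e)"
      using pk_nonneg[of V _ e e] by (intro sum_mono) (simp add: mult_left_le_one_le algebra_simps)
    also have "\<dots> \<le> h" by (rule short[OF e])
    finally have "green_energy {e} * v \<le> h * \<sigma>\<^sup>2"
      using v_le v_pos h_pos by (intro mult_mono) auto
    also have "\<dots> \<le> 2 * (h * \<sigma>\<^sup>2)" by simp
    finally show "green_energy {e} * v \<le> real (2 * (H * s\<^sup>2)) * (real (card {e}))\<^sup>2" by simp
  qed (use e in auto)
  finally show ?thesis .
qed

text \<open>\<open>h ^ 46\<close> is at most \<open>fact 46 * exp h\<close>, and
  \<open>t * h\<^sup>2 / 2\<close> exceeds \<open>2 * t + h\<close>. The resulting constant is free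
  of \<open>h\<close>, which matters in dimension 4, where \<open>h\<close> grows with the
  torus.\<close>

lemma tail_constant:
  assumes t: "1 \<le> t"
  shows "576 * (t * h ^ 46) / exp (t * h\<^sup>2 / 2) \<le> 576 * fact 46 * exp (- t)"
proof -
  have "t \<le> exp t" using exp_ge_add_one_self[of t] by linarith
  then have "t * h ^ 46 \<le> exp t * (fact 46 * exp h)"
    using t h_pos by (intro mult_mono power_le_fact_exp) auto
  moreover have "exp t * exp h / exp (t * h\<^sup>2 / 2) \<le> exp (- t)"
  proof -
    have "2 * t + h \<le> t * h\<^sup>2 / 2"
    proof -
      have "h * 1 \<le> h * t" using t h_pos by (intro mult_left_mono) auto
      moreover have "t * (4 + 2 * h) \<le> t * h\<^sup>2"
      proof (intro mult_left_mono)
        have "4 + 2 * h \<le> 1000 * h" using h_ge by simp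
        also have "\<dots> \<le> h * h" using h_ge by (intro mult_right_mono) auto
        finally show "4 + 2 * h \<le> h\<^sup>2" by (simp add: power2_eq_square)
      qed (use t in simp)
      ultimately show ?thesis by (simp add: algebra_simps)
    qed
    then have "exp (t + h - t * h\<^sup>2 / 2) \<le> exp (- t)" by simp
    then show ?thesis by (simp add: exp_diff exp_add)
  qed
  ultimately have "t * h ^ 46 / exp (t * h\<^sup>2 / 2) \<le> exp t * (fact 46 * exp h) / exp (t * h\<^sup>2 / 2)"
    by (intro divide_right_mono) auto
  also have "\<dots> = fact 46 * (exp t * exp h / exp (t * h\<^sup>2 / 2))" by simp
  also have "\<dots> \<le> fact 46 * exp (- t)"
    by (rule mult_left_mono) (fact, simp)
  finally show ?thesis by simp
qed

theorem hitting_loop_erasure_tail: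
  assumes b: "b \<in> V" and e: "e \<in> V" and t: "1 \<le> t"
  shows "\<exists>N. EE N b (\<lambda>l. of_bool (e \<notin> set l \<or>
      (\<exists>n\<le>N. l ! n = e \<and> t * h ^ 47 * \<sigma> < real (length (LE (take (Suc n) l))))))
    \<le> (1 + 576 * fact 46) * exp (- t)"
proof -
  \<comment> \<open>Chosen so that \<open>hit_prob * real J\<close> is at least
    \<open>t\<close>.\<close>
  define J where "J = nat \<lceil>16 * h\<^sup>2 * t\<rceil>"
  define N where "N = J * (g + 2 * (H * s\<^sup>2))"
  define \<kappa> where "\<kappa> = t * h ^ 47 * \<sigma>"
  \<comment> \<open>\<open>M\<close> exceeds the horizon \<open>N\<close> and is at least
    \<open>S\<close>, as \<open>sum_prob_LE_long\<close> requires. Being at most of order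
    \<open>t * h ^ 45 * v\<close>, it cancels the factor \<open>1 / v\<close> of
    \<open>EE_hit_long\<close> up to powers of \<open>h\<close>.\<close>
  define M where "M = nat \<lceil>t\<rceil> * H ^ 45 * s\<^sup>2"
  \<comment> \<open>The extra \<open>h\<^sup>2\<close> makes \<open>2 ^ j\<close> large enough to
    absorb all powers of \<open>h\<close> in \<open>tail_constant\<close>.\<close>
  define j where "j = nat \<lceil>t * h\<^sup>2\<rceil>"
  have hh: "1 \<le> h\<^sup>2" using h_ge by (simp add: one_le_power)
  have J_ge: "16 * h\<^sup>2 * t \<le> real J" and J_le: "real J \<le> 17 * h\<^sup>2 * t"
  proof -
    have "1 \<le> h\<^sup>2 * t" using mult_mono[OF hh t] by simp
    then show "16 * h\<^sup>2 * t \<le> real J" "real J \<le> 17 * h\<^sup>2 * t"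
      using real_nat_ceiling_ge[of "16 * h\<^sup>2 * t"] of_nat_ceiling[of "16 * h\<^sup>2 * t"] unfolding J_def by linarith+
  qed
  have M_le: "real M \<le> 2 * t * h ^ 45 * \<sigma>\<^sup>2" and M_ge: "t * h ^ 45 * \<sigma>\<^sup>2 \<le> real M"
  proof -
    have "t \<le> real (nat \<lceil>t\<rceil>)" "real (nat \<lceil>t\<rceil>) \<le> 2 * t" using t by linarith+
    then show "real M \<le> 2 * t * h ^ 45 * \<sigma>\<^sup>2" "t * h ^ 45 * \<sigma>\<^sup>2 \<le> real M"
      using h_pos \<sigma>_pos by (auto simp: M_def intro!: mult_right_mono)
  qed
  have \<sigma>2: "\<sigma> \<le> \<sigma>\<^sup>2" using \<sigma>_ge by (simp add: power2_eq_square)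
  have SM: "S \<le> real M"
  proof -
    have "S \<le> t * h ^ 45 * \<sigma>\<^sup>2" unfolding S_def
      using t h_pos \<sigma>2 by (intro mult_mono) auto
    then show ?thesis using M_ge by linarith
  qed
  have NM: "N < M"
  proof -
    have "real N = real J * (real g + 2 * (h * \<sigma>\<^sup>2))" by (simp add: N_def)
    also have "\<dots> \<le> (17 * h\<^sup>2 * t) * (h * \<sigma>\<^sup>2 + 2 * (h * \<sigma>\<^sup>2))"
    proof (intro mult_mono J_le add_right_mono)
      show "real g \<le> h * \<sigma>\<^sup>2" using g_le' mult_left_mono[OF \<sigma>2, of h] h_pos by linarith
    qed (use t h_pos in auto)
    also have "\<dots> = 51 * (t * h ^ 3 * \<sigma>\<^sup>2)" by (simp add: power2_eq_square power3_eq_cube)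
    also have "\<dots> < h * (t * h ^ 3 * \<sigma>\<^sup>2)" using h_ge t h_pos \<sigma>_pos by (intro mult_strict_right_mono) auto
    also have "\<dots> = t * h ^ 4 * \<sigma>\<^sup>2" by (simp add: power_add[of h 1 3, simplified])
    also have "\<dots> \<le> t * h ^ 45 * \<sigma>\<^sup>2" using t by (intro mult_right_mono mult_left_mono h_power_mono) auto
    also have "\<dots> \<le> real M" by (rule M_ge)
    finally show ?thesis by simp
  qed
  have \<kappa>j: "real (4 * D * j) \<le> \<kappa> - real g" and g\<kappa>: "real g \<le> \<kappa>"
  proof -
    have "real j \<le> t * h\<^sup>2 + 1" using t by (simp add: j_def)
    also have "\<dots> \<le> 2 * (t * h\<^sup>2)" using mult_mono[OF t hh] t by simp
    finally have j2: "real j \<le> 2 * (t * h\<^sup>2)" .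
    have "real (4 * D * j) = 4 * (h ^ 43 * \<sigma>) * real j" by (simp add: D_real)
    also have "\<dots> \<le> 4 * (h ^ 43 * \<sigma>) * (2 * (t * h\<^sup>2))"
      by (rule mult_left_mono[OF j2]) simp
    also have "\<dots> = 8 * (t * h ^ 45 * \<sigma>)" by (simp add: mult_ac flip: power_add)
    finally have 1: "real (4 * D * j) \<le> 8 * (t * h ^ 45 * \<sigma>)" .
    have "real g \<le> 1 * h ^ 1 * \<sigma>" using g_le' by simp
    also have "\<dots> \<le> t * h ^ 45 * \<sigma>"
      using t h_pos h_ge \<sigma>_pos by (intro mult_right_mono mult_mono h_power_mono) auto
    finally have 2: "real g \<le> t * h ^ 45 * \<sigma>" .
    have "9 * (t * h ^ 45 * \<sigma>) \<le> h\<^sup>2 * (t * h ^ 45 * \<sigma>)"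
    proof (intro mult_right_mono)
      have "9 * 1 \<le> h * h" using h_ge by (intro mult_mono) auto
      then show "9 \<le> h\<^sup>2" by (simp add: power2_eq_square)
    qed (use t h_pos \<sigma>_pos in auto)
    also have "\<dots> = \<kappa>" by (simp add: \<kappa>_def power_add[of h 2 45, simplified])
    finally have 3: "9 * (t * h ^ 45 * \<sigma>) \<le> \<kappa>" .
    show "real (4 * D * j) \<le> \<kappa> - real g" using 1 2 3 by linarith
    have "0 \<le> t * h ^ 45 * \<sigma>" using t h_pos \<sigma>_pos by simp
    then show "real g \<le> \<kappa>" using 2 3 by linarith
  qed
  let ?f = "\<lambda>n l. of_bool (l ! n = e \<and> \<kappa> < real (length (LE (take (Suc n) l)))) :: real"
  have "EE N b (\<lambda>l. of_bool (e \<notin> set l \<or> (\<exists>n\<le>N. l ! n = e \<and> \<kappa> < real (length (LE (take (Suc n) l))))))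
    \<le> EE N b (\<lambda>l. of_bool (e \<notin> set l) + (\<Sum>n | n \<le> N \<and> g \<le> n. ?f n l))"
  proof (rule EE_mono[OF b])
    fix l :: "'a list"
    have nn: "0 \<le> (\<Sum>n | n \<le> N \<and> g \<le> n. ?f n l)" by (intro sum_nonneg) simp
    show "of_bool (e \<notin> set l \<or> (\<exists>n\<le>N. l ! n = e \<and> \<kappa> < real (length (LE (take (Suc n) l)))))
      \<le> of_bool (e \<notin> set l) + (\<Sum>n | n \<le> N \<and> g \<le> n. ?f n l)"
    proof (cases "\<exists>n\<le>N. l ! n = e \<and> \<kappa> < real (length (LE (take (Suc n) l)))")
      case True
      then obtain n where n: "n \<le> N" "l ! n = e" "\<kappa> < real (length (LE (take (Suc n) l)))" by blast
      \<comment> \<open>A loop erasure has at most as many vertices as the path, so before time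
        \<open>g\<close> it cannot exceed \<open>\<kappa>\<close>. Only times with a full mixing
        time behind them remain.\<close>
      have "length (LE (take (Suc n) l)) \<le> Suc n"
        using length_LE[of "take (Suc n) l"] by simp
      then have "real (length (LE (take (Suc n) l))) \<le> real (Suc n)" by (rule of_nat_mono)
      then have "real g < real (Suc n)" using n(3) g\<kappa> by linarith
      then have "g \<le> n" by simp
      then have "?f n l \<le> (\<Sum>n | n \<le> N \<and> g \<le> n. ?f n l)"
        using n by (intro member_le_sum[of n _ "\<lambda>n. ?f n l"]) auto
      then have "1 \<le> (\<Sum>n | n \<le> N \<and> g \<le> n. ?f n l)" using n by simp
      then show ?thesis by (simp add: True add_increasing)
    qed (use nn in auto)
  qed
  also have "\<dots> = EE N b (\<lambda>l. of_bool (e \<notin> set l)) + (\<Sum>n | n \<le> N \<and> g \<le> n. EE N b (?f n))"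
    unfolding EE_add EE_sum ..
  also have "\<dots> \<le> exp (- t) + 576 * fact 46 * exp (- t)"
  proof (rule add_mono)
    have "EE N b (\<lambda>l. of_bool (e \<notin> set l)) \<le> (1 - hit_prob) ^ J"
      unfolding N_def by (rule EE_avoid_point[OF b e])
    also have "\<dots> \<le> exp (- (hit_prob * real J))"
      using hit_prob by (intro power_le_exp_neg) auto
    also have "\<dots> \<le> exp (- t)"
      using J_ge h_pos by (simp add: hit_prob_def field_simps)
    finally show "EE N b (\<lambda>l. of_bool (e \<notin> set l)) \<le> exp (- t)" .
    have "(\<Sum>n | n \<le> N \<and> g \<le> n. EE N b (?f n)) \<le>
      (\<Sum>n | n \<le> N \<and> g \<le> n. h / v * EE (n - g) b (\<lambda>l. of_bool (4 * D * j < length (LE l))))"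
    proof (rule sum_mono)
      fix n assume n: "n \<in> {n. n \<le> N \<and> g \<le> n}"
      then have "EE N b (?f n) \<le> h / v * EE (n - g) b (\<lambda>l. of_bool (\<kappa> - real g < real (length (LE l))))"
        by (intro EE_hit_long b e) auto
      also have "\<dots> \<le> h / v * EE (n - g) b (\<lambda>l. of_bool (4 * D * j < length (LE l)))"
      proof (intro mult_left_mono EE_mono b)
        fix l :: "'a list"
        have "4 * D * j < length (LE l)" if "\<kappa> - real g < real (length (LE l))"
        proof -
          have "real (4 * D * j) < real (length (LE l))" using that \<kappa>j by linarith
          then show ?thesis by (simp only: of_nat_less_iff)
        qed
        then show "of_bool (\<kappa> - real g < real (length (LE l))) \<le> (of_bool (4 * D * j < length (LE l)) :: real)"
          by simp
      qed (use h_pos v_pos in simp)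
      finally show "EE N b (?f n) \<le> h / v * EE (n - g) b (\<lambda>l. of_bool (4 * D * j < length (LE l)))" .
    qed
    also have "\<dots> = (\<Sum>m\<in>(\<lambda>n. n - g) ` {n. n \<le> N \<and> g \<le> n}. h / v * EE m b (\<lambda>l. of_bool (4 * D * j < length (LE l))))"
      by (subst sum.reindex) (auto simp: inj_on_def)
    also have "\<dots> \<le> (\<Sum>m<M. h / v * EE m b (\<lambda>l. of_bool (4 * D * j < length (LE l))))"
    proof (rule sum_mono2)
      show "0 \<le> h / v * EE m b (\<lambda>l. of_bool (4 * D * j < length (LE l)))" for m
        using h_pos v_pos by (intro mult_nonneg_nonneg EE_nonneg b) auto
    qed (use NM in auto)
    also have "\<dots> = h / v * (\<Sum>m<M. EE m b (\<lambda>l. of_bool (4 * D * j < length (LE l))))"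
      by (simp add: sum_distrib_left)
    also have "\<dots> \<le> h / v * (72 * real M / 2 ^ j)"
      using h_pos v_pos by (intro mult_left_mono sum_prob_LE_long b SM) auto
    also have "\<dots> \<le> (4 * h / \<sigma>\<^sup>2) * (72 * (2 * t * h ^ 45 * \<sigma>\<^sup>2) / exp (t * h\<^sup>2 / 2))"
    proof (rule mult_mono)
      have "h / v \<le> h / (\<sigma>\<^sup>2 / 4)"
        using v_ge h_pos \<sigma>_pos v_pos by (intro divide_left_mono) auto
      then show "h / v \<le> 4 * h / \<sigma>\<^sup>2" by (simp add: field_simps)
      have "exp (t * h\<^sup>2 / 2) \<le> exp (ln 2 * real j)"
      proof -
        have "t * h\<^sup>2 \<le> real j" unfolding j_def by (rule real_nat_ceiling_ge)
        moreover have "1 / 2 \<le> ln (2::real)" using ln2_ge_two_thirds by linarith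
        ultimately have "(1 / 2) * (t * h\<^sup>2) \<le> ln 2 * real j" using t by (intro mult_mono) auto
        then show ?thesis by simp
      qed
      also have "\<dots> = 2 ^ j" by (simp add: mult.commute[of "ln 2"] exp_of_nat_mult)
      finally show "72 * real M / 2 ^ j \<le> 72 * (2 * t * h ^ 45 * \<sigma>\<^sup>2) / exp (t * h\<^sup>2 / 2)"
        using M_le by (intro frac_le mult_left_mono) auto
    qed (use h_pos \<sigma>_pos in auto)
    also have "\<dots> = 576 * (t * h ^ 46) / exp (t * h\<^sup>2 / 2)"
      using \<sigma>_pos by (simp add: power_add[of h 1 45, simplified])
    also have "\<dots> \<le> 576 * fact 46 * exp (- t)" by (rule tail_constant[OF t])
    finally show "(\<Sum>n | n \<le> N \<and> g \<le> n. EE N b (?f n)) \<le> 576 * fact 46 * exp (- t)" .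
  qed
  also have "\<dots> = (1 + 576 * fact 46) * exp (- t)" by (simp only: distrib_right mult_1)
  finally show ?thesis unfolding \<kappa>_def by blast
qed

end

section \<open>The walk on the torus and its Fourier expansion\<close>

definition walk_step :: "nat \<Rightarrow> (nat \<Rightarrow> int) \<Rightarrow> nat \<times> int \<Rightarrow> nat \<Rightarrow> int" where
  "walk_step N x s = torus_proj N (\<lambda>i. x i + step_vec s i)"

text \<open>Steps are summed, not neighbours: for \<open>N \<le> 2\<close> different steps lead to
  the same point and have to be counted separately.\<close>

definition torus_kernel :: "nat \<Rightarrow> nat \<Rightarrow> (nat \<Rightarrow> int) \<Rightarrow> (nat \<Rightarrow> int) \<Rightarrow> real" where
  "torus_kernel d N x y = (\<Sum>s\<in>srw_steps d. of_bool (walk_step N x s = y)) / (2 * real d)"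

lemma finite_srw_steps [simp]: "finite (srw_steps d)"
  and card_srw_steps [simp]: "card (srw_steps d) = 2 * d"
  by (simp_all add: srw_steps_def)

lemma walk_step_in_torus:
  assumes "N > 0" "x \<in> torus d N" "s \<in> srw_steps d"
  shows "walk_step N x s \<in> torus d N"
  using assms by (auto simp: walk_step_def torus_def torus_proj_def step_vec_def srw_steps_def)

lemma bij_betw_torus:
  "bij_betw (\<lambda>f i. if i < d then f i else 0) (PiE {..<d} (\<lambda>_. {0..<int N})) (torus d N)"
proof (rule bij_betwI[where g = "\<lambda>x. restrict x {..<d}"])
  show "(\<lambda>f i. if i < d then f i else 0) \<in> (PiE {..<d} (\<lambda>_. {0..<int N})) \<rightarrow> torus d N"
    by (auto simp: torus_def PiE_iff)
  show "(\<lambda>x. restrict x {..<d}) \<in> torus d N \<rightarrow> PiE {..<d} (\<lambda>_. {0..<int N})"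
    by (auto simp: torus_def)
qed (auto simp: torus_def PiE_iff extensional_def fun_eq_iff)

lemma finite_torus: "finite (torus d N)"
  using bij_betw_finite[OF bij_betw_torus[of d N]] by (simp add: finite_PiE)

lemma card_torus: "card (torus d N) = N ^ d"
  using bij_betw_same_card[OF bij_betw_torus[of d N]] by (simp add: card_PiE)

lemma torus_kernel_sum:
  assumes "N > 0" "x \<in> torus d N"
  shows "(\<Sum>z\<in>torus d N. torus_kernel d N x z * F z) = (\<Sum>s\<in>srw_steps d. F (walk_step N x s)) / (2 * real d)"
proof -
  have "(\<Sum>z\<in>torus d N. torus_kernel d N x z * F z)
    = (\<Sum>z\<in>torus d N. \<Sum>s\<in>srw_steps d. of_bool (walk_step N x s = z) * F z) / (2 * real d)"
    by (simp add: torus_kernel_def sum_distrib_right sum_divide_distrib)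
  also have "(\<Sum>z\<in>torus d N. \<Sum>s\<in>srw_steps d. of_bool (walk_step N x s = z) * F z)
    = (\<Sum>s\<in>srw_steps d. \<Sum>z\<in>torus d N. of_bool (walk_step N x s = z) * F z)"
    by (rule sum.swap)
  also have "\<dots> = (\<Sum>s\<in>srw_steps d. F (walk_step N x s))"
  proof (rule sum.cong[OF refl])
    fix s assume "s \<in> srw_steps d"
    then have "walk_step N x s \<in> torus d N" using assms walk_step_in_torus by blast
    moreover have "(\<Sum>z\<in>torus d N. of_bool (walk_step N x s = z) * F z)
      = (\<Sum>z\<in>torus d N. if walk_step N x s = z then F z else 0)"
      by (intro sum.cong) auto
    ultimately show "(\<Sum>z\<in>torus d N. of_bool (walk_step N x s = z) * F z) = F (walk_step N x s)"
      using finite_torus by simp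
  qed
  finally show ?thesis .
qed

lemma walk_step_reverse:
  assumes "x \<in> torus d N" "y \<in> torus d N" "(i, s) \<in> srw_steps d"
  shows "walk_step N x (i, s) = y \<longleftrightarrow> walk_step N y (i, - s) = x"
proof -
  have "walk_step N y (i, - s) = x" if "x \<in> torus d N" "walk_step N x (i, s) = y" "y \<in> torus d N" for x y s
  proof
    fix j
    have y: "y j = (x j + step_vec (i, s) j) mod int N"
      using that(2) by (auto simp: walk_step_def torus_proj_def)
    have sv: "step_vec (i, - s) j = - step_vec (i, s) j" by (simp add: step_vec_def)
    have "walk_step N y (i, - s) j = (x j + step_vec (i, s) j - step_vec (i, s) j) mod int N"
      unfolding walk_step_def torus_proj_def sv y by (simp add: mod_diff_left_eq)
    also have "\<dots> = x j" using that(1) by (cases "j < d") (auto simp: torus_def)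
    finally show "walk_step N y (i, - s) j = x j" .
  qed
  from this[of x s y] this[of y "- s" x] show ?thesis using assms by auto
qed

lemma finite_chain_torus:
  assumes "N > 0" "d > 0"
  shows "finite_chain (torus d N) (torus_kernel d N)"
proof
  show "finite (torus d N)" by (rule finite_torus)
  show "0 \<le> torus_kernel d N x y" for x y
    by (simp add: torus_kernel_def sum_nonneg)
  show "(\<Sum>y\<in>torus d N. torus_kernel d N x y) = 1" if "x \<in> torus d N" for x
    using torus_kernel_sum[OF assms(1) that, of "\<lambda>_. 1"] assms by simp
  show "torus_kernel d N x y = torus_kernel d N y x" if "x \<in> torus d N" "y \<in> torus d N" for x y
  proof -
    have "(\<Sum>s\<in>srw_steps d. of_bool (walk_step N x s = y)) = (\<Sum>s\<in>srw_steps d. of_bool (walk_step N y s = x) :: real)"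
    proof (rule sum.reindex_bij_witness[of _ "\<lambda>(i, s). (i, - s)" "\<lambda>(i, s). (i, - s)"])
      fix p assume p: "p \<in> srw_steps d"
      obtain i s where ps: "p = (i, s)" by (cases p)
      show "of_bool (walk_step N y (case p of (i, s) \<Rightarrow> (i, - s)) = x) = (of_bool (walk_step N x p = y) :: real)"
        using walk_step_reverse[OF that, of i s] p by (simp add: ps)
    qed (auto simp: srw_steps_def)
    then show ?thesis by (simp add: torus_kernel_def)
  qed
qed

section \<open>Fourier expansion of the kernel\<close>

definition freqs :: "nat \<Rightarrow> nat \<Rightarrow> (nat \<Rightarrow> nat) set" where
  "freqs d N = PiE {..<d} (\<lambda>_. {..<N})"

definition phi :: "nat \<Rightarrow> nat \<Rightarrow> (nat \<Rightarrow> nat) \<Rightarrow> real" where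
  "phi d N \<xi> = (\<Sum>i<d. cos (2 * pi * real (\<xi> i) / real N)) / real d"

definition phase :: "nat \<Rightarrow> nat \<Rightarrow> (nat \<Rightarrow> nat) \<Rightarrow> (nat \<Rightarrow> int) \<Rightarrow> real" where
  "phase d N \<xi> z = (\<Sum>i<d. 2 * pi * real (\<xi> i) * real_of_int (z i) / real N)"

lemma sum_cis_roots:
  assumes N: "N > 0" and z: "\<bar>z\<bar> < int N"
  shows "(\<Sum>a<N. cis (2 * pi * real a * real_of_int z / real N)) = (if z = 0 then of_nat N else 0)"
proof (cases "z = 0")
  case False
  let ?w = "cis (2 * pi * real_of_int z / real N)"
  have pw: "cis (2 * pi * real a * real_of_int z / real N) = ?w ^ a" for a
    by (subst Complex.DeMoivre, rule arg_cong[where f = cis]) (simp add: field_simps)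
  have "?w \<noteq> 1"
  proof
    assume "?w = 1"
    then have "cos (2 * pi * real_of_int z / real N) = 1" by (simp add: complex_eq_iff)
    then obtain k :: int where "2 * pi * real_of_int z / real N = real_of_int k * 2 * pi"
      using cos_one_2pi_int by auto
    then have "real_of_int z = real_of_int (k * int N)" using N by (simp add: field_simps)
    then have "z = k * int N" by (simp only: of_int_eq_iff)
    then show False using z False by (auto simp: abs_mult)
  qed
  moreover have "?w ^ N = 1"
  proof -
    have "?w ^ N = cis (2 * pi * real_of_int z)" using N by (simp add: Complex.DeMoivre)
    then show ?thesis using cis_multiple_2pi[of "real_of_int z"] by simp
  qed
  ultimately show ?thesis using False geometric_sum[of ?w N] unfolding pw by simp
qed simp

lemma fourier_orthogonality:
  assumes N: "N > 0" and x: "x \<in> torus d N" and y: "y \<in> torus d N"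
  shows "(\<Sum>\<xi>\<in>freqs d N. cos (phase d N \<xi> (\<lambda>i. x i - y i))) = real N ^ d * of_bool (x = y)"
proof -
  let ?z = "\<lambda>i. x i - y i"
  have cis_sum: "cis (\<Sum>i<k. f i) = (\<Prod>i<k. cis (f i))" for k and f :: "nat \<Rightarrow> real"
    by (induction k) (simp_all flip: cis_mult)
  have z: "\<bar>?z i\<bar> < int N" if "i < d" for i
    using x y that by (auto simp: torus_def) (smt (verit))
  have "(\<Sum>\<xi>\<in>freqs d N. cis (phase d N \<xi> ?z))
     = (\<Sum>\<xi>\<in>freqs d N. \<Prod>i<d. cis (2 * pi * real (\<xi> i) * real_of_int (?z i) / real N))"
    unfolding phase_def cis_sum ..
  also have "\<dots> = (\<Prod>i<d. \<Sum>a<N. cis (2 * pi * real a * real_of_int (?z i) / real N))"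
    unfolding freqs_def by (subst prod_sum_PiE) auto
  also have "\<dots> = (\<Prod>i<d. if ?z i = 0 then of_nat N else 0)"
    using sum_cis_roots[OF N z] by (intro prod.cong) auto
  also have "\<dots> = of_real (real N ^ d * of_bool (x = y))"
  proof (cases "x = y")
    case False
    then obtain i where "x i \<noteq> y i" by (auto simp: fun_eq_iff)
    then have i: "i < d" "?z i \<noteq> 0" using x y by (auto simp: torus_def) (metis not_le)
    then have "(\<Prod>i<d. if ?z i = 0 then of_nat N else 0) = (0 :: complex)"
      by (intro prod_zero) auto
    then show ?thesis using False by simp
  qed simp
  finally have "Re (\<Sum>\<xi>\<in>freqs d N. cis (phase d N \<xi> ?z)) = real N ^ d * of_bool (x = y)"
    by (metis Re_complex_of_real)
  then show ?thesis by simp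
qed

lemma cos_phase_step:
  assumes N: "N > 0" and i: "i < d"
  shows "cos (phase d N \<xi> (\<lambda>j. walk_step N x (i, s) j - y j))
    = cos (phase d N \<xi> (\<lambda>j. x j - y j) + 2 * pi * real (\<xi> i) * real_of_int s / real N)"
proof -
  \<comment> \<open>Wrapping around shifts coordinate \<open>j\<close> by a multiple of
    \<open>N\<close>; \<open>K\<close> collects the resulting full turns of the phase.\<close>
  define K where "K = (\<Sum>j<d. int (\<xi> j) * ((x j + step_vec (i, s) j) div int N))"
  have w: "real_of_int (walk_step N x (i, s) j) =
      real_of_int (x j) + real_of_int (step_vec (i, s) j) - real N * real_of_int ((x j + step_vec (i, s) j) div int N)" for j
  proof -
    have "walk_step N x (i, s) j = x j + step_vec (i, s) j - int N * ((x j + step_vec (i, s) j) div int N)"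
      by (simp add: walk_step_def torus_proj_def minus_mult_div_eq_mod)
    then show ?thesis by simp
  qed
  have "phase d N \<xi> (\<lambda>j. walk_step N x (i, s) j - y j) =
     (\<Sum>j<d. 2 * pi * real (\<xi> j) * real_of_int (x j - y j) / real N
        + 2 * pi * real (\<xi> j) * real_of_int (step_vec (i, s) j) / real N
        - 2 * pi * real_of_int (int (\<xi> j) * ((x j + step_vec (i, s) j) div int N)))"
    unfolding phase_def
  proof (rule sum.cong[OF refl])
    fix j
    show "2 * pi * real (\<xi> j) * real_of_int (walk_step N x (i, s) j - y j) / real N =
        2 * pi * real (\<xi> j) * real_of_int (x j - y j) / real N
        + 2 * pi * real (\<xi> j) * real_of_int (step_vec (i, s) j) / real N
        - 2 * pi * real_of_int (int (\<xi> j) * ((x j + step_vec (i, s) j) div int N))"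
      unfolding of_int_diff w using N by (simp add: field_simps)
  qed
  also have "\<dots> = phase d N \<xi> (\<lambda>j. x j - y j) + (\<Sum>j<d. 2 * pi * real (\<xi> j) * real_of_int (step_vec (i, s) j) / real N)
      - 2 * pi * real_of_int K"
    by (simp add: phase_def K_def sum.distrib sum_subtractf sum_distrib_left)
  also have "(\<Sum>j<d. 2 * pi * real (\<xi> j) * real_of_int (step_vec (i, s) j) / real N)
     = (\<Sum>j<d. if j = i then 2 * pi * real (\<xi> i) * real_of_int s / real N else 0)"
    by (intro sum.cong) (auto simp: step_vec_def)
  also have "\<dots> = 2 * pi * real (\<xi> i) * real_of_int s / real N" using i by simp
  finally show ?thesis
    by (simp add: cos_diff)
qed

text \<open>Cosines suffice: opposite steps combine to twice the cosine of the frequency times the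
  same cosine phase, so one step of the walk multiplies the mode by \<open>phi d N \<xi>\<close>.
  The initial condition is \<open>fourier_orthogonality\<close>.\<close>

lemma pk_fourier:
  assumes N: "N > 0" and d: "d > 0" and "x \<in> torus d N" and y: "y \<in> torus d N"
  shows "real N ^ d * finite_chain.pk (torus_kernel d N) (torus d N) n x y
    = (\<Sum>\<xi>\<in>freqs d N. phi d N \<xi> ^ n * cos (phase d N \<xi> (\<lambda>i. x i - y i)))"
  using assms(3)
proof (induction n arbitrary: x)
  interpret finite_chain "torus d N" "torus_kernel d N" by (rule finite_chain_torus[OF N d])
  {
    case 0
    then show ?case using fourier_orthogonality[OF N 0 y] by simp
  next
    case (Suc n)
    let ?c = "\<lambda>\<xi>. cos (phase d N \<xi> (\<lambda>i. x i - y i))"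
    have "real N ^ d * pk (torus d N) (Suc n) x y
      = (\<Sum>s\<in>srw_steps d. real N ^ d * pk (torus d N) n (walk_step N x s) y) / (2 * real d)"
      using Suc.prems by (simp add: torus_kernel_sum[OF N Suc.prems] sum_distrib_left)
    also have "\<dots> = (\<Sum>s\<in>srw_steps d. \<Sum>\<xi>\<in>freqs d N. phi d N \<xi> ^ n *
         cos (phase d N \<xi> (\<lambda>i. walk_step N x s i - y i))) / (2 * real d)"
      using Suc.IH[OF walk_step_in_torus[OF N Suc.prems]] by simp
    also have "\<dots> = (\<Sum>\<xi>\<in>freqs d N. phi d N \<xi> ^ n * ((\<Sum>s\<in>srw_steps d.
         cos (phase d N \<xi> (\<lambda>i. walk_step N x s i - y i))) / (2 * real d)))"
      by (subst sum.swap) (simp add: sum_distrib_left sum_divide_distrib)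
    also have "\<dots> = (\<Sum>\<xi>\<in>freqs d N. phi d N \<xi> ^ n * (phi d N \<xi> * ?c \<xi>))"
    proof (rule sum.cong[OF refl])
      fix \<xi>
      have "(\<Sum>s\<in>srw_steps d. cos (phase d N \<xi> (\<lambda>i. walk_step N x s i - y i)))
        = (\<Sum>i<d. \<Sum>s\<in>{-1, 1}. cos (phase d N \<xi> (\<lambda>j. walk_step N x (i, s) j - y j)))"
        unfolding srw_steps_def sum.cartesian_product by (rule sum.cong) auto
      also have "\<dots> = (\<Sum>i<d. 2 * cos (2 * pi * real (\<xi> i) / real N) * ?c \<xi>)"
        by (intro sum.cong refl) (simp add: cos_phase_step[OF N] cos_add cos_diff)
      also have "\<dots> = 2 * real d * (phi d N \<xi> * ?c \<xi>)"
        using d by (simp add: phi_def sum_distrib_left sum_distrib_right sum_divide_distrib mult.assoc)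
      finally show "phi d N \<xi> ^ n * ((\<Sum>s\<in>srw_steps d. cos (phase d N \<xi> (\<lambda>i. walk_step N x s i - y i))) / (2 * real d))
        = phi d N \<xi> ^ n * (phi d N \<xi> * ?c \<xi>)" using d by simp
    qed
    finally show ?case by (simp add: mult_ac)
  }
qed

section \<open>Heat kernel estimates on the torus\<close>

lemma jordan_sin:
  assumes "0 \<le> t" "t \<le> 1"
  shows "t \<le> sin (t * (pi / 2))"
proof -
  have "convex_on {0..pi} (\<lambda>x. - sin x)"
  proof (rule f''_ge0_imp_convex[where f' = "\<lambda>x. - cos x" and f'' = sin])
    show "((\<lambda>x. - sin x) has_real_derivative - cos x) (at x)" for x
      by (auto intro!: derivative_eq_intros)
    show "((\<lambda>x. - cos x) has_real_derivative sin x) (at x)" for x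
      by (auto intro!: derivative_eq_intros)
  qed (auto intro: sin_ge_zero)
  from convex_onD[OF this, of t 0 "pi / 2"] assms show ?thesis
    by simp
qed

text \<open>As the square of \<open>r * b - 1\<close> is nonnegative, the Gaussian is below
  \<open>exp 1\<close> times a geometric sequence with ratio \<open>exp (- (2 * r))\<close>.\<close>

lemma sum_gaussian_le:
  assumes r: "0 < r"
  shows "(\<Sum>b<m. exp (- (r * real b)\<^sup>2)) \<le> 3 * (1 + 1 / (2 * r))"
proof -
  let ?x = "exp (- (2 * r))"
  have x: "0 < ?x" "?x < 1" using r by auto
  have "exp (- (r * real b)\<^sup>2) \<le> exp 1 * ?x ^ b" for b
  proof -
    have "0 \<le> (r * real b - 1)\<^sup>2" by simp
    then have "- (r * real b)\<^sup>2 \<le> 1 + real b * (- (2 * r))"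
      by (simp add: power2_eq_square algebra_simps)
    then have "exp (- (r * real b)\<^sup>2) \<le> exp (1 + real b * (- (2 * r)))" by simp
    then show ?thesis by (simp only: exp_add exp_of_nat_mult)
  qed
  then have "(\<Sum>b<m. exp (- (r * real b)\<^sup>2)) \<le> (\<Sum>b<m. exp 1 * ?x ^ b)"
    by (intro sum_mono)
  also have "\<dots> = exp 1 * (\<Sum>b<m. ?x ^ b)" by (simp add: sum_distrib_left)
  also have "(\<Sum>b<m. ?x ^ b) \<le> (\<Sum>b. ?x ^ b)"
    using x by (intro sum_le_suminf summable_geometric) auto
  also have "(\<Sum>b. ?x ^ b) = 1 / (1 - ?x)" using x by (intro suminf_geometric) auto
  also have "1 / (1 - ?x) \<le> 1 + 1 / (2 * r)"
  proof -
    have "1 + 2 * r \<le> exp (2 * r)" by (rule exp_ge_add_one_self)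
    then have "?x * (1 + 2 * r) \<le> 1" using r by (simp add: exp_minus field_simps)
    then have "1 \<le> (1 - ?x) * ((1 + 2 * r) / (2 * r)) " using r by (simp add: field_simps)
    then have "1 / (1 - ?x) \<le> (1 + 2 * r) / (2 * r)" using x by (simp add: field_simps)
    also have "\<dots> = 1 + 1 / (2 * r)" using r by (simp add: field_simps)
    finally show ?thesis .
  qed
  also have "exp 1 * (1 + 1 / (2 * r)) \<le> 3 * (1 + 1 / (2 * r))"
    using exp_le r by (intro mult_right_mono) auto
  finally show ?thesis by simp
qed

text \<open>The grid of half steps \<open>pi / (2 * N)\<close> carries, after a shift by
  \<open>pi / 2\<close>, the cosines as well as the sines, so one bound serves eigenvalues near 1
  and near -1. Reflection at \<open>b = N\<close> reduces it to \<open>jordan_sin\<close>.\<close>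

lemma sum_exp_sin_le:
  assumes N: "0 < N" and c: "0 < c"
  shows "(\<Sum>b<2 * N. exp (- (c * (sin (pi * real b / (2 * real N)))\<^sup>2))) \<le> 6 * (1 + real N / (2 * sqrt c))"
proof -
  let ?f = "\<lambda>b. exp (- (c * (sin (pi * real b / (2 * real N)))\<^sup>2))"
  let ?g = "\<lambda>b. exp (- (sqrt c / real N * real b)\<^sup>2)"
  have fg: "?f b \<le> ?g b" if "b \<le> N" for b
  proof -
    have "real b / real N \<le> sin (real b / real N * (pi / 2))"
      using that N by (intro jordan_sin) auto
    then have "(real b / real N)\<^sup>2 \<le> (sin (real b / real N * (pi / 2)))\<^sup>2"
      by (intro power_mono) auto
    also have "real b / real N * (pi / 2) = pi * real b / (2 * real N)" by (simp add: field_simps)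
    finally have "c * (real b / real N)\<^sup>2 \<le> c * (sin (pi * real b / (2 * real N)))\<^sup>2"
      using c by (intro mult_left_mono) auto
    moreover have "(sqrt c / real N * real b)\<^sup>2 = c * (real b / real N)\<^sup>2"
      using c by (simp add: power_mult_distrib power_divide)
    ultimately show ?thesis by simp
  qed
  have refl: "?f b = ?f (2 * N - b)" if "b \<le> 2 * N" for b
  proof -
    have "pi * real (2 * N - b) / (2 * real N) = pi - pi * real b / (2 * real N)"
      using that N by (simp add: of_nat_diff field_simps)
    then show ?thesis by simp
  qed
  have "{..<2 * N} = {..<N} \<union> {N..<2 * N}" by auto
  then have "(\<Sum>b<2 * N. ?f b) = (\<Sum>b<N. ?f b) + (\<Sum>b\<in>{N..<2 * N}. ?f b)"
    by (simp add: sum.union_disjoint[symmetric] ivl_disj_int)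
  also have "(\<Sum>b\<in>{N..<2 * N}. ?f b) = (\<Sum>b\<in>{0<..N}. ?f b)"
  proof (rule sum.reindex_bij_witness[of _ "\<lambda>b. 2 * N - b" "\<lambda>b. 2 * N - b"])
    fix b assume "b \<in> {N..<2 * N}"
    then show "?f (2 * N - b) = ?f b" by (intro refl[symmetric]) simp
  qed auto
  also have "(\<Sum>b<N. ?f b) \<le> (\<Sum>b<Suc N. ?g b)"
  proof (rule order.trans)
    show "(\<Sum>b<N. ?f b) \<le> (\<Sum>b<N. ?g b)" by (intro sum_mono fg) auto
    show "(\<Sum>b<N. ?g b) \<le> (\<Sum>b<Suc N. ?g b)" by (intro sum_mono2) auto
  qed
  also have "(\<Sum>b\<in>{0<..N}. ?f b) \<le> (\<Sum>b<Suc N. ?g b)"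
  proof (rule order.trans)
    show "(\<Sum>b\<in>{0<..N}. ?f b) \<le> (\<Sum>b\<in>{0<..N}. ?g b)" by (intro sum_mono fg) auto
    show "(\<Sum>b\<in>{0<..N}. ?g b) \<le> (\<Sum>b<Suc N. ?g b)" by (intro sum_mono2) auto
  qed
  also have "(\<Sum>b<Suc N. ?g b) \<le> 3 * (1 + 1 / (2 * (sqrt c / real N)))"
    using N c by (intro sum_gaussian_le) auto
  also have "1 / (2 * (sqrt c / real N)) = real N / (2 * sqrt c)" by simp
  finally show ?thesis by simp
qed

lemma sum_inj_le:
  assumes "inj_on f {..<m::nat}" "f ` {..<m} \<subseteq> {..<k::nat}" "\<And>a. a < m \<Longrightarrow> (u a :: real) = w (f a)" "\<And>b. 0 \<le> w b"
  shows "(\<Sum>a<m. u a) \<le> (\<Sum>b<k. w b)"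
proof -
  have "(\<Sum>a<m. u a) = (\<Sum>b\<in>f ` {..<m}. w b)"
    using assms by (subst sum.reindex) auto
  also have "\<dots> \<le> (\<Sum>b<k. w b)" using assms by (intro sum_mono2) auto
  finally show ?thesis .
qed

text \<open>Each of the \<open>k + 1\<close> powers \<open>x ^ i\<close> with
  \<open>i \<le> k\<close> is at least \<open>x ^ k\<close>, and \<open>1 - x\<close> times their
  sum is at most 1. This replaces the spectral gap near the eigenvalue -1.\<close>

lemma power_times_diff_le:
  assumes "0 \<le> x" "x \<le> (1::real)"
  shows "x ^ k * (1 - x) \<le> 1 / real (Suc k)"
proof -
  have "real (Suc k) * x ^ k \<le> (\<Sum>i<Suc k. x ^ i)"
  proof -
    have "(\<Sum>i<Suc k. x ^ k) \<le> (\<Sum>i<Suc k. x ^ i)"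
      using assms by (intro sum_mono power_decreasing) auto
    then show ?thesis by simp
  qed
  then have "real (Suc k) * x ^ k * (1 - x) \<le> (\<Sum>i<Suc k. x ^ i) * (1 - x)"
    using assms by (intro mult_right_mono) auto
  also have "\<dots> = 1 - x ^ Suc k" using one_diff_power_eq[of x "Suc k"] by (simp add: mult.commute)
  also have "\<dots> \<le> 1" using assms by simp
  finally show ?thesis by (simp add: field_simps)
qed

section \<open>Heat kernel bounds from sums over frequencies\<close>

locale torus_chain =
  fixes d N :: nat
  assumes d_ge: "4 \<le> d" and N_pos: "0 < N"
begin

sublocale finite_chain "torus d N" "torus_kernel d N"
  by (rule finite_chain_torus) (use d_ge N_pos in auto)

abbreviation "V \<equiv> torus d N"
abbreviation "\<phi> \<equiv> phi d N"
abbreviation "\<Xi> \<equiv> freqs d N"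

text \<open>The factor 2 accounts for eigenvalues near 1 and near -1; either kind gives a product of
  \<open>d\<close> one-dimensional sums, each at most
  \<open>12 * sqrt d * N / sqrt n\<close>.\<close>

definition Cd :: real where "Cd = 2 * (12 * sqrt (real d)) ^ d"

definition weight :: "nat \<Rightarrow> real" where "weight n = (\<Sum>\<xi>\<in>\<Xi>. \<bar>\<phi> \<xi>\<bar> ^ n)"

lemma N_ge: "1 \<le> real N" using N_pos by simp
lemma d_pos: "0 < real d" using d_ge by simp
lemma finite_freqs: "finite \<Xi>" by (simp add: freqs_def finite_PiE)

lemma one_minus_phi: "1 - \<phi> \<xi> = (2 / real d) * (\<Sum>i<d. (sin (pi * real (\<xi> i) / real N))\<^sup>2)"
proof -
  have "cos (2 * pi * real (\<xi> i) / real N) = 1 - 2 * (sin (pi * real (\<xi> i) / real N))\<^sup>2" for i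
    using cos_double_sin[of "pi * real (\<xi> i) / real N"] by (simp add: mult.assoc)
  then have "\<phi> \<xi> = (\<Sum>i<d. 1 - 2 * (sin (pi * real (\<xi> i) / real N))\<^sup>2) / real d"
    by (simp only: phi_def)
  then show ?thesis using d_pos
    by (simp add: sum_subtractf sum_distrib_left[symmetric] field_simps)
qed

lemma one_plus_phi: "1 + \<phi> \<xi> = (2 / real d) * (\<Sum>i<d. (cos (pi * real (\<xi> i) / real N))\<^sup>2)"
proof -
  have "cos (2 * pi * real (\<xi> i) / real N) = 2 * (cos (pi * real (\<xi> i) / real N))\<^sup>2 - 1" for i
    using cos_double_cos[of "pi * real (\<xi> i) / real N"] by (simp add: mult.assoc)
  then have "\<phi> \<xi> = (\<Sum>i<d. 2 * (cos (pi * real (\<xi> i) / real N))\<^sup>2 - 1) / real d"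
    by (simp only: phi_def)
  then show ?thesis using d_pos
    by (simp add: sum_subtractf sum_distrib_left[symmetric] field_simps)
qed

lemma abs_phi_le_1: "\<bar>\<phi> \<xi>\<bar> \<le> 1"
proof -
  have "0 \<le> 1 - \<phi> \<xi>" "0 \<le> 1 + \<phi> \<xi>"
    unfolding one_minus_phi one_plus_phi by (intro mult_nonneg_nonneg sum_nonneg; simp)+
  then show ?thesis by linarith
qed

text \<open>The exponential of a sum over coordinates is a product, so summing over frequencies will
  give a \<open>d\<close>-th power. Nonnegative eigenvalues use the sine form, negative ones the
  cosine form.\<close>

lemma abs_phi_power_le:
  "\<bar>\<phi> \<xi>\<bar> ^ n \<le> (\<Prod>i<d. exp (- (2 * real n / real d * (sin (pi * real (\<xi> i) / real N))\<^sup>2)))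
     + (\<Prod>i<d. exp (- (2 * real n / real d * (cos (pi * real (\<xi> i) / real N))\<^sup>2)))"
proof -
  have "\<bar>\<phi> \<xi>\<bar> ^ n \<le> exp (- (1 - \<bar>\<phi> \<xi>\<bar>)) ^ n"
    using exp_ge_add_one_self[of "- (1 - \<bar>\<phi> \<xi>\<bar>)"] by (intro power_mono) auto
  also have "\<dots> = exp (- (real n * (1 - \<bar>\<phi> \<xi>\<bar>)))" by (simp add: exp_of_nat_mult[symmetric] algebra_simps)
  finally have 1: "\<bar>\<phi> \<xi>\<bar> ^ n \<le> exp (- (real n * (1 - \<bar>\<phi> \<xi>\<bar>)))" .
  have 2: "exp (- (real n * ((2 / real d) * (\<Sum>i<d. f i)))) = (\<Prod>i<d. exp (- (2 * real n / real d * f i)))" for f :: "nat \<Rightarrow> real"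
    by (simp add: exp_sum[symmetric] sum_negf sum_distrib_left sum_divide_distrib mult_ac)
  have 3: "0 \<le> (\<Prod>i<d. exp (f i))" for f :: "nat \<Rightarrow> real" by (intro prod_nonneg) simp
  show ?thesis
  proof (cases "0 \<le> \<phi> \<xi>")
    case True
    then have "\<bar>\<phi> \<xi>\<bar> ^ n \<le> exp (- (real n * (1 - \<phi> \<xi>)))" using 1 by simp
    then show ?thesis unfolding one_minus_phi 2 by (rule order.trans) (simp add: 3)
  next
    case False
    then have "\<bar>\<phi> \<xi>\<bar> ^ n \<le> exp (- (real n * (1 + \<phi> \<xi>)))" using 1 by simp
    then show ?thesis unfolding one_plus_phi 2 by (rule order.trans) (simp add: 3)
  qed
qed

lemma weight_le_early:
  assumes n: "1 \<le> n" "n \<le> N\<^sup>2"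
  shows "weight n \<le> Cd * (real N / sqrt (real n)) ^ d"
proof -
  define c where "c = 2 * real n / real d"
  define \<Theta> where "\<Theta> = (\<Sum>b<2 * N. exp (- (c * (sin (pi * real b / (2 * real N)))\<^sup>2)))"
  have c: "0 < c" using n d_pos by (simp add: c_def)
  have \<Theta>0: "0 \<le> \<Theta>" unfolding \<Theta>_def by (intro sum_nonneg) simp
  have s: "(\<Sum>a<N. exp (- (c * (sin (pi * real a / real N))\<^sup>2))) \<le> \<Theta>"
    unfolding \<Theta>_def by (rule sum_inj_le[where f = "\<lambda>a. 2 * a"]) (auto simp: inj_on_def)
  have co: "(\<Sum>a<N. exp (- (c * (cos (pi * real a / real N))\<^sup>2))) \<le> \<Theta>"
    unfolding \<Theta>_def
  proof (rule sum_inj_le[where f = "\<lambda>a. if 2 * a < N then 2 * a + N else 2 * a - N"])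
    show "inj_on (\<lambda>a. if 2 * a < N then 2 * a + N else 2 * a - N) {..<N}"
      by (auto simp: inj_on_def split: if_splits)
    fix a assume a: "a < N"
    have "(sin (pi * real (if 2 * a < N then 2 * a + N else 2 * a - N) / (2 * real N)))\<^sup>2 = (cos (pi * real a / real N))\<^sup>2"
    proof (cases "2 * a < N")
      case True
      have "pi * real (2 * a + N) / (2 * real N) = pi * real a / real N + pi / 2"
        using N_pos by (simp add: field_simps)
      then show ?thesis using True by (simp add: sin_add)
    next
      case False
      have "pi * real (2 * a - N) / (2 * real N) = pi * real a / real N - pi / 2"
        using N_pos False by (simp add: of_nat_diff field_simps)
      then show ?thesis using False by (simp add: sin_diff)
    qed
    then show "exp (- (c * (cos (pi * real a / real N))\<^sup>2)) =
      exp (- (c * (sin (pi * real (if 2 * a < N then 2 * a + N else 2 * a - N) / (2 * real N)))\<^sup>2))" by simp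
  qed auto
  have "weight n \<le> (\<Sum>\<xi>\<in>\<Xi>. (\<Prod>i<d. exp (- (c * (sin (pi * real (\<xi> i) / real N))\<^sup>2)))
     + (\<Prod>i<d. exp (- (c * (cos (pi * real (\<xi> i) / real N))\<^sup>2))))"
    unfolding weight_def c_def by (intro sum_mono abs_phi_power_le)
  also have "\<dots> = (\<Sum>a<N. exp (- (c * (sin (pi * real a / real N))\<^sup>2))) ^ d
      + (\<Sum>a<N. exp (- (c * (cos (pi * real a / real N))\<^sup>2))) ^ d"
    unfolding sum.distrib freqs_def
    using prod_sum_PiE[of "{..<d}" "\<lambda>_. {..<N}" "\<lambda>i a. exp (- (c * (sin (pi * real a / real N))\<^sup>2))"]
      prod_sum_PiE[of "{..<d}" "\<lambda>_. {..<N}" "\<lambda>i a. exp (- (c * (cos (pi * real a / real N))\<^sup>2))"]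
    by simp
  also have "\<dots> \<le> \<Theta> ^ d + \<Theta> ^ d"
    using s co by (intro add_mono power_mono) (auto intro!: sum_nonneg)
  also have "\<dots> = 2 * \<Theta> ^ d" by simp
  also have "\<dots> \<le> 2 * (12 * sqrt (real d) * (real N / sqrt (real n))) ^ d"
  proof (intro mult_left_mono power_mono \<Theta>0)
    have sn: "0 < sqrt (real n)" using n by simp
    have "\<Theta> \<le> 6 * (1 + real N / (2 * sqrt c))"
      unfolding \<Theta>_def by (rule sum_exp_sin_le[OF N_pos c])
    also have "real N / (2 * sqrt c) \<le> sqrt (real d) * (real N / sqrt (real n))"
    proof -
      have "sqrt (real n) / sqrt (real d) \<le> 2 * sqrt c"
      proof -
        have "sqrt (real n) / sqrt (real d) = sqrt (real n / real d)" by (simp add: real_sqrt_divide)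
        also have "\<dots> \<le> sqrt c" using d_pos by (simp add: c_def divide_right_mono)
        also have "\<dots> \<le> 2 * sqrt c" using c by simp
        finally show ?thesis .
      qed
      then have "real N / (2 * sqrt c) \<le> real N / (sqrt (real n) / sqrt (real d))"
        using sn d_pos c by (intro divide_left_mono) auto
      then show ?thesis by (simp add: mult_ac)
    qed
    also have "1 \<le> sqrt (real d) * (real N / sqrt (real n))"
    proof -
      have "sqrt (real n) \<le> sqrt (real (N\<^sup>2))" using n by (intro real_sqrt_le_mono) simp
      then have "1 \<le> real N / sqrt (real n)" using sn by simp
      moreover have "1 \<le> sqrt (real d)" using d_ge by simp
      ultimately show ?thesis using mult_mono[of 1 "sqrt (real d)" 1 "real N / sqrt (real n)"] by simp
    qed
    finally show "\<Theta> \<le> 12 * sqrt (real d) * (real N / sqrt (real n))" by (simp add: mult_ac)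
  qed auto
  also have "\<dots> = Cd * (real N / sqrt (real n)) ^ d" by (simp only: Cd_def power_mult_distrib mult.assoc)
  finally show ?thesis .
qed

lemma weight_antimono: "m \<le> n \<Longrightarrow> weight n \<le> weight m"
  unfolding weight_def using abs_phi_le_1 by (intro sum_mono power_decreasing) auto

lemma Cd_ge: "2 \<le> Cd"
proof -
  have "1 \<le> sqrt (real d)" using d_ge by simp
  then have "1 \<le> 12 * sqrt (real d)" by linarith
  then have "1 \<le> (12 * sqrt (real d)) ^ d" by (rule one_le_power)
  then show ?thesis by (simp add: Cd_def)
qed

lemma weight_le_late: "N\<^sup>2 \<le> n \<Longrightarrow> weight n \<le> Cd"
  using weight_antimono[of "N\<^sup>2" n] weight_le_early[of "N\<^sup>2"] N_pos by simp

lemma pk_le_weight: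
  assumes "x \<in> V" "y \<in> V"
  shows "pk V n x y \<le> weight n / real N ^ d"
proof -
  have "real N ^ d * pk V n x y = (\<Sum>\<xi>\<in>\<Xi>. \<phi> \<xi> ^ n * cos (phase d N \<xi> (\<lambda>i. x i - y i)))"
    using d_ge assms by (intro pk_fourier N_pos) auto
  also have "\<dots> \<le> weight n" unfolding weight_def
  proof (rule sum_mono)
    fix \<xi>
    have "\<phi> \<xi> ^ n * cos (phase d N \<xi> (\<lambda>i. x i - y i)) \<le> \<bar>\<phi> \<xi>\<bar> ^ n * 1"
      by (rule order.trans[OF abs_ge_self]) (simp add: abs_mult power_abs mult_left_le)
    then show "\<phi> \<xi> ^ n * cos (phase d N \<xi> (\<lambda>i. x i - y i)) \<le> \<bar>\<phi> \<xi>\<bar> ^ n" by simp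
  qed
  finally show ?thesis using N_pos by (simp add: field_simps)
qed

definition zero_freq :: "nat \<Rightarrow> nat" where "zero_freq = (\<lambda>i\<in>{..<d}. 0)"

lemma zero_freq: "zero_freq \<in> \<Xi>" "\<phi> zero_freq = 1" "phase d N zero_freq z = 0"
  using N_pos d_ge by (auto simp: zero_freq_def freqs_def phi_def phase_def)

text \<open>One nonzero coordinate is enough: its sine is at least \<open>2 / N\<close> by
  \<open>jordan_sin\<close>, after reflection if the frequency is beyond
  \<open>N / 2\<close>.\<close>

lemma phi_gap:
  assumes "\<xi> \<in> \<Xi>" "\<xi> \<noteq> zero_freq"
  shows "8 / (real d * (real N)\<^sup>2) \<le> 1 - \<phi> \<xi>"
proof -
  have "\<exists>i<d. \<xi> i \<noteq> 0"
  proof (rule ccontr)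
    assume "\<not> (\<exists>i<d. \<xi> i \<noteq> 0)"
    then have "\<xi> = zero_freq" using assms(1)
      by (intro extensionalityI[of _ "{..<d}"]) (auto simp: zero_freq_def freqs_def PiE_def)
    then show False using assms(2) by simp
  qed
  then obtain i where i: "i < d" "\<xi> i \<noteq> 0" by blast
  then have xN: "0 < \<xi> i" "\<xi> i < N" using assms(1) by (auto simp: freqs_def PiE_def Pi_def)
  have sin_ge: "2 / real N \<le> sin (pi * real (\<xi> i) / real N)"
  proof (cases "2 * \<xi> i \<le> N")
    case True
    have "2 / real N \<le> 2 * real (\<xi> i) / real N" using xN by (intro divide_right_mono) auto
    also have "\<dots> \<le> sin (2 * real (\<xi> i) / real N * (pi / 2))"
      using True N_pos by (intro jordan_sin) (auto simp: field_simps simp flip: of_nat_mult)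
    finally show ?thesis by (simp add: mult.commute)
  next
    case False
    have e: "real (N - \<xi> i) = real N - real (\<xi> i)" using xN by (simp add: of_nat_diff)
    have "2 / real N \<le> 2 * real (N - \<xi> i) / real N" using xN by (intro divide_right_mono) auto
    also have "\<dots> \<le> sin (2 * real (N - \<xi> i) / real N * (pi / 2))"
      using False N_pos xN by (intro jordan_sin) (auto simp: field_simps e)
    also have "2 * real (N - \<xi> i) / real N * (pi / 2) = pi - pi * real (\<xi> i) / real N"
      unfolding e using N_pos by (simp add: field_simps)
    finally show ?thesis by simp
  qed
  have "(2 / real N)\<^sup>2 \<le> (sin (pi * real (\<xi> i) / real N))\<^sup>2"
    using sin_ge by (intro power_mono) auto
  also have "\<dots> \<le> (\<Sum>i<d. (sin (pi * real (\<xi> i) / real N))\<^sup>2)"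
    using i by (intro member_le_sum[of i _ "\<lambda>i. (sin (pi * real (\<xi> i) / real N))\<^sup>2"]) auto
  finally have "(2 / real d) * (2 / real N)\<^sup>2 \<le> 1 - \<phi> \<xi>"
    unfolding one_minus_phi using d_pos by (intro mult_left_mono) auto
  then show ?thesis by (simp add: power_divide)
qed

text \<open>The factor \<open>1 + c\<^sub>1\<close> makes the contribution of the non-trivial frequencies to \<open>pk_lower\<close> at most 1.\<close>

definition c\<^sub>1 :: nat where "c\<^sub>1 = nat \<lceil>Cd * (real d + 1)\<rceil>"
definition g :: nat where "g = (1 + c\<^sub>1) * N\<^sup>2"

lemma c\<^sub>1: "Cd * (real d + 1) \<le> real c\<^sub>1" "0 < real c\<^sub>1"
proof -
  show "Cd * (real d + 1) \<le> real c\<^sub>1" unfolding c\<^sub>1_def by (rule real_nat_ceiling_ge)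
  moreover have "0 < Cd * (real d + 1)" using Cd_ge by simp
  ultimately show "0 < real c\<^sub>1" by linarith
qed

lemma N2_le_g: "N\<^sup>2 \<le> g" and N2_c\<^sub>1_le: "c\<^sub>1 * N\<^sup>2 = g - N\<^sup>2"
  by (simp_all add: g_def)

lemma real_g: "real g = (1 + real c\<^sub>1) * (real N)\<^sup>2"
  unfolding g_def of_nat_mult of_nat_add of_nat_1 of_nat_power ..

lemma pk_upper:
  assumes "g \<le> n" "x \<in> V" "y \<in> V"
  shows "pk V n x y \<le> Cd / real N ^ d"
proof -
  have "pk V n x y \<le> weight n / real N ^ d" by (rule pk_le_weight[OF assms(2,3)])
  also have "\<dots> \<le> Cd / real N ^ d"
    using weight_le_late[of n] assms(1) N2_le_g by (intro divide_right_mono) auto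
  finally show ?thesis .
qed

text \<open>For nonnegative eigenvalues the gap gives decay over
  \<open>k \<ge> c\<^sub>1 * N\<^sup>2\<close> steps. Negative ones may equal -1, but there the
  factor \<open>1 + \<phi> \<xi>\<close> of two consecutive times is
  \<open>1 - \<bar>\<phi> \<xi>\<bar>\<close>, so \<open>power_times_diff_le\<close> applies. The
  remaining \<open>N\<^sup>2\<close> steps keep the sum over all frequencies below
  \<open>Cd\<close>.\<close>

lemma phi_pair_le:
  assumes n: "g \<le> n" and \<xi>: "\<xi> \<in> \<Xi>" "\<xi> \<noteq> zero_freq"
  shows "\<bar>\<phi> \<xi>\<bar> ^ n * (1 + \<phi> \<xi>) \<le> \<bar>\<phi> \<xi>\<bar> ^ N\<^sup>2 * ((real d + 1) / real c\<^sub>1)"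
proof -
  define k where "k = n - N\<^sup>2"
  have k: "c\<^sub>1 * N\<^sup>2 \<le> k" "n = N\<^sup>2 + k" using n N2_le_g by (auto simp: k_def N2_c\<^sub>1_le)
  have k': "real c\<^sub>1 * (real N)\<^sup>2 \<le> real k"
    using k(1) by (metis of_nat_le_iff of_nat_mult of_nat_power)
  have N2: "1 \<le> (real N)\<^sup>2" using N_ge by (simp add: one_le_power)
  have "\<bar>\<phi> \<xi>\<bar> ^ k * (1 + \<phi> \<xi>) \<le> (real d + 1) / real c\<^sub>1"
  proof (cases "0 \<le> \<phi> \<xi>")
    case True
    have gap: "8 / (real d * (real N)\<^sup>2) \<le> 1 - \<phi> \<xi>" by (rule phi_gap[OF \<xi>])
    have "\<phi> \<xi> ^ k = (1 - (1 - \<phi> \<xi>)) ^ k" by simp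
    also have "\<dots> \<le> exp (- ((1 - \<phi> \<xi>) * real k))"
      using True abs_phi_le_1[of \<xi>] by (intro power_le_exp_neg) auto
    also have "(8 / (real d * (real N)\<^sup>2)) * (real c\<^sub>1 * (real N)\<^sup>2) \<le> (1 - \<phi> \<xi>) * real k"
      using gap k' d_pos abs_phi_le_1[of \<xi>] by (intro mult_mono) auto
    then have "exp (- ((1 - \<phi> \<xi>) * real k)) \<le> exp (- (8 * real c\<^sub>1 / real d))"
      using N_pos by (simp add: field_simps)
    also have "\<dots> \<le> 1 / (8 * real c\<^sub>1 / real d)"
      using c\<^sub>1(2) d_pos by (intro exp_neg_le_inverse) auto
    finally have "\<phi> \<xi> ^ k \<le> real d / (8 * real c\<^sub>1)" by simp
    moreover have "1 + \<phi> \<xi> \<le> 2" using abs_phi_le_1[of \<xi>] by linarith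
    ultimately have "\<phi> \<xi> ^ k * (1 + \<phi> \<xi>) \<le> real d / (8 * real c\<^sub>1) * 2"
      using True by (intro mult_mono) auto
    also have "\<dots> \<le> (real d + 1) / real c\<^sub>1" using c\<^sub>1(2) by (simp add: field_simps)
    finally show ?thesis using True by simp
  next
    case False
    have "\<bar>\<phi> \<xi>\<bar> ^ k * (1 - \<bar>\<phi> \<xi>\<bar>) \<le> 1 / real (Suc k)"
      using abs_phi_le_1 by (intro power_times_diff_le) auto
    also have "\<dots> \<le> 1 / real c\<^sub>1"
    proof (intro divide_left_mono)
      have "real c\<^sub>1 * 1 \<le> real c\<^sub>1 * (real N)\<^sup>2" using N2 by (intro mult_left_mono) auto
      then show "real c\<^sub>1 \<le> real (Suc k)" using k' by simp
    qed (use c\<^sub>1 in auto)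
    also have "\<dots> \<le> (real d + 1) / real c\<^sub>1" using c\<^sub>1(2) by (intro divide_right_mono) auto
    finally show ?thesis using False by simp
  qed
  then have "\<bar>\<phi> \<xi>\<bar> ^ N\<^sup>2 * (\<bar>\<phi> \<xi>\<bar> ^ k * (1 + \<phi> \<xi>)) \<le> \<bar>\<phi> \<xi>\<bar> ^ N\<^sup>2 * ((real d + 1) / real c\<^sub>1)"
    by (rule mult_left_mono) simp
  then show ?thesis unfolding k(2) power_add by (simp only: mult.assoc)
qed

text \<open>After multiplication by \<open>N ^ d\<close> the trivial frequency contributes 2 and the
  others together at most 1 in absolute value.\<close>

lemma pk_lower:
  assumes n: "g \<le> n" and x: "x \<in> V" and y: "y \<in> V"
  shows "1 / real N ^ d \<le> pk V n x y + pk V (Suc n) x y"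
proof -
  let ?c = "\<lambda>\<xi>. cos (phase d N \<xi> (\<lambda>i. x i - y i))"
  have d0: "0 < d" using d_ge by simp
  have "real N ^ d * (pk V n x y + pk V (Suc n) x y) = (\<Sum>\<xi>\<in>\<Xi>. \<phi> \<xi> ^ n * (1 + \<phi> \<xi>) * ?c \<xi>)"
    unfolding distrib_left pk_fourier[OF N_pos d0 x y] sum.distrib[symmetric]
    by (intro sum.cong refl) (simp add: algebra_simps)
  also have "\<dots> = \<phi> zero_freq ^ n * (1 + \<phi> zero_freq) * ?c zero_freq
      + (\<Sum>\<xi>\<in>\<Xi> - {zero_freq}. \<phi> \<xi> ^ n * (1 + \<phi> \<xi>) * ?c \<xi>)"
    by (rule sum.remove[OF finite_freqs zero_freq(1)])
  also have "\<dots> = 2 + (\<Sum>\<xi>\<in>\<Xi> - {zero_freq}. \<phi> \<xi> ^ n * (1 + \<phi> \<xi>) * ?c \<xi>)"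
    by (simp add: zero_freq)
  also have "\<dots> \<ge> 2 - 1"
  proof -
    have "\<bar>\<Sum>\<xi>\<in>\<Xi> - {zero_freq}. \<phi> \<xi> ^ n * (1 + \<phi> \<xi>) * ?c \<xi>\<bar>
      \<le> (\<Sum>\<xi>\<in>\<Xi> - {zero_freq}. \<bar>\<phi> \<xi>\<bar> ^ N\<^sup>2 * ((real d + 1) / real c\<^sub>1))"
    proof (rule order.trans[OF sum_abs], rule sum_mono)
      fix \<xi> assume \<xi>: "\<xi> \<in> \<Xi> - {zero_freq}"
      have p: "0 \<le> 1 + \<phi> \<xi>" using abs_phi_le_1[of \<xi>] by linarith
      have "\<bar>\<phi> \<xi> ^ n * (1 + \<phi> \<xi>) * ?c \<xi>\<bar> = \<bar>\<phi> \<xi>\<bar> ^ n * (1 + \<phi> \<xi>) * \<bar>?c \<xi>\<bar>"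
        using p by (simp add: abs_mult power_abs)
      also have "\<dots> \<le> \<bar>\<phi> \<xi>\<bar> ^ n * (1 + \<phi> \<xi>)"
        using p by (intro mult_left_le) auto
      also have "\<dots> \<le> \<bar>\<phi> \<xi>\<bar> ^ N\<^sup>2 * ((real d + 1) / real c\<^sub>1)"
        using \<xi> by (intro phi_pair_le n) auto
      finally show "\<bar>\<phi> \<xi> ^ n * (1 + \<phi> \<xi>) * ?c \<xi>\<bar> \<le> \<bar>\<phi> \<xi>\<bar> ^ N\<^sup>2 * ((real d + 1) / real c\<^sub>1)" .
    qed
    also have "\<dots> \<le> (\<Sum>\<xi>\<in>\<Xi>. \<bar>\<phi> \<xi>\<bar> ^ N\<^sup>2 * ((real d + 1) / real c\<^sub>1))"
      by (intro sum_mono2 finite_freqs) auto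
    also have "\<dots> = weight (N\<^sup>2) * ((real d + 1) / real c\<^sub>1)"
      by (simp only: weight_def sum_distrib_right)
    also have "\<dots> \<le> Cd * ((real d + 1) / real c\<^sub>1)"
      by (intro mult_right_mono weight_le_late) auto
    also have "\<dots> \<le> 1" using c\<^sub>1 by simp
    finally show ?thesis by linarith
  qed
  finally show ?thesis using N_pos by (simp add: field_simps)
qed

text \<open>\<open>L\<close> bounds the sum of n^(1 - d/2), the only part that may grow with
  \<open>N\<close>. Between \<open>N\<^sup>2\<close> and \<open>g\<close> the kernel is at most
  \<open>Cd / N ^ d\<close>, and \<open>g\<^sup>2 / N ^ d\<close> is bounded because
  \<open>d \<ge> 4\<close>.\<close>

lemma sum_returns_le:
  assumes x: "x \<in> V" and L: "(\<Sum>n = 1..<N\<^sup>2. real n / sqrt (real n) ^ d) \<le> L"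
  shows "(\<Sum>n<g. real (Suc n) * pk V n x x) \<le> 1 + 2 * Cd * L + (1 + real c\<^sub>1)\<^sup>2 * Cd"
proof -
  have Nd: "0 < real N ^ d" using N_pos by simp
  have "(\<Sum>n<g. real (Suc n) * pk V n x x)
    \<le> (\<Sum>n\<in>{0} \<union> {1..<N\<^sup>2} \<union> {N\<^sup>2..<g}. real (Suc n) * pk V n x x)"
    using pk_nonneg[of V _ x x] N2_le_g by (intro sum_mono2) auto
  also have "\<dots> = real (Suc 0) * pk V 0 x x + (\<Sum>n = 1..<N\<^sup>2. real (Suc n) * pk V n x x)
      + (\<Sum>n = N\<^sup>2..<g. real (Suc n) * pk V n x x)"
    using N_pos by (subst sum.union_disjoint) (auto simp del: pk.simps)
  also have "(\<Sum>n = 1..<N\<^sup>2. real (Suc n) * pk V n x x) \<le> (\<Sum>n = 1..<N\<^sup>2. 2 * Cd * (real n / sqrt (real n) ^ d))"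
  proof (rule sum_mono)
    fix n assume n: "n \<in> {1..<N\<^sup>2}"
    then have sn: "0 < sqrt (real n)" by simp
    have "pk V n x x \<le> weight n / real N ^ d" by (rule pk_le_weight[OF x x])
    also have "\<dots> \<le> Cd * (real N / sqrt (real n)) ^ d / real N ^ d"
      using n Nd by (intro divide_right_mono weight_le_early) auto
    also have "\<dots> = Cd / sqrt (real n) ^ d" using Nd by (simp add: power_divide)
    finally have "real (Suc n) * pk V n x x \<le> (2 * real n) * (Cd / sqrt (real n) ^ d)"
      using n by (intro mult_mono pk_nonneg) auto
    then show "real (Suc n) * pk V n x x \<le> 2 * Cd * (real n / sqrt (real n) ^ d)" by (simp add: mult_ac)
  qed
  also have "(\<Sum>n = 1..<N\<^sup>2. 2 * Cd * (real n / sqrt (real n) ^ d)) = 2 * Cd * (\<Sum>n = 1..<N\<^sup>2. real n / sqrt (real n) ^ d)"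
    by (simp only: sum_distrib_left)
  also have "\<dots> \<le> 2 * Cd * L" using Cd_ge by (intro mult_left_mono L) auto
  also have "(\<Sum>n = N\<^sup>2..<g. real (Suc n) * pk V n x x) \<le> (\<Sum>n = N\<^sup>2..<g. real g * (Cd / real N ^ d))"
  proof (rule sum_mono)
    fix n assume n: "n \<in> {N\<^sup>2..<g}"
    have "pk V n x x \<le> weight n / real N ^ d" by (rule pk_le_weight[OF x x])
    also have "\<dots> \<le> Cd / real N ^ d" using n Nd by (intro divide_right_mono weight_le_late) auto
    finally show "real (Suc n) * pk V n x x \<le> real g * (Cd / real N ^ d)"
      using n by (intro mult_mono pk_nonneg) auto
  qed
  also have "\<dots> = real (g - N\<^sup>2) * (real g * (Cd / real N ^ d))" by simp
  also have "\<dots> \<le> real g * (real g * (Cd / real N ^ d))"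
    using Cd_ge Nd by (intro mult_right_mono) auto
  also have "\<dots> \<le> (1 + real c\<^sub>1)\<^sup>2 * Cd"
  proof -
    have "real N ^ 4 \<le> real N ^ d" using N_ge d_ge by (intro power_increasing) auto
    then have "real N ^ 4 / real N ^ d \<le> 1" using Nd by simp
    then have "((1 + real c\<^sub>1)\<^sup>2 * Cd) * (real N ^ 4 / real N ^ d) \<le> ((1 + real c\<^sub>1)\<^sup>2 * Cd) * 1"
      using Cd_ge by (intro mult_left_mono) auto
    then show ?thesis by (simp add: real_g power2_eq_square power4_eq_xxxx mult_ac)
  qed
  finally show ?thesis using x by simp
qed

lemma trace_fourier: "(\<Sum>y\<in>V. pk V n y y) = (\<Sum>\<xi>\<in>\<Xi>. \<phi> \<xi> ^ n)"
proof -
  have Nd: "real N ^ d \<noteq> 0" using N_pos by simp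
  have "pk V n y y = (\<Sum>\<xi>\<in>\<Xi>. \<phi> \<xi> ^ n) / real N ^ d" if y: "y \<in> V" for y
  proof -
    have "real N ^ d * pk V n y y = (\<Sum>\<xi>\<in>\<Xi>. \<phi> \<xi> ^ n * cos (phase d N \<xi> (\<lambda>i. y i - y i)))"
      using d_ge by (intro pk_fourier N_pos y) simp
    then show ?thesis using Nd by (simp add: phase_def field_simps)
  qed
  then have "(\<Sum>y\<in>V. pk V n y y) = (\<Sum>y\<in>V. (\<Sum>\<xi>\<in>\<Xi>. \<phi> \<xi> ^ n) / real N ^ d)"
    by (intro sum.cong) auto
  then show ?thesis using N_pos by (simp add: card_torus)
qed

text \<open>Without the trivial frequency there remain geometric series whose denominators
  \<open>1 - \<phi> \<xi> * q\<close> are at least \<open>1 / (d * N\<^sup>2)\<close>, uniformly in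
  \<open>q\<close>. Their numerators, powers with exponent \<open>g \<ge> N\<^sup>2\<close>, sum to
  at most \<open>Cd\<close> over the frequencies.\<close>

lemma trace_excess_le:
  assumes q: "0 < q" "q < 1"
  shows "(\<Sum>n. ((\<Sum>y\<in>V. pk V (n + g) y y) - 1) * q ^ (n + g)) \<le> Cd * real d * real g"
proof -
  have aq: "\<bar>\<phi> \<xi> * q\<bar> < 1" for \<xi>
  proof -
    have "\<bar>\<phi> \<xi> * q\<bar> = \<bar>\<phi> \<xi>\<bar> * q" using q by (simp add: abs_mult)
    also have "\<dots> \<le> 1 * q" using q by (intro mult_right_mono abs_phi_le_1) auto
    finally show ?thesis using q by linarith
  qed
  have "(\<lambda>n. \<Sum>\<xi>\<in>\<Xi> - {zero_freq}. (\<phi> \<xi> * q) ^ g * (\<phi> \<xi> * q) ^ n) sums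
      (\<Sum>\<xi>\<in>\<Xi> - {zero_freq}. (\<phi> \<xi> * q) ^ g * (1 / (1 - \<phi> \<xi> * q)))"
    using aq by (intro sums_sum sums_mult geometric_sums) simp
  moreover have "(\<Sum>\<xi>\<in>\<Xi> - {zero_freq}. (\<phi> \<xi> * q) ^ g * (\<phi> \<xi> * q) ^ n)
     = ((\<Sum>y\<in>V. pk V (n + g) y y) - 1) * q ^ (n + g)" for n
  proof -
    have "(\<Sum>y\<in>V. pk V (n + g) y y) - 1 = (\<Sum>\<xi>\<in>\<Xi> - {zero_freq}. \<phi> \<xi> ^ (n + g))"
      unfolding trace_fourier sum.remove[OF finite_freqs zero_freq(1)] by (simp add: zero_freq)
    then show ?thesis by (simp add: sum_distrib_left power_mult_distrib power_add mult_ac)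
  qed
  ultimately have "(\<Sum>n. ((\<Sum>y\<in>V. pk V (n + g) y y) - 1) * q ^ (n + g))
     = (\<Sum>\<xi>\<in>\<Xi> - {zero_freq}. (\<phi> \<xi> * q) ^ g * (1 / (1 - \<phi> \<xi> * q)))"
    by (simp add: sums_iff)
  also have "\<dots> \<le> (\<Sum>\<xi>\<in>\<Xi> - {zero_freq}. \<bar>\<phi> \<xi>\<bar> ^ N\<^sup>2 * (real d * (real N)\<^sup>2))"
  proof (rule sum_mono)
    fix \<xi> assume \<xi>: "\<xi> \<in> \<Xi> - {zero_freq}"
    have N2: "1 \<le> (real N)\<^sup>2" using N_ge by (simp add: one_le_power)
    have dN: "1 \<le> real d * (real N)\<^sup>2" using mult_mono[of 1 "real d" 1 "(real N)\<^sup>2"] N2 d_ge by simp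
    have "\<bar>\<phi> \<xi> * q\<bar> ^ g \<le> \<bar>\<phi> \<xi>\<bar> ^ g"
      using q by (intro power_mono) (auto simp: abs_mult mult_left_le)
    also have "\<dots> \<le> \<bar>\<phi> \<xi>\<bar> ^ N\<^sup>2" using abs_phi_le_1 N2_le_g by (intro power_decreasing) auto
    finally have p: "\<bar>\<phi> \<xi> * q\<bar> ^ g \<le> \<bar>\<phi> \<xi>\<bar> ^ N\<^sup>2" .
    have pos: "0 < 1 - \<phi> \<xi> * q" using aq[of \<xi>] by linarith
    have r: "1 / (1 - \<phi> \<xi> * q) \<le> real d * (real N)\<^sup>2"
    proof (cases "0 \<le> \<phi> \<xi>")
      case True
      have "8 / (real d * (real N)\<^sup>2) \<le> 1 - \<phi> \<xi>" using \<xi> by (intro phi_gap) auto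
      moreover have "\<phi> \<xi> * q \<le> \<phi> \<xi>" using True q by (simp add: mult_left_le)
      moreover have "1 / (real d * (real N)\<^sup>2) \<le> 8 / (real d * (real N)\<^sup>2)" by (intro divide_right_mono) auto
      ultimately have "1 / (real d * (real N)\<^sup>2) \<le> 1 - \<phi> \<xi> * q" by linarith
      then have "1 / (1 - \<phi> \<xi> * q) \<le> 1 / (1 / (real d * (real N)\<^sup>2))"
        using pos d_pos N_pos by (intro divide_left_mono mult_pos_pos divide_pos_pos) auto
      then show ?thesis by simp
    next
      case False
      then have "\<phi> \<xi> * q \<le> 0" using q by (simp add: mult_nonpos_nonneg)
      then have "1 / (1 - \<phi> \<xi> * q) \<le> 1" by simp
      then show ?thesis using dN by linarith
    qed
    have "(\<phi> \<xi> * q) ^ g * (1 / (1 - \<phi> \<xi> * q)) \<le> \<bar>\<phi> \<xi> * q\<bar> ^ g * (1 / (1 - \<phi> \<xi> * q))"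
      using pos by (intro mult_right_mono) (auto simp flip: power_abs)
    also have "\<dots> \<le> \<bar>\<phi> \<xi>\<bar> ^ N\<^sup>2 * (real d * (real N)\<^sup>2)"
      using p r pos by (intro mult_mono) auto
    finally show "(\<phi> \<xi> * q) ^ g * (1 / (1 - \<phi> \<xi> * q)) \<le> \<bar>\<phi> \<xi>\<bar> ^ N\<^sup>2 * (real d * (real N)\<^sup>2)" .
  qed
  also have "\<dots> \<le> (\<Sum>\<xi>\<in>\<Xi>. \<bar>\<phi> \<xi>\<bar> ^ N\<^sup>2 * (real d * (real N)\<^sup>2))"
    by (intro sum_mono2 finite_freqs) auto
  also have "\<dots> = weight (N\<^sup>2) * (real d * (real N)\<^sup>2)"
    by (simp only: weight_def sum_distrib_right)
  also have "\<dots> \<le> Cd * (real d * real g)"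
  proof (intro mult_mono weight_le_late mult_left_mono)
    show "(real N)\<^sup>2 \<le> real g" using N2_le_g by (metis of_nat_le_iff of_nat_power)
  qed (use Cd_ge in auto)
  finally show ?thesis by (simp add: mult_ac)
qed

text \<open>The \<open>H\<close> of \<open>lerw_chain\<close>, obtained by adding up the lower
  bounds required of it; the torus size enters only through \<open>L\<close>.\<close>

definition scale :: "real \<Rightarrow> nat" where
  "scale L = nat \<lceil>1000 + Cd * real d + (1 + real c\<^sub>1)\<^sup>2 * Cd + 2 * Cd * L\<rceil>"

text \<open>An integer within a factor 2 of N^(d/2), since the length scale \<open>s\<close> of
  \<open>lerw_chain\<close> is a natural number.\<close>

definition root_vol :: nat where "root_vol = nat \<lceil>sqrt (real N ^ d)\<rceil>"

lemma root_vol: "sqrt (real N ^ d) \<le> real root_vol" "real root_vol \<le> 2 * sqrt (real N ^ d)"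
proof -
  have "1 \<le> real N ^ d" using N_ge by (simp add: one_le_power)
  then have "1 \<le> sqrt (real N ^ d)" by simp
  then show "sqrt (real N ^ d) \<le> real root_vol" "real root_vol \<le> 2 * sqrt (real N ^ d)"
    unfolding root_vol_def by linarith+
qed

lemma lerw_chain_torus:
  assumes L0: "0 \<le> L" and L: "(\<Sum>n = 1..<N\<^sup>2. real n / sqrt (real n) ^ d) \<le> L"
  shows "lerw_chain V (torus_kernel d N) g (scale L) (real N ^ d) root_vol"
proof -
  have Nd: "1 \<le> real N ^ d" using N_ge by (simp add: one_le_power)
  have sq1: "1 \<le> sqrt (real N ^ d)" using Nd by simp
  have c0: "0 \<le> Cd * real d" "0 \<le> 2 * Cd * L" using Cd_ge L0 by auto
  have c2: "1 + real c\<^sub>1 \<le> (1 + real c\<^sub>1)\<^sup>2 * Cd"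
  proof -
    have "(1 + real c\<^sub>1) * 1 \<le> (1 + real c\<^sub>1) * ((1 + real c\<^sub>1) * Cd)"
      using Cd_ge mult_mono[of 1 "1 + real c\<^sub>1" 1 Cd] by (intro mult_left_mono) auto
    then show ?thesis by (simp add: power2_eq_square mult_ac)
  qed
  have H: "1000 + Cd * real d + (1 + real c\<^sub>1)\<^sup>2 * Cd + 2 * Cd * L \<le> real (scale L)"
    unfolding scale_def by (rule real_nat_ceiling_ge)
  have HC: "Cd \<le> real (scale L)"
  proof -
    have "Cd * 1 \<le> Cd * real d" using Cd_ge d_ge by (intro mult_left_mono) auto
    then show ?thesis using H c0 c2 by linarith
  qed
  show ?thesis
  proof unfold_locales
    show "1 \<le> g" using N_pos N2_le_g by (metis One_nat_def Suc_leI le_trans zero_less_power)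
    show "1 \<le> real (scale L)" using H c0 c2 by linarith
    show "0 < real N ^ d" using Nd by linarith
    show "pk V n x y \<le> real (scale L) / real N ^ d" if "g \<le> n" "x \<in> V" "y \<in> V" for n x y
      using pk_upper[OF that] divide_right_mono[OF HC, of "real N ^ d"] by simp
    show "1 / real N ^ d \<le> pk V n x y + pk V (Suc n) x y" if "g \<le> n" "x \<in> V" "y \<in> V" for n x y
      by (rule pk_lower[OF that])
    show "(\<Sum>n<g. real (Suc n) * pk V n x x) \<le> real (scale L)" if "x \<in> V" for x
      using sum_returns_le[OF that L] H c0 by linarith
    show "(\<Sum>n. ((\<Sum>y\<in>V. pk V (n + g) y y) - 1) * q ^ (n + g)) \<le> real (scale L) * real g"
      if "0 < q" "q < 1" for q
    proof -
      have "Cd * real d * real g \<le> real (scale L) * real g"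
      proof (rule mult_right_mono)
        show "Cd * real d \<le> real (scale L)" using H c0 c2 by linarith
      qed simp
      then show ?thesis using trace_excess_le[OF that] by linarith
    qed
    have "1000 \<le> real (scale L)" using H c0 c2 by linarith
    then show "1000 \<le> scale L" by simp
    show "1 \<le> root_vol" using root_vol(1) sq1 by linarith
    have "(sqrt (real N ^ d))\<^sup>2 \<le> (real root_vol)\<^sup>2" using root_vol sq1 by (intro power_mono) auto
    then show "real N ^ d \<le> (real root_vol)\<^sup>2" by simp
    have "(real root_vol)\<^sup>2 \<le> (2 * sqrt (real N ^ d))\<^sup>2" using root_vol by (intro power_mono) auto
    then show "(real root_vol)\<^sup>2 \<le> 4 * real N ^ d" by (simp add: power_mult_distrib)
    have "real g = (1 + real c\<^sub>1) * (real N)\<^sup>2" by (rule real_g)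
    also have "\<dots> \<le> real (scale L) * real root_vol"
    proof (rule mult_mono)
      show "1 + real c\<^sub>1 \<le> real (scale L)" using H c0 c2 by linarith
      \<comment> \<open>The mixing time is compared with the length scale: \<open>N\<^sup>2\<close>
        is at most N^(d/2) because \<open>d \<ge> 4\<close>.\<close>
      have "real N ^ 4 = ((real N)\<^sup>2)\<^sup>2" by (simp flip: power_mult)
      then have "(real N)\<^sup>2 = sqrt (real N ^ 4)" by (metis real_sqrt_abs abs_power2)
      also have "\<dots> \<le> sqrt (real N ^ d)"
        using N_ge d_ge by (intro real_sqrt_le_mono power_increasing) auto
      finally show "(real N)\<^sup>2 \<le> real root_vol" using root_vol(1) by linarith
    qed auto
    finally have "real g \<le> real (scale L * root_vol)" by simp
    then show "g \<le> scale L * root_vol" by (simp only: of_nat_le_iff)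
  qed
qed

end

section \<open>Transfer to the product space\<close>

definition step_seqs :: "nat \<Rightarrow> nat \<Rightarrow> (nat \<times> int) list set" where
  "step_seqs d n = {ss. set ss \<subseteq> srw_steps d \<and> length ss = n}"

fun path_of :: "nat \<Rightarrow> (nat \<Rightarrow> int) \<Rightarrow> (nat \<times> int) list \<Rightarrow> (nat \<Rightarrow> int) list" where
  "path_of N x [] = [x]"
| "path_of N x (s # ss) = x # path_of N (walk_step N x s) ss"

lemma finite_step_seqs: "finite (step_seqs d n)"
  unfolding step_seqs_def by (rule finite_lists_length_eq) simp

lemma card_step_seqs: "card (step_seqs d n) = (2 * d) ^ n"
  unfolding step_seqs_def by (subst card_lists_length_eq) auto

lemma path_of_snoc: "path_of N x (ss @ [s]) = path_of N x ss @ [walk_step N (last (path_of N x ss)) s]"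
proof (induction ss arbitrary: x)
  case (Cons a ss)
  have "path_of N (walk_step N x a) ss \<noteq> []" by (cases ss) auto
  then show ?case using Cons by simp
qed simp

lemma torus_walk_Suc: "torus_walk N b \<omega> (Suc n) = walk_step N (torus_walk N b \<omega> n) (\<omega> n)"
  by (auto simp: torus_walk_def walk_step_def torus_proj_def srw_def mod_add_left_eq add.assoc)

lemma path_of_torus_walk:
  assumes "b \<in> torus d N"
  shows "path_of N b (map \<omega> [0..<n]) = map (torus_walk N b \<omega>) [0..<Suc n]"
proof (induction n)
  case 0
  have "torus_walk N b \<omega> 0 i = b i" for i
    using assms by (cases "i < d") (auto simp: torus_walk_def torus_proj_def srw_def torus_def)
  then show ?case by (simp add: fun_eq_iff)
next
  case (Suc n)
  have "map \<omega> [0..<Suc n] = map \<omega> [0..<n] @ [\<omega> n]" by simp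
  then have "path_of N b (map \<omega> [0..<Suc n]) =
     path_of N b (map \<omega> [0..<n]) @ [walk_step N (last (path_of N b (map \<omega> [0..<n]))) (\<omega> n)]"
    by (simp only: path_of_snoc)
  also have "\<dots> = map (torus_walk N b \<omega>) [0..<Suc n] @ [torus_walk N b \<omega> (Suc n)]"
    unfolding Suc torus_walk_Suc by simp
  finally show ?case by simp
qed

lemma (in torus_chain) EE_step_seqs:
  assumes "x \<in> V"
  shows "EE n x f = (\<Sum>ss\<in>step_seqs d n. f (path_of N x ss)) / (2 * real d) ^ n"
  using assms
proof (induction n arbitrary: x f)
  case 0
  have "step_seqs d 0 = {[]}" by (auto simp: step_seqs_def)
  then show ?case by simp
next
  case (Suc n)
  have st: "step_seqs d (Suc n) = (\<lambda>(s, ss). s # ss) ` (srw_steps d \<times> step_seqs d n)"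
    by (auto simp: step_seqs_def length_Suc_conv)
  have "(\<Sum>ss\<in>step_seqs d (Suc n). f (path_of N x ss)) =
      (\<Sum>(s, ss)\<in>srw_steps d \<times> step_seqs d n. f (x # path_of N (walk_step N x s) ss))"
    unfolding st by (subst sum.reindex) (auto simp: inj_on_def intro!: sum.cong)
  also have "\<dots> = (\<Sum>s\<in>srw_steps d. \<Sum>ss\<in>step_seqs d n. f (x # path_of N (walk_step N x s) ss))"
    by (rule sum.cartesian_product[symmetric])
  finally have 1: "(\<Sum>ss\<in>step_seqs d (Suc n). f (path_of N x ss)) = \<dots>" .
  have "EE (Suc n) x f = (\<Sum>s\<in>srw_steps d. EE n (walk_step N x s) (\<lambda>l. f (x # l))) / (2 * real d)"
    using torus_kernel_sum[OF N_pos Suc.prems] by simp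
  also have "\<dots> = (\<Sum>s\<in>srw_steps d. (\<Sum>ss\<in>step_seqs d n. f (x # path_of N (walk_step N x s) ss)) / (2 * real d) ^ n) / (2 * real d)"
    using Suc.IH walk_step_in_torus[OF N_pos Suc.prems] by simp
  also have "\<dots> = (\<Sum>ss\<in>step_seqs d (Suc n). f (path_of N x ss)) / (2 * real d) ^ Suc n"
    unfolding 1 by (simp add: sum_divide_distrib[symmetric] mult.commute)
  finally show ?case .
qed

lemma srw_cylinder:
  assumes d: "d > 0"
  shows "{\<omega>. map \<omega> [0..<n] = ss} \<in> sets (srw_space d)"
    and "ss \<in> step_seqs d n \<Longrightarrow> measure (srw_space d) {\<omega>. map \<omega> [0..<n] = ss} = 1 / (2 * real d) ^ n"
proof -
  let ?p = "\<lambda>_::nat. measure_pmf (pmf_of_set (srw_steps d))"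
  interpret product_prob_space ?p UNIV
    by (intro product_prob_spaceI) (rule measure_pmf.prob_space_axioms)
  have fin: "finite (srw_steps d)" "srw_steps d \<noteq> {}" using d by (auto simp: srw_steps_def)
  have emb: "{\<omega>. map \<omega> [0..<n] = ss} = prod_emb UNIV ?p {..<n} (PiE {..<n} (\<lambda>i. {ss ! i}))"
    if "length ss = n" for ss
  proof -
    have "map \<omega> [0..<n] = ss \<longleftrightarrow> (\<forall>i\<in>{..<n}. \<omega> i \<in> {ss ! i})" for \<omega>
      using that by (auto simp: list_eq_iff_nth_eq)
    then show ?thesis
      unfolding prod_emb_def space_measure_pmf by (simp only: restrict_PiE_iff vimage_def PiE_UNIV_domain) auto
  qed
  show "{\<omega>. map \<omega> [0..<n] = ss} \<in> sets (srw_space d)"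
  proof (cases "length ss = n")
    case True
    show ?thesis unfolding emb[OF True] srw_space_def
      by (intro sets_PiM_I) auto
  next
    case False
    then have "{\<omega>. map \<omega> [0..<n] = ss} = {}" by auto
    then show ?thesis by simp
  qed
  assume ss: "ss \<in> step_seqs d n"
  then have len: "length ss = n" by (simp add: step_seqs_def)
  have "measure (srw_space d) {\<omega>. map \<omega> [0..<n] = ss} = (\<Prod>i<n. measure (?p i) {ss ! i})"
    unfolding emb[OF len] srw_space_def by (rule measure_PiM_emb) auto
  also have "\<dots> = (\<Prod>i<n. 1 / (2 * real d))"
  proof (rule prod.cong[OF refl])
    fix i assume "i \<in> {..<n}"
    then have "ss ! i \<in> set ss" using len by simp
    then have "ss ! i \<in> srw_steps d" using ss unfolding step_seqs_def by blast
    then show "measure (?p i) {ss ! i} = 1 / (2 * real d)"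
      using fin by (simp add: measure_pmf_single)
  qed
  finally show "measure (srw_space d) {\<omega>. map \<omega> [0..<n] = ss} = 1 / (2 * real d) ^ n"
    by (simp add: power_one_over)
qed

text \<open>Passing to the complement avoids outcomes with entries outside
  \<open>srw_steps d\<close>: the cylinders of admissible sequences violating \<open>Q\<close> are
  disjoint, and 1 minus their total is the bound. Measurability is a countable union of
  cylinders.\<close>

lemma measure_srw_le:
  assumes d: "d > 0"
  shows "measure (srw_space d) {\<omega>. Q (map \<omega> [0..<n])} \<le> (\<Sum>ss\<in>step_seqs d n. of_bool (Q ss)) / (2 * real d) ^ n"
    and "{\<omega>. Q (map \<omega> [0..<n])} \<in> sets (srw_space d)"
proof -
  interpret prob_space "srw_space d" by (rule prob_space_srw_space)
  let ?C = "\<lambda>ss. {\<omega>. map \<omega> [0..<n] = ss}"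
  let ?c = "1 / (2 * real d) ^ n"
  have sets: "{\<omega>. Q (map \<omega> [0..<n])} \<in> sets (srw_space d)" for Q
  proof -
    have "{\<omega>. Q (map \<omega> [0..<n])} = (\<Union>ss\<in>{ss. Q ss}. ?C ss)" by auto
    also have "\<dots> \<in> sets (srw_space d)"
      by (rule sets.countable_UN') (use srw_cylinder(1)[OF d] in auto)
    finally show ?thesis .
  qed
  then show "{\<omega>. Q (map \<omega> [0..<n])} \<in> sets (srw_space d)" .
  let ?W = "{ss \<in> step_seqs d n. \<not> Q ss}"
  have "prob (\<Union>ss\<in>?W. ?C ss) = (\<Sum>ss\<in>?W. prob (?C ss))"
    using finite_step_seqs by (intro finite_measure_finite_Union) (auto simp: disjoint_family_on_def srw_cylinder(1) d)
  also have "\<dots> = (\<Sum>ss\<in>?W. ?c)" using srw_cylinder(2)[OF d] by (intro sum.cong) auto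
  finally have W: "prob (\<Union>ss\<in>?W. ?C ss) = (\<Sum>ss\<in>?W. ?c)" .
  have "prob (\<Union>ss\<in>?W. ?C ss) \<le> prob {\<omega>. \<not> Q (map \<omega> [0..<n])}"
    by (intro finite_measure_mono sets) auto
  also have "{\<omega>. \<not> Q (map \<omega> [0..<n])} = space (srw_space d) - {\<omega>. Q (map \<omega> [0..<n])}" by auto
  also have "prob \<dots> = 1 - prob {\<omega>. Q (map \<omega> [0..<n])}" by (rule prob_compl[OF sets])
  finally have le: "prob {\<omega>. Q (map \<omega> [0..<n])} \<le> 1 - (\<Sum>ss\<in>?W. ?c)" using W by linarith
  have one: "(1::real) = (\<Sum>ss\<in>step_seqs d n. ?c)" using d by (simp add: card_step_seqs)
  have "(\<Sum>ss\<in>step_seqs d n. ?c) - (\<Sum>ss\<in>?W. ?c) = (\<Sum>ss\<in>step_seqs d n - ?W. ?c)"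
    using finite_step_seqs by (intro sum_diff[symmetric]) auto
  also have "\<dots> = (\<Sum>ss\<in>step_seqs d n. of_bool (Q ss) * ?c)"
    using finite_step_seqs by (intro sum.mono_neutral_cong_left) auto
  also have "\<dots> = (\<Sum>ss\<in>step_seqs d n. of_bool (Q ss)) * ?c" by (rule sum_distrib_right[symmetric])
  also have "\<dots> = (\<Sum>ss\<in>step_seqs d n. of_bool (Q ss)) / (2 * real d) ^ n" by simp
  finally show "prob {\<omega>. Q (map \<omega> [0..<n])} \<le> (\<Sum>ss\<in>step_seqs d n. of_bool (Q ss)) / (2 * real d) ^ n"
    using le one by linarith
qed

lemma walk_loop_erasure_hit:
  assumes n: "n \<le> M" "torus_walk N b \<omega> n = e" and long: "\<kappa> < real (length (walk_loop_erasure N b e \<omega>))"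
  shows "\<exists>n\<le>M. map (torus_walk N b \<omega>) [0..<Suc M] ! n = e \<and>
     \<kappa> < real (length (LE (take (Suc n) (map (torus_walk N b \<omega>) [0..<Suc M]))))"
proof -
  define \<tau> where "\<tau> = hitting_time (torus_walk N b \<omega>) e"
  have "torus_walk N b \<omega> \<tau> = e" unfolding \<tau>_def hitting_time_def 
    by (rule LeastI[where P = "\<lambda>n. torus_walk N b \<omega> n = e", OF n(2)])
  moreover have \<tau>: "\<tau> \<le> M" unfolding \<tau>_def hitting_time_def 
    using Least_le[where P = "\<lambda>n. torus_walk N b \<omega> n = e", OF n(2)] n(1) by (rule le_trans)
  moreover have "take (Suc \<tau>) (map (torus_walk N b \<omega>) [0..<Suc M]) = map (torus_walk N b \<omega>) [0..<Suc \<tau>]"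
    unfolding take_map using \<tau> by (subst take_upt) (auto simp del: upt_Suc)
  moreover have "\<kappa> < real (length (LE (map (torus_walk N b \<omega>) [0..<Suc \<tau>])))"
    using long unfolding walk_loop_erasure_def loop_erasure_eq_LE \<tau>_def .
  ultimately show ?thesis
    by (intro exI[of _ \<tau>]) (simp del: upt_Suc)
qed

lemma (in torus_chain) walk_loop_erasure_tail:
  assumes L: "0 \<le> L" "(\<Sum>n = 1..<N\<^sup>2. real n / sqrt (real n) ^ d) \<le> L"
    and b: "b \<in> V" and e: "e \<in> V" and t: "0 < t"
  shows "measure (srw_space d) {\<omega>. t * (2 * real (scale L) ^ 47 * sqrt (real N ^ d)) < real (length (walk_loop_erasure N b e \<omega>))}
    \<le> (3 * (1 + 576 * fact 46)) * exp (- t)"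
proof -
  interpret S: prob_space "srw_space d" by (rule prob_space_srw_space)
  interpret lerw_chain V "torus_kernel d N" g "scale L" "real N ^ d" root_vol
    by (rule lerw_chain_torus[OF L])
  let ?\<kappa> = "t * (2 * real (scale L) ^ 47 * sqrt (real N ^ d))"
  show ?thesis
  proof (cases "1 \<le> t")
    \<comment> \<open>For \<open>t < 1\<close> the bound is at least 1; this is where the factor 3
      comes from.\<close>
    case False
    have "1 \<le> 3 * exp (- t)"
    proof -
      have "exp t \<le> exp 1" using False by simp
      then have "exp t \<le> 3" using exp_le by linarith
      then show ?thesis by (simp add: exp_minus field_simps)
    qed
    also have "\<dots> \<le> (3 * (1 + 576 * fact 46)) * exp (- t)"
      by (intro mult_right_mono) auto
    finally show ?thesis using S.prob_le_1 by (rule order.trans[rotated])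
  next
    case True
    let ?\<kappa>' = "t * real (scale L) ^ 47 * real root_vol"
    obtain M where M: "EE M b (\<lambda>l. of_bool (e \<notin> set l \<or>
        (\<exists>n\<le>M. l ! n = e \<and> ?\<kappa>' < real (length (LE (take (Suc n) l))))))
      \<le> (1 + 576 * fact 46) * exp (- t)"
      using hitting_loop_erasure_tail[OF b e True] by blast
    define Q where "Q l \<longleftrightarrow> e \<notin> set l \<or> (\<exists>n\<le>M. l ! n = e \<and> ?\<kappa>' < real (length (LE (take (Suc n) l))))" for l
    define B where "B = {\<omega>. Q (path_of N b (map \<omega> [0..<M]))}"
    have \<kappa>: "?\<kappa>' \<le> ?\<kappa>"
      using mult_left_mono[OF root_vol(2), of "t * real (scale L) ^ 47"] t by (simp add: mult_ac)
    have "{\<omega>. ?\<kappa> < real (length (walk_loop_erasure N b e \<omega>))} \<subseteq> B"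
    proof
      fix \<omega> assume "\<omega> \<in> {\<omega>. ?\<kappa> < real (length (walk_loop_erasure N b e \<omega>))}"
      then have long: "?\<kappa>' < real (length (walk_loop_erasure N b e \<omega>))"
        using \<kappa> by simp
      have "Q (map (torus_walk N b \<omega>) [0..<Suc M])"
      proof (cases "e \<in> set (map (torus_walk N b \<omega>) [0..<Suc M])")
        case True
        then obtain n where "n \<in> {0..<Suc M}" "torus_walk N b \<omega> n = e"
          unfolding set_map set_upt by (metis imageE)
        then have "n \<le> M" "torus_walk N b \<omega> n = e" by auto
        from walk_loop_erasure_hit[OF this long] show ?thesis unfolding Q_def by (rule disjI2)
      next
        case False
        then show ?thesis unfolding Q_def by (rule disjI1)
      qed
      then show "\<omega> \<in> B"
        by (simp only: B_def mem_Collect_eq path_of_torus_walk[OF b])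
    qed
    moreover have "B \<in> sets (srw_space d)"
      unfolding B_def by (rule measure_srw_le(2)) (use d_ge in simp)
    ultimately have "measure (srw_space d) {\<omega>. ?\<kappa> < real (length (walk_loop_erasure N b e \<omega>))}
      \<le> measure (srw_space d) B"
      by (rule S.finite_measure_mono)
    also have "\<dots> \<le> (\<Sum>ss\<in>step_seqs d M. of_bool (Q (path_of N b ss))) / (2 * real d) ^ M"
      unfolding B_def by (rule measure_srw_le(1)) (use d_ge in simp)
    also have "\<dots> = EE M b (\<lambda>l. of_bool (Q l))" by (rule EE_step_seqs[OF b, symmetric])
    also have "\<dots> \<le> (1 + 576 * fact 46) * exp (- t)" unfolding Q_def by (rule M)
    also have "\<dots> \<le> (3 * (1 + 576 * fact 46)) * exp (- t)"
      by (intro mult_right_mono) auto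
    finally show ?thesis .
  qed
qed

section \<open>Growth of the return sums and of powers of the logarithm\<close>

lemma one_plus_ln_power_le:
  assumes N: "1 \<le> (x::real)" and \<epsilon>: "0 < \<epsilon>" and k: "0 < k"
  shows "(1 + ln x) ^ k \<le> (1 + real k / \<epsilon>) ^ k * x powr \<epsilon>"
proof -
  define \<delta> where "\<delta> = \<epsilon> / real k"
  have \<delta>: "0 < \<delta>" using \<epsilon> k by (simp add: \<delta>_def)
  have p1: "1 \<le> x powr \<delta>" using N \<delta> by (intro ge_one_powr_ge_zero) auto
  have "\<delta> * ln x = ln (x powr \<delta>)" using N by (simp add: ln_powr)
  also have "\<dots> \<le> x powr \<delta>" using ln_le_minus_one[of "x powr \<delta>"] p1 by linarith
  finally have "ln x \<le> (1 / \<delta>) * x powr \<delta>" using \<delta> by (simp add: field_simps)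
  then have "1 + ln x \<le> (1 + 1 / \<delta>) * x powr \<delta>" using p1 by (simp add: distrib_right)
  moreover have "0 \<le> ln x" using N by simp
  ultimately have "(1 + ln x) ^ k \<le> ((1 + 1 / \<delta>) * x powr \<delta>) ^ k"
    by (intro power_mono) auto
  also have "\<dots> = (1 + real k / \<epsilon>) ^ k * x powr \<epsilon>"
    using k N by (simp add: power_mult_distrib \<delta>_def powr_power)
  finally show ?thesis .
qed

lemma sum_inverse_le_ln: "1 \<le> N \<Longrightarrow> (\<Sum>n = 1..<N\<^sup>2. 1 / real n) \<le> 1 + 2 * ln (real N)"
proof -
  assume N: "1 \<le> N"
  have h: "(\<Sum>n = 1..m. 1 / real n) \<le> 1 + ln (real m)" if "1 \<le> m" for m
    using that
  proof (induction m rule: dec_induct)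
    case (step m)
    have m0: "0 < real m" using step by simp
    have "1 / real (Suc m) \<le> ln (real (Suc m)) - ln (real m)"
    proof -
      have "ln (real m / real (Suc m)) \<le> real m / real (Suc m) - 1"
        using m0 by (intro ln_le_minus_one) simp
      also have "\<dots> = - (1 / real (Suc m))" by (simp add: field_simps)
      finally show ?thesis using m0 by (simp add: ln_div)
    qed
    then show ?case using step by simp
  qed simp
  have "(\<Sum>n = 1..<N\<^sup>2. 1 / real n) \<le> (\<Sum>n = 1..N\<^sup>2. 1 / real n)" by (intro sum_mono2) auto
  also have "\<dots> \<le> 1 + ln (real (N\<^sup>2))" using N by (intro h) simp
  also have "\<dots> = 1 + 2 * ln (real N)" using N by (simp add: ln_realpow)
  finally show ?thesis .
qed

text \<open>The summand is n^(1 - d/2), and \<open>d \<ge> 5\<close> makes the exponent at most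
  -3/2.\<close>

lemma bubble_sum_bounded:
  assumes d: "4 < d"
  shows "\<exists>L\<ge>0. \<forall>N. (\<Sum>n = 1..<N\<^sup>2. real n / sqrt (real n) ^ d) \<le> L"
proof -
  have s: "summable (\<lambda>n. real n powr (- 3 / 2))" by (subst summable_real_powr_iff) simp
  have "(\<Sum>n = 1..<N\<^sup>2. real n / sqrt (real n) ^ d) \<le> (\<Sum>n. real n powr (- 3 / 2))" for N
  proof -
    have "(\<Sum>n = 1..<N\<^sup>2. real n / sqrt (real n) ^ d) \<le> (\<Sum>n = 1..<N\<^sup>2. real n powr (- 3 / 2))"
    proof (rule sum_mono)
      fix n assume "n \<in> {1..<N\<^sup>2}"
      then have n: "1 \<le> real n" by simp
      then have "sqrt (real n) ^ 5 \<le> sqrt (real n) ^ d" using d by (intro power_increasing) auto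
      then have "real n / sqrt (real n) ^ d \<le> real n / sqrt (real n) ^ 5"
        using n by (intro divide_left_mono) auto
      also have "sqrt (real n) ^ 5 = real n powr (5 / 2)"
        using n by (simp add: powr_half_sqrt[symmetric] powr_power)
      also have "real n / real n powr (5 / 2) = real n powr 1 / real n powr (5 / 2)"
        using n by simp
      also have "\<dots> = real n powr (- 3 / 2)"
        unfolding powr_diff[symmetric] by simp
      finally show "real n / sqrt (real n) ^ d \<le> real n powr (- 3 / 2)" .
    qed
    also have "\<dots> \<le> (\<Sum>n. real n powr (- 3 / 2))" by (intro sum_le_suminf s) auto
    finally show ?thesis .
  qed
  moreover have "0 \<le> (\<Sum>n. real n powr (- 3 / 2))" by (intro suminf_nonneg s) simp
  ultimately show ?thesis by blast
qed

text \<open>Substituting \<open>t * w / K\<close> for \<open>t\<close> moves the constant from the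
  length scale into the exponent. The room \<open>w\<close> is N^\<epsilon> in dimension 4 and 1
  otherwise.\<close>

lemma tail_rescale:
  assumes "\<And>t. 0 < t \<Longrightarrow> measure M {\<omega>. t * (K * s) < X \<omega>} \<le> C * exp (- t)"
    and "s' = s * w" and "K \<le> K' * w" and "0 < K" "0 < K'" "0 < w" "0 \<le> C" "0 \<le> s" and t: "0 < t"
  shows "measure M {\<omega>. t * s' < X \<omega>} \<le> C * exp (- (1 / K') * (t::real))"
proof -
  have "measure M {\<omega>. (t * w / K) * (K * s) < X \<omega>} \<le> C * exp (- (t * w / K))"
    using assms by (intro assms(1)) simp
  also have "(t * w / K) * (K * s) = t * s'" using assms by simp
  also have "C * exp (- (t * w / K)) \<le> C * exp (- (1 / K') * t)"
  proof -
    have "1 / K' \<le> w / K" using assms by (simp add: field_simps)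
    then have "1 / K' * t \<le> w / K * t" using t by (intro mult_right_mono) auto
    then have "exp (- (t * w / K)) \<le> exp (- (1 / K') * t)" by (simp add: mult.commute)
    then show ?thesis using assms by (intro mult_left_mono) auto
  qed
  finally show ?thesis .
qed

theorem theorem1:
  shows
    "(\<forall>d::nat. d > 4 \<longrightarrow>
       (\<exists>C c :: real. C > 0 \<and> c > 0 \<and>
         (\<forall>N::nat. N > 0 \<longrightarrow>
           (\<forall>b\<in>torus d N. \<forall>e\<in>torus d N. \<forall>t::real. t > 0 \<longrightarrow>
             measure (srw_space d)
               {\<omega> \<in> space (srw_space d).
                  real (length (walk_loop_erasure N b e \<omega>)) > t * real N powr (real d / 2)}
             \<le> C * exp (- c * t)))))
     \<and>
     (\<forall>\<epsilon>::real. \<epsilon> > 0 \<longrightarrow>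
       (\<exists>C c :: real. C > 0 \<and> c > 0 \<and>
         (\<forall>N::nat. N > 0 \<longrightarrow>
           (\<forall>b\<in>torus 4 N. \<forall>e\<in>torus 4 N. \<forall>t::real. t > 0 \<longrightarrow>
             measure (srw_space 4)
               {\<omega> \<in> space (srw_space 4).
                  real (length (walk_loop_erasure N b e \<omega>)) > t * real N powr (2 + \<epsilon>)}
             \<le> C * exp (- c * t)))))"
proof (intro conjI allI impI)
  fix d :: nat assume d: "4 < d"
  obtain L where L: "0 \<le> L" "\<And>N. (\<Sum>n = 1..<N\<^sup>2. real n / sqrt (real n) ^ d) \<le> L"
    using bubble_sum_bounded[OF d] by blast
  have chain: "torus_chain d N" if "0 < N" for N
    using that d by unfold_locales auto
  \<comment> \<open>\<open>scale\<close> involves \<open>d\<close> and \<open>L\<close> but not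
    \<open>N\<close>, so \<open>K\<close> is fixed before the torus is chosen.\<close>
  define K where "K = 2 * real (torus_chain.scale d L) ^ 47"
  have K: "0 < K"
  proof -
    \<comment> \<open>Any torus would do here, since just the positivity of \<open>scale\<close> is
      read off.\<close>
    interpret torus_chain d 1 by (rule chain) simp
    interpret lerw_chain V "torus_kernel d 1" g "scale L" "real 1 ^ d" root_vol
      by (rule lerw_chain_torus[OF L])
    show ?thesis using h_pos by (simp add: K_def)
  qed
  show "\<exists>C c :: real. C > 0 \<and> c > 0 \<and>
         (\<forall>N::nat. N > 0 \<longrightarrow>
           (\<forall>b\<in>torus d N. \<forall>e\<in>torus d N. \<forall>t::real. t > 0 \<longrightarrow>
             measure (srw_space d)
               {\<omega> \<in> space (srw_space d).
                  real (length (walk_loop_erasure N b e \<omega>)) > t * real N powr (real d / 2)}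
             \<le> C * exp (- c * t)))"
  proof (rule exI[of _ "3 * (1 + 576 * fact 46)"], rule exI[of _ "1 / K"], intro conjI allI impI ballI)
    fix N :: nat and b e and t :: real
    assume N: "0 < N" and b: "b \<in> torus d N" and e: "e \<in> torus d N" and t: "0 < t"
    interpret torus_chain d N by (rule chain[OF N])
    have s: "real N powr (real d / 2) = sqrt (real N ^ d) * 1"
      using N by (simp add: powr_half_sqrt[symmetric] powr_powr flip: powr_realpow)
    have tl: "measure (srw_space d) {\<omega>. t * (K * sqrt (real N ^ d)) < real (length (walk_loop_erasure N b e \<omega>))}
        \<le> 3 * (1 + 576 * fact 46) * exp (- t)" if "0 < t" for t
      unfolding K_def by (rule walk_loop_erasure_tail[OF L b e that])
    have "measure (srw_space d) {\<omega>. t * real N powr (real d / 2) < real (length (walk_loop_erasure N b e \<omega>))}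
        \<le> 3 * (1 + 576 * fact 46) * exp (- (1 / K) * t)"
      by (rule tail_rescale[OF tl s, of K]) (use K t in auto)
    then show "measure (srw_space d) {\<omega> \<in> space (srw_space d). t * real N powr (real d / 2) < real (length (walk_loop_erasure N b e \<omega>))}
        \<le> 3 * (1 + 576 * fact 46) * exp (- (1 / K) * t)"
      by (simp only: space_srw_space UNIV_I simp_thms)
  qed (use K in \<open>auto intro!: add_pos_pos\<close>)
next
  fix \<epsilon> :: real assume \<epsilon>: "0 < \<epsilon>"
  have chain: "torus_chain 4 N" if "0 < N" for N
    using that by unfold_locales auto
  define L where "L N = 1 + 2 * ln (real N)" for N :: nat
  have L: "0 \<le> L N" "(\<Sum>n = 1..<N\<^sup>2. real n / sqrt (real n) ^ 4) \<le> L N" if "0 < N" for N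
  proof -
    have "real n / sqrt (real n) ^ 4 = 1 / real n" for n
      by (simp add: power4_eq_xxxx power2_eq_square[symmetric])
    then show "0 \<le> L N" "(\<Sum>n = 1..<N\<^sup>2. real n / sqrt (real n) ^ 4) \<le> L N"
      using sum_inverse_le_ln[of N] that by (auto simp: L_def)
  qed
  \<comment> \<open>1001 is the 1000 of \<open>scale\<close> plus 1 for rounding up, and the last
    term comes from \<open>2 * Cd * L N\<close>, as \<open>L N\<close> is at most
    \<open>2 * (1 + ln N)\<close>.\<close>
  define A where "A = 1001 + torus_chain.Cd 4 * 4 + (1 + real (torus_chain.c\<^sub>1 4))\<^sup>2 * torus_chain.Cd 4 + 4 * torus_chain.Cd 4"
  have A: "1 \<le> A" and scale: "\<And>N. 0 < N \<Longrightarrow> real (torus_chain.scale 4 (L N)) \<le> A * (1 + ln (real N))"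
  proof -
    interpret torus_chain 4 1 by (rule chain) simp
    have nn: "0 \<le> Cd" "0 \<le> (1 + real c\<^sub>1)\<^sup>2 * Cd" using Cd_ge by auto
    then show "1 \<le> A" by (simp add: A_def)
    fix N :: nat assume N: "0 < N"
    have l: "0 \<le> ln (real N)" using N by simp
    let ?B = "1000 + Cd * 4 + (1 + real c\<^sub>1)\<^sup>2 * Cd"
    have B0: "0 \<le> ?B + 1" using nn by linarith
    have "0 \<le> ?B + 2 * Cd * L N" using nn L(1)[OF N] by (intro add_nonneg_nonneg) auto
    moreover have "real (nat \<lceil>x\<rceil>) \<le> x + 1" if "0 \<le> x" for x :: real
      using that by linarith
    moreover have "scale (L N) = nat \<lceil>?B + 2 * Cd * L N\<rceil>" by (simp add: scale_def)
    ultimately have "real (scale (L N)) \<le> ?B + 2 * Cd * L N + 1"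
      by (simp only:)
    also have "\<dots> = (?B + 1) * 1 + 2 * Cd * L N" by simp
    also have "\<dots> \<le> (?B + 1) * (1 + ln (real N)) + 4 * Cd * (1 + ln (real N))"
    proof (rule add_mono)
      show "(?B + 1) * 1 \<le> (?B + 1) * (1 + ln (real N))" using l B0 by (intro mult_left_mono) auto
      show "2 * Cd * L N \<le> 4 * Cd * (1 + ln (real N))"
        using nn by (simp add: L_def algebra_simps)
    qed
    also have "\<dots> = A * (1 + ln (real N))" by (simp add: A_def algebra_simps)
    finally show "real (torus_chain.scale 4 (L N)) \<le> A * (1 + ln (real N))" .
  qed
  \<comment> \<open>The 47 powers of \<open>scale\<close> cost 47 powers of \<open>1 + ln N\<close>,
    which \<open>one_plus_ln_power_le\<close> trades for N^\<epsilon> and the second factor.\<close>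
  define K where "K = 2 * (A ^ 47 * (1 + 47 / \<epsilon>) ^ 47)"
  have "0 < 1 + 47 / \<epsilon>" using \<epsilon> by (intro add_pos_pos) auto
  then have K: "0 < K" using A unfolding K_def by (intro mult_pos_pos zero_less_power) auto
  show "\<exists>C c :: real. C > 0 \<and> c > 0 \<and>
         (\<forall>N::nat. N > 0 \<longrightarrow>
           (\<forall>b\<in>torus 4 N. \<forall>e\<in>torus 4 N. \<forall>t::real. t > 0 \<longrightarrow>
             measure (srw_space 4)
               {\<omega> \<in> space (srw_space 4).
                  real (length (walk_loop_erasure N b e \<omega>)) > t * real N powr (2 + \<epsilon>)}
             \<le> C * exp (- c * t)))"
  proof (rule exI[of _ "3 * (1 + 576 * fact 46)"], rule exI[of _ "1 / K"], intro conjI allI impI ballI)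
    fix N :: nat and b e and t :: real
    assume N: "0 < N" and b: "b \<in> torus 4 N" and e: "e \<in> torus 4 N" and t: "0 < t"
    interpret torus_chain 4 N by (rule chain[OF N])
    interpret lerw_chain V "torus_kernel 4 N" g "scale (L N)" "real N ^ 4" root_vol
      by (rule lerw_chain_torus[OF L[OF N]])
    have s: "real N powr (2 + \<epsilon>) = sqrt (real N ^ 4) * real N powr \<epsilon>"
    proof -
      have "real N ^ 4 = ((real N)\<^sup>2)\<^sup>2" by (simp flip: power_mult)
      then have "sqrt (real N ^ 4) = (real N)\<^sup>2" by (metis real_sqrt_abs abs_power2)
      then show ?thesis using N by (simp add: powr_add)
    qed
    have sc: "2 * real (scale (L N)) ^ 47 \<le> K * real N powr \<epsilon>"
    proof -
      have "real (scale (L N)) ^ 47 \<le> (A * (1 + ln (real N))) ^ 47"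
        by (intro power_mono scale[OF N]) simp
      also have "\<dots> = A ^ 47 * (1 + ln (real N)) ^ 47" by (rule power_mult_distrib)
      also have "\<dots> \<le> A ^ 47 * ((1 + real 47 / \<epsilon>) ^ 47 * real N powr \<epsilon>)"
        using A N by (intro mult_left_mono one_plus_ln_power_le \<epsilon>) auto
      finally show ?thesis by (simp add: K_def mult_ac)
    qed
    have "measure (srw_space 4) {\<omega>. t * real N powr (2 + \<epsilon>) < real (length (walk_loop_erasure N b e \<omega>))}
        \<le> 3 * (1 + 576 * fact 46) * exp (- (1 / K) * t)"
    proof (rule tail_rescale[OF walk_loop_erasure_tail[OF L[OF N] b e] s sc])
      show "0 < 2 * real (scale (L N)) ^ 47" using h_pos by simp
      show "0 < real N powr \<epsilon>" using N by simp
    qed (use K t in auto)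
    then show "measure (srw_space 4) {\<omega> \<in> space (srw_space 4). t * real N powr (2 + \<epsilon>) < real (length (walk_loop_erasure N b e \<omega>))}
        \<le> 3 * (1 + 576 * fact 46) * exp (- (1 / K) * t)"
      by (simp only: space_srw_space UNIV_I simp_thms)
  qed (use K in \<open>auto intro!: add_pos_pos\<close>)
qed

end
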